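(* For every $\epsilon\in\mathbb{C}$ with $|\epsilon|<0.1$, the density of visible points of $\mathcal{P}_\epsilon$ is $$\theta(\widehat{\mathcal{P}_\epsilon})=\frac{(3+\tau)\,\mathrm{vol}(\mathcal{W}_1)-\mathrm{vol}\big(\mathcal{W}_1\cap(\mathcal{W}_1+\tau\epsilon)\big)}{3(\tau+2)\,\zeta_K(2)}.$$
   Context: Identify $\mathbb{C}$ with $\mathbb{R}^2$. For a locally finite set $\mathcal{P}\subset\mathbb{R}^d$, the set of visible points is $\widehat{\mathcal{P}}=\{x\in\mathcal{P}\mid tx\notin\mathcal{P}\ \forall t\in(0,1)\}$. $\mathcal{P}$ has density $\theta(\mathcal{P})$ if $\lim_{T\to\infty}\#(\mathcal{P}\cap TD)/\mathrm{vol}(TD)=\theta(\mathcal{P})$ for every Jordan measurable $D\subset\mathbb{R}^d$ with $\mathrm{vol}(D)>0$. Let $\zeta=e^{2\pi i/5}$, $\tau=\frac{1+\sqrt5}{2}$, $K=\mathbb{Q}(\zeta)\cap\mathbb{R}=\mathbb{Q}(\tau)$, with Dedekind zeta function $\zeta_K$. Let $\sigma$ be the automorphism of $\mathbb{Q}(\zeta)$ with $\sigma(\zeta)=\zeta^2$, and $\kappa:\mathbb{Z}[\zeta]\to\mathbb{Z}/5\mathbb{Z}$ the ring homomorphism with $\kappa(\zeta)=1$. Let $\mathcal{W}_1$ be the interior of the convex hull of $\{1,\zeta,\zeta^2,\zeta^3,\zeta^4\}$ in $\mathbb{C}$, and for $\epsilon\in\mathbb{C}$ set $\mathcal{W}_{1,\epsilon}=\mathcal{W}_1+\epsilon$,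 $\mathcal{W}_{2,\epsilon}=-\tau\mathcal{W}_1+\epsilon$, $\mathcal{W}_{3,\epsilon}=\tau\mathcal{W}_1+\epsilon$, $\mathcal{W}_{4,\epsilon}=-\mathcal{W}_1+\epsilon$. Define $$\mathcal{P}_\epsilon=\bigcup_{k=1}^4\{x\in\mathbb{Z}[\zeta]\mid\kappa(x)=k,\ \sigma(x)\in\mathcal{W}_{k,\epsilon}\}.$$ *)

theory Defs
  imports
    "HOL-Analysis.Analysis"
    "HOL-Algebra.Algebra"
    "HOL-Algebra.Algebraic_Closure_Type"
    "HOL-Number_Theory.Residues"
begin

section \<open>Visible points and density\<close>

definition locally_finite :: "'a::euclidean_space set \<Rightarrow> bool" where
  "locally_finite P \<longleftrightarrow> (\<forall>B. bounded B \<longrightarrow> finite (P \<inter> B))"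

definition visible_points :: "'a::real_vector set \<Rightarrow> 'a set" where
  "visible_points P = {x \<in> P. \<forall>t\<in>{0<..<1}. t *\<^sub>R x \<notin> P}"

definition jordan_measurable :: "'a::euclidean_space set \<Rightarrow> bool" where
  "jordan_measurable D \<longleftrightarrow> bounded D \<and> negligible (frontier D)"

text \<open>
  Density is only defined for locally finite sets; this also guarantees that \<^const>\<open>card\<close> is
  never applied to an infinite set. Jordan measurable sets need not be Borel, so volumes are
  taken with respect to \<^const>\<open>lebesgue\<close>.
\<close>

definition has_density :: "'a::euclidean_space set \<Rightarrow> real \<Rightarrow> bool" where
  "has_density P \<theta> \<longleftrightarrow> locally_finite P \<and>
     (\<forall>D. jordan_measurable D \<and> measure lebesgue D > 0 \<longrightarrow>
       ((\<lambda>T::real. real (card (P \<inter> (*\<^sub>R) T ` D)) / measure lebesgue ((*\<^sub>R) T ` D))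
          \<longlongrightarrow> \<theta>) at_top)"


section \<open>Dedekind zeta functions of subfields of the complex numbers\<close>

definition subring_of_complex :: "complex set \<Rightarrow> complex ring" where
  "subring_of_complex S = ring_of_type_algebra\<lparr>carrier := S\<rparr>"

definition ring_of_integers :: "complex set \<Rightarrow> complex ring" where
  "ring_of_integers F = subring_of_complex {x \<in> F. algebraic_int x}"

definition ideal_norm :: "complex set \<Rightarrow> complex set \<Rightarrow> nat" where
  "ideal_norm F I = card (carrier (ring_of_integers F Quot I))"

text \<open>The Dirichlet series, for a number field \<open>F\<close> and real \<open>s > 1\<close>, where it converges.\<close>

definition dedekind_zeta :: "complex set \<Rightarrow> real \<Rightarrow> real" where
  "dedekind_zeta F s =
     (\<Sum>\<^sub>\<infinity>I\<in>{I. ideal I (ring_of_integers F) \<and> I \<noteq> {0}}. 1 / real (ideal_norm F I) powr s)"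


section \<open>The point sets\<close>

definition zeta5 :: complex where
  "zeta5 = exp (2 * of_real pi * \<i> / 5)"

definition golden :: real where
  "golden = (1 + sqrt 5) / 2"

definition Z_zeta5 :: "complex set" where
  "Z_zeta5 = generate_ring ring_of_type_algebra {zeta5}"

definition Q_zeta5 :: "complex set" where
  "Q_zeta5 = generate_field ring_of_type_algebra {zeta5}"

definition real_subfield :: "complex set" where
  "real_subfield = Q_zeta5 \<inter> \<real>"

text \<open>
  The conditions in the next two definitions determine the map uniquely on \<open>\<rat>(\<zeta>)\<close> and on
  \<open>\<int>[\<zeta>]\<close>, respectively; its values elsewhere are unspecified and never used.
\<close>

definition sigma :: "complex \<Rightarrow> complex" where
  "sigma = (SOME s. s \<in> ring_iso (subring_of_complex Q_zeta5) (subring_of_complex Q_zeta5) \<and>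
                    s zeta5 = zeta5 ^ 2)"

definition kappa :: "complex \<Rightarrow> int" where
  "kappa = (SOME h. h \<in> ring_hom (subring_of_complex Z_zeta5) (residue_ring 5) \<and> h zeta5 = 1)"

definition pentagon :: "complex set" where
  "pentagon = interior (convex hull {1, zeta5, zeta5 ^ 2, zeta5 ^ 3, zeta5 ^ 4})"

definition window :: "nat \<Rightarrow> complex \<Rightarrow> complex set" where
  "window k \<epsilon> =
     (let c = (if k = 1 then 1 else if k = 2 then - golden else if k = 3 then golden else - 1)
      in (\<lambda>w. c *\<^sub>R w + \<epsilon>) ` pentagon)"

definition point_set :: "complex \<Rightarrow> complex set" where
  "point_set \<epsilon> = (\<Union>k\<in>{1..4::nat}. {x \<in> Z_zeta5. kappa x = int k \<and> sigma x \<in> window k \<epsilon>})"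

end

theory Submission
  imports Defs
begin

hide_const (open) Divisibility.prime Divisibility.irreducible Group.Units

text \<open>
  Write \<open>x \<in> \<int>[\<zeta>]\<close> as \<open>a + b \<zeta>\<close> with \<open>a, b \<in> \<int>[\<tau>]\<close>, and call it primitive if \<open>a\<close> and \<open>b\<close> are
  coprime. A real multiple of a primitive point lies in \<open>\<int>[\<zeta>]\<close> only for a factor in \<open>\<int>[\<tau>]\<close>.
  Nonunits of \<open>\<int>[\<tau>]\<close> have norm at least 4 and the windows contain a common disc, so for
  \<open>\<bar>\<epsilon>\<bar> < 0.1\<close> a non-primitive point is always hidden by one of its real multiples; a primitive
  point is hidden exactly if one of its multiples by \<open>1 / \<tau>\<close> and \<open>1 / \<tau>\<^sup>2\<close> belongs to the set. Hence
  the visible points are the primitive points of a cut-and-project set with smaller windows.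

  Points of a cut-and-project set are counted by multiplying with powers of the unit \<open>\<tau>\<close>: this
  preserves the lattice, and turns the region \<open>T D \<times> V\<close> into a dilate by \<open>\<surd>T\<close> of a region of bounded
  shape, where counting reduces to comparing volumes of neighbourhoods. Inclusion-exclusion over
  finite sets of primes (Tannery's theorem) extracts the primitive points; since \<open>\<kappa> \<noteq> 0\<close> excludes the
  prime above 5, this contributes the factor \<open>1 / ((1 - 1/25) \<zeta>\<^sub>K(2))\<close>.
\<close>

section \<open>The ring of integers of the golden field\<close>

text \<open>In the conjugate plane the factor \<open>1 / golden\<close> acts as
  \<open>- golden\<close>, and \<open>kap gphi = 2\<close>: shrinking a point by tau moves class k
  to 2k modulo 5 and multiplies its conjugate coordinate by \<open>- golden\<close>. The windows of
  classes 2 and 3 are exactly \<open>- golden\<close> times those of classes 1 and 4, so for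
  \<epsilon> = 0 all points of classes 1 and 4 are hidden. A nonzero \<epsilon> shifts the hidden
  part against the window by \<open>golden\<close> times \<epsilon>, which is the source of the
  overlap term. The bound 0.1 enters numerically: conjugate coordinates stay below
  \<open>golden + 0.1\<close>, the factor \<open>golden / 4\<close> brings them below 0.7, and
  \<open>golden / 2 - 0.1\<close> still exceeds 0.7, where \<open>golden / 2\<close> is the inradius
  of the pentagon. Limits for each fixed divisor g do not justify the infinite inclusion-exclusion.
  The majorant is a bound \<open>C * wt g\<close> with C independent of both g and T; it rests on
  the fact that a nonzero point of the lattice cannot be small in both planes at once.\<close>

lemma int_square_eq_5_square:
  fixes u v :: int
  assumes "u\<^sup>2 = 5 * v\<^sup>2" shows "v = 0"
proof (rule ccontr)
  assume nz: "v \<noteq> 0"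
  with assms have u: "u \<noteq> 0" by auto
  have 5: "prime_elem (5 :: int)"
    using prime_int_numeral_eq[of "num.Bit1 (num.Bit0 num.One)"] by (intro prime_imp_prime_elem) simp
  \<comment> \<open>The multiplicity of 5 is even on the left and odd on the right.\<close>
  have "multiplicity 5 (u\<^sup>2) = multiplicity 5 (5 * v\<^sup>2)" using assms by (rule arg_cong)
  then have "2 * multiplicity 5 u = 1 + 2 * multiplicity 5 v"
    using 5 nz u
    by (simp add: prime_elem_multiplicity_power_distrib prime_elem_multiplicity_mult_distrib)
  then show False by presburger
qed

text \<open>\<open>Gold m n\<close> represents \<open>m + n \<tau>\<close>; its two real embeddings are \<open>rv\<close> and \<open>rv'\<close> below.\<close>

datatype gold = Gold (gre: int) (gim: int)

lemma gold_eq_iff: "x = y \<longleftrightarrow> gre x = gre y \<and> gim x = gim y"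
  by (auto intro: gold.expand)

instantiation gold :: idom
begin

definition "0 = Gold 0 0"
definition "1 = Gold 1 0"
definition "x + y = Gold (gre x + gre y) (gim x + gim y)"
definition "x - y = Gold (gre x - gre y) (gim x - gim y)"
definition "- x = Gold (- gre x) (- gim x)"
definition "x * y = Gold (gre x * gre y + gim x * gim y) (gre x * gim y + gim x * gre y + gim x * gim y)"

lemma gold_sel [simp]:
  "gre 0 = 0" "gim 0 = 0" "gre 1 = 1" "gim 1 = 0"
  "gre (x + y) = gre x + gre y" "gim (x + y) = gim x + gim y"
  "gre (x - y) = gre x - gre y" "gim (x - y) = gim x - gim y"
  "gre (- x) = - gre x" "gim (- x) = - gim x"
  "gre (x * y) = gre x * gre y + gim x * gim y"
  "gim (x * y) = gre x * gim y + gim x * gre y + gim x * gim y"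
  by (simp_all add: zero_gold_def one_gold_def plus_gold_def minus_gold_def uminus_gold_def times_gold_def)

text \<open>The norm of m + n tau. It comes before the instance proof because the absence of zero
  divisors is read off from its multiplicativity.\<close>

definition gnorm :: "gold \<Rightarrow> int" where
  "gnorm x = (gre x)\<^sup>2 + gre x * gim x - (gim x)\<^sup>2"

definition gconj :: "gold \<Rightarrow> gold" where
  "gconj x = Gold (gre x + gim x) (- gim x)"

lemma gnorm_mult: "gnorm (Gold a b * Gold c d) = gnorm (Gold a b) * gnorm (Gold c d)"
  by (simp add: gnorm_def power2_eq_square algebra_simps)

lemma gnorm_eq_0_aux:
  assumes "gnorm x = 0" shows "x = Gold 0 0"
proof -
  have "(2 * gre x + gim x)\<^sup>2 = 5 * (gim x)\<^sup>2"
    using assms by (simp add: gnorm_def power2_eq_square algebra_simps)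
  then have "gim x = 0"
    by (rule int_square_eq_5_square)
  with assms show ?thesis
    by (simp add: gold_eq_iff gnorm_def)
qed

instance
proof
  fix a b c :: gold
  show "a * b * c = a * (b * c)" "(a + b) * c = a * c + b * c"
    by (simp_all add: gold_eq_iff algebra_simps)
  show "a * b = b * a"
    by (simp add: gold_eq_iff algebra_simps)
  show "a \<noteq> 0 \<Longrightarrow> b \<noteq> 0 \<Longrightarrow> a * b \<noteq> 0"
  proof -
    assume "a \<noteq> 0" "b \<noteq> 0"
    then have "gnorm a \<noteq> 0" "gnorm b \<noteq> 0"
      using gnorm_eq_0_aux unfolding zero_gold_def by metis+
    moreover have "gnorm (a * b) = gnorm a * gnorm b"
      using gnorm_mult[of "gre a" "gim a" "gre b" "gim b"] unfolding gold.collapse .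
    ultimately have "gnorm (a * b) \<noteq> 0"
      by simp
    moreover have "gnorm 0 = 0" by (simp add: gnorm_def)
    ultimately show "a * b \<noteq> 0"
      by metis
  qed
qed (simp_all add: gold_eq_iff algebra_simps)

end

lemma gnorm_times [simp]: "gnorm (x * y) = gnorm x * gnorm y"
  using gnorm_mult[of "gre x" "gim x" "gre y" "gim y"] unfolding gold.collapse .

lemma gnorm_0 [simp]: "gnorm 0 = 0" and gnorm_1 [simp]: "gnorm 1 = 1"
  by (simp_all add: gnorm_def)

lemma gnorm_eq_0_iff [simp]: "gnorm x = 0 \<longleftrightarrow> x = 0"
  using gnorm_eq_0_aux[of x] by (metis gnorm_0 zero_gold_def)

lemma mult_gconj: "x * gconj x = of_int (gnorm x)"
proof -
  have [simp]: "gre (of_int k) = k" "gim (of_int k) = 0" for k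
    by (induction k rule: int_induct[of _ 0]) auto
  show ?thesis
    by (simp add: gold_eq_iff gconj_def gnorm_def power2_eq_square algebra_simps)
qed

lemma gold_of_int_sel [simp]: "gre (of_int k) = k" "gim (of_int k) = 0"
  by (induction k rule: int_induct[of _ 0]) auto

lemma gnorm_gconj [simp]: "gnorm (gconj x) = gnorm x"
  by (simp add: gnorm_def gconj_def power2_eq_square algebra_simps)

lemma gconj_eq_0_iff [simp]: "gconj x = 0 \<longleftrightarrow> x = 0"
  by (metis gnorm_eq_0_iff gnorm_gconj)

section \<open>Real embeddings and the norm\<close>

definition rv :: "gold \<Rightarrow> real" where
  "rv x = of_int (gre x) + of_int (gim x) * golden"

definition rv' :: "gold \<Rightarrow> real" where
  "rv' x = of_int (gre x) + of_int (gim x) * (1 - golden)"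

lemma golden_square: "golden * golden = golden + 1"
  by (simp add: golden_def field_simps)

lemma golden_bounds: "1.618 < golden" "golden < 1.6181"
proof -
  have "2.236 < sqrt 5" by (rule real_less_rsqrt) (simp add: power2_eq_square)
  moreover have "sqrt 5 < 2.2362" by (rule real_less_lsqrt) (simp_all add: power2_eq_square)
  ultimately show "1.618 < golden" "golden < 1.6181" by (simp_all add: golden_def)
qed

lemma rv_simps [simp]:
  "rv 0 = 0" "rv 1 = 1" "rv (x + y) = rv x + rv y" "rv (x - y) = rv x - rv y" "rv (- x) = - rv x"
  "rv' 0 = 0" "rv' 1 = 1" "rv' (x + y) = rv' x + rv' y" "rv' (x - y) = rv' x - rv' y" "rv' (- x) = - rv' x"
  by (simp_all add: rv_def rv'_def algebra_simps)

lemma rv_mult [simp]: "rv (x * y) = rv x * rv y"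
proof -
  have "rv x * rv y = gre x * gre y + gim x * gim y * (golden * golden)
     + (gre x * gim y + gim x * gre y) * golden"
    by (simp add: rv_def algebra_simps)
  then show ?thesis unfolding golden_square by (simp add: rv_def algebra_simps)
qed

lemma rv'_mult [simp]: "rv' (x * y) = rv' x * rv' y"
proof -
  have "rv' x * rv' y = gre x * gre y + gim x * gim y * (golden * golden - 2 * golden + 1)
     + (gre x * gim y + gim x * gre y) * (1 - golden)"
    by (simp add: rv'_def algebra_simps)
  then show ?thesis unfolding golden_square by (simp add: rv'_def algebra_simps)
qed

lemma rv_of_int [simp]: "rv (of_int k) = of_int k" "rv' (of_int k) = of_int k"
  by (simp_all add: rv_def rv'_def)

lemma rv_power [simp]: "rv (x ^ n) = rv x ^ n" "rv' (x ^ n) = rv' x ^ n"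
  by (induction n) simp_all

lemma rv_gconj: "rv (gconj x) = rv' x" "rv' (gconj x) = rv x"
  by (simp_all add: rv_def rv'_def gconj_def algebra_simps)

lemma rv_mult_rv': "rv x * rv' x = of_int (gnorm x)"
  using mult_gconj[of x] by (metis rv_gconj(1) rv_mult rv_of_int(1))

lemma rv_eq_0_iff [simp]: "rv x = 0 \<longleftrightarrow> x = 0" and rv'_eq_0_iff [simp]: "rv' x = 0 \<longleftrightarrow> x = 0"
  using rv_mult_rv'[of x] by (auto simp: rv_def rv'_def)

lemma rv_eq_iff [simp]: "rv x = rv y \<longleftrightarrow> x = y" and rv'_eq_iff [simp]: "rv' x = rv' y \<longleftrightarrow> x = y"
  using rv_eq_0_iff[of "x - y"] rv'_eq_0_iff[of "x - y"] by auto

lemma abs_gnorm: "real_of_int \<bar>gnorm x\<bar> = \<bar>rv x\<bar> * \<bar>rv' x\<bar>"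
  by (metis abs_mult of_int_abs rv_mult_rv')

text \<open>The norm is a nonzero integer; this is the discreteness that keeps an element from being
  small under both embeddings.\<close>

lemma abs_gnorm_ge_1: "x \<noteq> 0 \<Longrightarrow> 1 \<le> \<bar>rv x\<bar> * \<bar>rv' x\<bar>"
  proof -
  assume "x \<noteq> 0"
  then have "1 \<le> \<bar>gnorm x\<bar>" using gnorm_eq_0_iff[of x] by linarith
  then show ?thesis unfolding abs_gnorm[symmetric] by simp
qed

lemma gold_is_unit_iff: "x dvd 1 \<longleftrightarrow> \<bar>gnorm x\<bar> = 1" for x :: gold
proof
  assume "x dvd 1"
  then obtain y where "1 = x * y" by (rule dvdE)
  then have "gnorm x * gnorm y = 1" using gnorm_times[of x y] by simp
  then show "\<bar>gnorm x\<bar> = 1" using abs_zmult_eq_1[of "gnorm x" "gnorm y"] by simp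
next
  assume "\<bar>gnorm x\<bar> = 1"
  then have "gnorm x = 1 \<or> gnorm x = - 1"
    by linarith
  then have "x * gconj x = 1 \<or> x * (- gconj x) = 1"
    using mult_gconj[of x] by auto
  then show "x dvd 1"
    by (metis dvdI)
qed

text \<open>The norm form satisfies \<open>4 N = (2 m + n)\<^sup>2 - 5 n\<^sup>2\<close>, so it is a square modulo 5.\<close>

lemma gnorm_nonunit_ge_4:
  assumes "x \<noteq> 0" "\<not> x dvd 1" shows "4 \<le> \<bar>gnorm x\<bar>"
proof -
  have mod5: "(a - 5 * b) mod 5 = a mod 5" for a b :: int
    by presburger
  have "4 * gnorm x = (2 * gre x + gim x)\<^sup>2 - 5 * (gim x)\<^sup>2"
    by (simp add: gnorm_def power2_eq_square algebra_simps)
  then have "(4 * gnorm x) mod 5 = (2 * gre x + gim x)\<^sup>2 mod 5"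
    by (simp only: mod5)
  also have "\<dots> = ((2 * gre x + gim x) mod 5)\<^sup>2 mod 5"
    by (simp only: power_mod)
  finally have *: "(4 * gnorm x) mod 5 = ((2 * gre x + gim x) mod 5)\<^sup>2 mod 5" .
  have "y mod 5 = 0 \<or> y mod 5 = 1 \<or> y mod 5 = 2 \<or> y mod 5 = 3 \<or> y mod 5 = 4" for y :: int
    by presburger
  from this[of "2 * gre x + gim x"] have r: "(4 * gnorm x) mod 5 \<in> {0, 1, 4}"
    unfolding * by (elim disjE) simp_all
  have nz: "gnorm x \<noteq> 0" "\<bar>gnorm x\<bar> \<noteq> 1"
    using assms by (auto simp: gold_is_unit_iff)
  have fin: False if "(4 * y) mod 5 \<in> {0, 1, 4}" "y \<noteq> 0" "\<bar>y\<bar> \<noteq> 1" "\<not> 4 \<le> \<bar>y\<bar>" for y :: int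
  proof -
    have "y \<in> {-3, -2, 2, 3}" using that by auto
    then show False using that(1) by auto
  qed
  show ?thesis
    by (rule ccontr) (rule fin[OF r nz])
qed

subsection \<open>Units\<close>

text \<open>\<open>Gold (- 1) 1\<close> is tau - 1, the inverse of tau, so negative exponents stay
  inside the ring.\<close>

definition tau_pow :: "int \<Rightarrow> gold" where
  "tau_pow n = (if 0 \<le> n then Gold 0 1 ^ nat n else Gold (- 1) 1 ^ nat (- n))"

lemma golden_gt: "1 < golden" "0 < golden"
  using golden_bounds by simp_all

lemma inverse_golden: "1 / golden = golden - 1"
  using golden_square golden_gt by (simp add: field_simps)

lemma rv_tau_pow: "rv (tau_pow n) = golden powr of_int n"
proof (cases "0 \<le> n")
  case True
  then show ?thesis
    using golden_gt by (simp add: tau_pow_def rv_def[of "Gold 0 1"] powr_realpow[symmetric])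
next
  case False
  have "rv (Gold (- 1) 1) = 1 / golden" unfolding inverse_golden by (simp add: rv_def)
  with False have "rv (tau_pow n) = (1 / golden) powr of_int (- n)"
    using golden_gt by (simp add: tau_pow_def powr_realpow[symmetric] del: of_int_minus)
  then show ?thesis using golden_gt by (simp add: powr_divide powr_minus_divide)
qed

lemma rv_tau_pow_pos [simp]: "0 < rv (tau_pow n)"
  using golden_gt by (simp add: rv_tau_pow)

lemma tau_pow_unit [simp]: "tau_pow n dvd 1"
proof -
  have "Gold 0 1 dvd 1" "Gold (- 1) 1 dvd 1"
    by (simp_all add: gold_is_unit_iff gnorm_def)
  then show ?thesis
    unfolding tau_pow_def by (auto intro: dvd_power_same[where y = 1, simplified])
qed

text \<open>The norm is 1 in absolute value. Multiplying by a unit therefore shifts size from one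
  embedding to the other without changing the product.\<close>

lemma abs_rv'_unit:
  assumes "u dvd 1" shows "\<bar>rv' u\<bar> = 1 / \<bar>rv u\<bar>"
proof -
  have "\<bar>rv u\<bar> * \<bar>rv' u\<bar> = 1"
    using assms unfolding abs_gnorm[symmetric] gold_is_unit_iff by simp
  then show ?thesis by (metis mult_zero_left nonzero_mult_div_cancel_left zero_neq_one)
qed

lemma golden_powr_floor:
  assumes "0 < (x :: real)"
  shows "golden powr of_int \<lfloor>log golden x\<rfloor> \<le> x" "x < golden * golden powr of_int \<lfloor>log golden x\<rfloor>"
proof -
  have "golden powr of_int \<lfloor>log golden x\<rfloor> \<le> golden powr log golden x"
    using golden_gt by (intro powr_mono) auto
  then show "golden powr of_int \<lfloor>log golden x\<rfloor> \<le> x"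
    using assms golden_gt by simp
  have "golden powr log golden x < golden powr (1 + of_int \<lfloor>log golden x\<rfloor>)"
    using golden_gt by (intro powr_less_mono) linarith+
  then show "x < golden * golden powr of_int \<lfloor>log golden x\<rfloor>"
    using assms golden_gt by (simp add: powr_add)
qed

text \<open>Powers of tau form a geometric progression of ratio \<open>golden\<close>. This is the
  device for every balancing step: choosing associates, shaping the counted region, and finding a
  unit that hides a point.\<close>

lemma unit_near:
  assumes "0 < x"
  obtains u where "u dvd 1" "0 < rv u" "rv u \<le> x" "x < golden * rv u"
  using golden_powr_floor[OF assms] rv_tau_pow rv_tau_pow_pos tau_pow_unit by metis

lemma abs_int_less_2: "k = 0 \<or> k = 1 \<or> k = - 1" if "\<bar>k\<bar> < (2 :: int)"
  using that by linarith

lemma rv_minus_rv': "rv x - rv' x = of_int (gim x) * (2 * golden - 1)"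
  by (simp add: rv_def rv'_def algebra_simps)

text \<open>Here the conjugate of \<open>w\<close> is below \<open>golden\<close> in absolute value,
  so \<open>rv w - rv' w\<close>, which is \<open>gim w\<close> times sqrt 5, is below
  \<open>1 + golden\<close>. This leaves three values of \<open>gim w\<close>.\<close>

lemma unit_in_fundamental_interval:
  assumes "w dvd 1" "1 / golden < rv w" "rv w \<le> 1"
  shows "w = 1"
proof -
  have inv_pos: "0 < 1 / golden"
    using golden_gt by simp
  have pos: "0 < rv w"
    using less_trans[OF inv_pos assms(2)] .
  have "1 / rv w < golden"
    using assms(2) golden_gt pos by (simp add: field_simps)
  then have "\<bar>rv' w\<bar> < golden"
    using abs_rv'_unit[OF assms(1)] pos by simp
  then have lt: "\<bar>rv w - rv' w\<bar> < 1 + golden"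
    using assms(3) pos by linarith
  have "\<bar>gim w\<bar> < 2"
  proof (rule ccontr)
    assume "\<not> \<bar>gim w\<bar> < 2"
    then have "2 \<le> \<bar>real_of_int (gim w)\<bar>" by linarith
    then have "2 * (2 * golden - 1) \<le> \<bar>real_of_int (gim w)\<bar> * (2 * golden - 1)"
      using golden_gt by (intro mult_right_mono) auto
    also have "\<dots> = \<bar>rv w - rv' w\<bar>"
      using golden_gt by (simp add: rv_minus_rv' abs_mult)
    finally show False using lt golden_bounds by simp
  qed
  then consider "gim w = 0" | "gim w = 1" | "gim w = -1"
    using abs_int_less_2 by blast
  then show ?thesis
  proof cases
    case 1
    then have "0 < real_of_int (gre w)" "real_of_int (gre w) \<le> 1"
      using assms less_trans[OF inv_pos assms(2)] by (simp_all add: rv_def)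
    then have "gre w = 1" by linarith
    with 1 show ?thesis by (simp add: gold_eq_iff)
  next
    case 2
    \<comment> \<open>\<open>gre w\<close> is \<open>rv w - golden\<close>, and
      \<open>1 / golden - golden\<close> is exactly -1.\<close>
    then have "of_int (- 1) < real_of_int (gre w)" "real_of_int (gre w) < of_int 0"
      using assms golden_bounds by (auto simp: rv_def inverse_golden)
    then have "- 1 < gre w" "gre w < 0"
      unfolding of_int_less_iff .
    then have False by linarith
    then show ?thesis ..
  next
    case 3
    \<comment> \<open>This exceeds \<open>1 / golden\<close> plus sqrt 5, contradicting the bound
      \<open>golden\<close> for the conjugate.\<close>
    then have "rv' w = rv w + (2 * golden - 1)"
      using rv_minus_rv'[of w] by simp
    then show ?thesis
      using \<open>\<bar>rv' w\<bar> < golden\<close> assms golden_bounds by (simp add: inverse_golden)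
  qed
qed

text \<open>Dirichlet's unit theorem for this ring, with tau as fundamental unit: a power of tau
  moves \<open>u\<close> into the interval that contains only the unit 1.\<close>

lemma small_unit_is_tau_power:
  assumes "u dvd 1" "0 < rv u" "rv u < 1"
  obtains n :: nat where "1 \<le> n" "u * Gold 0 1 ^ n = 1"
proof -
  define k where "k = \<lfloor>log golden (1 / rv u)\<rfloor>"
  have le: "golden powr k \<le> 1 / rv u" and gt: "1 / rv u < golden * golden powr k"
    using golden_powr_floor[of "1 / rv u"] assms by (auto simp: k_def)
  have "0 \<le> log golden (1 / rv u)"
    using assms golden_gt by simp
  then have k: "0 \<le> k" by (simp add: k_def)
  define w where "w = u * tau_pow k"
  have "w dvd 1"
    using mult_dvd_mono[OF assms(1) tau_pow_unit[of k]] unfolding w_def by simp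
  moreover have "rv w \<le> 1" "1 / golden < rv w"
    using le gt assms golden_gt unfolding w_def rv_mult rv_tau_pow by (simp_all add: field_simps)
  ultimately have "w = 1"
    by (intro unit_in_fundamental_interval)
  then have *: "u * Gold 0 1 ^ nat k = 1"
    using k by (simp add: w_def tau_pow_def)
  moreover have "nat k \<noteq> 0"
  proof
    assume "nat k = 0"
    then have "u = 1" using * by simp
    then show False using assms by simp
  qed
  ultimately show ?thesis using that[of "nat k"] by simp
qed

text \<open>Multiplying by tau changes the ratio of the conjugates by \<open>golden\<^sup>2\<close>,
  so every associate class meets this range.\<close>

definition balanced :: "gold \<Rightarrow> bool" where
  "balanced x \<longleftrightarrow> \<bar>rv' x\<bar> \<le> \<bar>rv x\<bar> \<and> \<bar>rv x\<bar> \<le> golden\<^sup>2 * \<bar>rv' x\<bar>"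

lemma balanced_1: "balanced 1"
  using golden_gt by (simp add: balanced_def)

lemma ex_balanced_associate:
  assumes "x \<noteq> 0"
  obtains r where "r dvd x" "x dvd r" "balanced r"
proof -
  have pos: "0 < \<bar>rv x\<bar>" "0 < \<bar>rv' x\<bar>" using assms by simp_all
  \<comment> \<open>The ratio of conjugates of \<open>x * u\<close> is that of \<open>x\<close>
    times \<open>(rv u)\<^sup>2\<close>. For \<open>rv u = s\<close> it would be exactly
    \<open>golden\<^sup>2\<close>; losing less than a factor \<open>golden\<close> in
    \<open>u\<close> keeps it above 1.\<close>
  define s where "s = sqrt (golden\<^sup>2 * \<bar>rv' x\<bar> / \<bar>rv x\<bar>)"
  have s: "0 < s" "s\<^sup>2 = golden\<^sup>2 * \<bar>rv' x\<bar> / \<bar>rv x\<bar>"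
    using pos golden_gt by (simp_all add: s_def)
  obtain u where u: "u dvd 1" "0 < rv u" "rv u \<le> s" "s < golden * rv u"
    using unit_near[OF s(1)] .
  have u': "\<bar>rv' u\<bar> = 1 / rv u" using abs_rv'_unit[OF u(1)] u(2) by simp
  have "(rv u)\<^sup>2 \<le> s\<^sup>2"
    using u by (intro power_mono) simp_all
  moreover have "s\<^sup>2 \<le> (golden * rv u)\<^sup>2"
    using u s(1) by (intro power_mono) simp_all
  ultimately have "(rv u)\<^sup>2 * \<bar>rv x\<bar> \<le> golden\<^sup>2 * \<bar>rv' x\<bar>" "golden\<^sup>2 * \<bar>rv' x\<bar> \<le> golden\<^sup>2 * ((rv u)\<^sup>2 * \<bar>rv x\<bar>)"
    using pos unfolding s by (simp_all add: field_simps power_mult_distrib)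
  moreover from this(2) have "\<bar>rv' x\<bar> \<le> (rv u)\<^sup>2 * \<bar>rv x\<bar>"
    using golden_gt by simp
  ultimately have "balanced (x * u)"
    unfolding balanced_def rv_mult rv'_mult abs_mult u' using u(2)
    by (simp add: field_simps power2_eq_square)
  moreover have "x * u dvd x" "x dvd x * u"
    using u(1) mult_dvd_mono[of x x u 1] by simp_all
  ultimately show ?thesis using that by blast
qed

subsection \<open>Euclidean division\<close>

text \<open>Normalized elements are chosen with conjugates of comparable size, which makes the sum of
  \<open>1 / N\<^sup>2\<close> over all ideals easy to bound.\<close>

definition canonical :: "gold \<Rightarrow> gold \<Rightarrow> bool" where
  "canonical x r \<longleftrightarrow> r dvd x \<and> x dvd r \<and> balanced r \<and> (x dvd 1 \<longrightarrow> r = 1)"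

lemma ex_canonical: "x \<noteq> 0 \<Longrightarrow> \<exists>r. canonical x r"
  by (cases "x dvd 1") (auto simp: canonical_def balanced_1 elim!: ex_balanced_associate)

text \<open>Stated as equality of predicates so that the choice in \<open>gold_rep\<close> returns
  the same element for all associates.\<close>

lemma canonical_unit_mult:
  assumes "u dvd 1" shows "canonical (u * x) = canonical x"
proof -
  obtain v where v: "1 = u * v" using assms by (rule dvdE)
  have "y dvd u * x \<longleftrightarrow> y dvd x" for y
    by (metis dvd_mult mult.assoc mult.commute mult_1 v)
  moreover have "u * x dvd y \<longleftrightarrow> x dvd y" for y
    by (metis assms dvd_mult_right mult.commute mult_dvd_mono mult_1)
  ultimately show ?thesis by (auto simp: canonical_def fun_eq_iff)
qed

text \<open>The exact quotient in the field is \<open>x * gconj y\<close> divided by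
  \<open>gnorm y\<close>; its two coefficients are rounded to the nearest integers.\<close>

definition gold_quot :: "gold \<Rightarrow> gold \<Rightarrow> gold" where
  "gold_quot x y = (if y = 0 then 0 else
     Gold (round (of_int (gre (x * gconj y)) / of_int (gnorm y) :: real))
          (round (of_int (gim (x * gconj y)) / of_int (gnorm y) :: real)))"

definition gold_rep :: "gold \<Rightarrow> gold" where
  "gold_rep x = (if x = 0 then 0 else (SOME r. canonical x r))"

definition gold_ufac :: "gold \<Rightarrow> gold" where
  "gold_ufac x = (if x = 0 then 0 else gold_quot x (gold_rep x))"

lemma gold_mult_quot:
  assumes b: "b \<noteq> 0" shows "gold_quot (a * b) b = a"
proof -
  have "a * b * gconj b = a * of_int (gnorm b)"
    by (simp add: mult.assoc mult_gconj)
  then have "gre (a * b * gconj b) = gre a * gnorm b" "gim (a * b * gconj b) = gim a * gnorm b"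
    by (simp_all only: gold_sel gold_of_int_sel)
  then show ?thesis
    using b by (simp add: gold_quot_def gold_eq_iff[of _ a] del: gold_sel)
qed

lemma canonical_gold_rep: "x \<noteq> 0 \<Longrightarrow> canonical x (gold_rep x)"
  unfolding gold_rep_def using someI_ex[OF ex_canonical] by simp

lemma gold_ufac_rep:
  assumes "x \<noteq> 0" obtains u where "u dvd 1" "x = u * gold_rep x" "gold_ufac x = u" "gold_rep x \<noteq> 0"
proof -
  have c: "canonical x (gold_rep x)" using canonical_gold_rep[OF assms] .
  then obtain u v where uv: "x = gold_rep x * u" "gold_rep x = x * v"
    unfolding canonical_def dvd_def by metis
  have nz: "gold_rep x \<noteq> 0" using uv assms by auto
  have "x * (v * u) = x * 1" using uv by (metis mult.assoc mult_1_right)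
  then have "u dvd 1" using assms by (metis dvd_triv_right mult_left_cancel)
  moreover have "gold_ufac x = u"
    using uv(1) nz assms gold_mult_quot[OF nz, of u] by (simp add: gold_ufac_def mult.commute)
  ultimately show ?thesis using that[of u] uv nz by (simp add: mult.commute)
qed

text \<open>The norm form evaluated at a rounding error. That it stays below 1 is what makes the
  ring norm-Euclidean.\<close>

lemma quadratic_form_abs_less_1:
  fixes e f :: real
  assumes "\<bar>e\<bar> \<le> 1 / 2" "\<bar>f\<bar> \<le> 1 / 2" shows "\<bar>e\<^sup>2 + e * f - f\<^sup>2\<bar> < 1"
proof -
  have "\<bar>e\<bar>\<^sup>2 \<le> (1/2)\<^sup>2" "\<bar>f\<bar>\<^sup>2 \<le> (1/2)\<^sup>2"
    using assms by (intro power_mono; simp)+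
  then have "e\<^sup>2 \<le> 1/4" "f\<^sup>2 \<le> 1/4" by (simp_all add: power2_eq_square)
  moreover have "\<bar>e * f\<bar> \<le> 1/2 * (1/2)"
    unfolding abs_mult using assms by (intro mult_mono) auto
  moreover have "0 \<le> e\<^sup>2" "0 \<le> f\<^sup>2" by simp_all
  ultimately show ?thesis by linarith
qed

text \<open>The remainder times \<open>gconj b\<close> is \<open>gnorm b\<close> times the rounding
  error \<open>(e, f)\<close>, so the norm of the remainder is \<open>gnorm b\<close> times the form
  at that error.\<close>

lemma gnorm_mod_less:
  assumes "b \<noteq> 0" shows "\<bar>gnorm (a - gold_quot a b * b)\<bar> < \<bar>gnorm b\<bar>"
proof -
  define N where "N = real_of_int (gnorm b)"
  define c where "c = a * gconj b"
  define q where "q = gold_quot a b"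
  have N: "N \<noteq> 0" using assms by (simp add: N_def)
  define e f where "e = gre c / N - gre q" and "f = gim c / N - gim q"
  have "gre q = round (gre c / N)" "gim q = round (gim c / N)"
    using assms by (simp_all add: q_def c_def N_def gold_quot_def)
  then have ef: "\<bar>e\<bar> \<le> 1 / 2" "\<bar>f\<bar> \<le> 1 / 2"
    using of_int_round_abs_le[of "gre c / N"] of_int_round_abs_le[of "gim c / N"]
    by (simp_all add: e_def f_def abs_minus_commute)
  have "(a - q * b) * gconj b = c - q * of_int (gnorm b)"
    by (simp add: c_def algebra_simps flip: mult_gconj)
  then have "gnorm (a - q * b) * gnorm b = gnorm (c - q * of_int (gnorm b))"
    by (metis gnorm_times gnorm_gconj)
  moreover have "real_of_int (gnorm (c - q * of_int (gnorm b))) = N\<^sup>2 * (e\<^sup>2 + e * f - f\<^sup>2)"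
  proof -
    have "gre (c - q * of_int (gnorm b)) = N * e" "gim (c - q * of_int (gnorm b)) = N * f"
      using N by (simp_all add: e_def f_def N_def[symmetric] field_simps)
    then show ?thesis
      unfolding gnorm_def of_int_diff of_int_add of_int_mult of_int_power
      by (simp add: power2_eq_square algebra_simps)
  qed
  ultimately have "real_of_int (gnorm (a - q * b)) * N = N\<^sup>2 * (e\<^sup>2 + e * f - f\<^sup>2)"
    unfolding N_def by (metis of_int_mult)
  then have *: "real_of_int (gnorm (a - q * b)) = N * (e\<^sup>2 + e * f - f\<^sup>2)"
    using N by (simp add: power2_eq_square)
  have "\<bar>N\<bar> * \<bar>e\<^sup>2 + e * f - f\<^sup>2\<bar> < \<bar>N\<bar> * 1"
    using N quadratic_form_abs_less_1[OF ef] by (intro mult_strict_left_mono) auto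
  then have "real_of_int \<bar>gnorm (a - q * b)\<bar> < real_of_int \<bar>gnorm b\<bar>"
    using * by (simp add: N_def abs_mult)
  then show ?thesis by (simp add: q_def)
qed

instantiation gold :: normalization_euclidean_semiring
begin

definition divide_gold :: "gold \<Rightarrow> gold \<Rightarrow> gold" where
  "divide_gold = gold_quot"
definition modulo_gold :: "gold \<Rightarrow> gold \<Rightarrow> gold" where
  "modulo_gold x y = x - gold_quot x y * y"
definition euclidean_size_gold :: "gold \<Rightarrow> nat" where
  "euclidean_size_gold x = nat \<bar>gnorm x\<bar>"
definition normalize_gold :: "gold \<Rightarrow> gold" where
  "normalize_gold = gold_rep"
definition unit_factor_gold :: "gold \<Rightarrow> gold" where
  "unit_factor_gold = gold_ufac"

instance
proof
  fix a b c :: gold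
  show "b \<noteq> 0 \<Longrightarrow> a * b div b = a" by (simp add: divide_gold_def gold_mult_quot)
  show "a div 0 = 0" by (simp add: divide_gold_def gold_quot_def)
  show "a div b * b + a mod b = a" by (simp add: modulo_gold_def divide_gold_def)
  show "euclidean_size (0 :: gold) = 0" by (simp add: euclidean_size_gold_def)
  show "b \<noteq> 0 \<Longrightarrow> euclidean_size (a mod b) < euclidean_size b"
    using gnorm_mod_less[of b a] by (simp add: euclidean_size_gold_def modulo_gold_def)
  show "b \<noteq> 0 \<Longrightarrow> euclidean_size a \<le> euclidean_size (a * b)"
  proof -
    assume "b \<noteq> 0"
    then have "1 \<le> \<bar>gnorm b\<bar>" using gnorm_eq_0_iff[of b] by linarith
    then have "\<bar>gnorm a\<bar> * 1 \<le> \<bar>gnorm a\<bar> * \<bar>gnorm b\<bar>" by (intro mult_left_mono) auto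
    then show ?thesis by (simp add: euclidean_size_gold_def abs_mult)
  qed
  show "unit_factor (0 :: gold) = 0" by (simp add: unit_factor_gold_def gold_ufac_def)
  show "normalize (0 :: gold) = 0" by (simp add: normalize_gold_def gold_rep_def)
  show "unit_factor a * normalize a = a"
    unfolding unit_factor_gold_def normalize_gold_def
    by (cases "a = 0") (simp add: gold_ufac_def, metis gold_ufac_rep)
  show "a \<noteq> 0 \<Longrightarrow> unit_factor a dvd 1"
    unfolding unit_factor_gold_def by (metis gold_ufac_rep)
  show "a dvd 1 \<Longrightarrow> unit_factor a = a"
  proof -
    assume a: "a dvd 1"
    then have nz: "a \<noteq> 0" by auto
    then have "gold_rep a = 1" using canonical_gold_rep[OF nz] a by (simp add: canonical_def)
    then show ?thesis unfolding unit_factor_gold_def using gold_ufac_rep[OF nz] by (metis mult_1_right)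
  qed
  show "a dvd 1 \<Longrightarrow> unit_factor (a * b) = a * unit_factor b"
  proof (cases "b = 0")
    case True
    then show ?thesis by (simp add: unit_factor_gold_def gold_ufac_def)
  next
    case False
    assume a: "a dvd 1"
    then have nz: "a \<noteq> 0" by auto
    have eq: "gold_rep (a * b) = gold_rep b"
      using False nz by (simp add: gold_rep_def canonical_unit_mult[OF a])
    obtain u where u: "u dvd 1" "b = u * gold_rep b" "gold_ufac b = u" "gold_rep b \<noteq> 0"
      using gold_ufac_rep[OF False] .
    have "a * b = (a * u) * gold_rep b" using u(2) by (metis mult.assoc)
    then have "gold_quot (a * b) (gold_rep b) = a * u"
      using gold_mult_quot[OF u(4), of "a * u"] by metis
    then show ?thesis using eq u nz False unfolding unit_factor_gold_def by (simp add: gold_ufac_def[of "a * b"])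
  qed
qed

end

instantiation gold :: euclidean_ring_gcd
begin

definition gcd_gold :: "gold \<Rightarrow> gold \<Rightarrow> gold" where
  "gcd_gold = Euclidean_Algorithm.gcd"
definition lcm_gold :: "gold \<Rightarrow> gold \<Rightarrow> gold" where
  "lcm_gold = Euclidean_Algorithm.lcm"
definition Gcd_gold :: "gold set \<Rightarrow> gold" where
 "Gcd_gold = Euclidean_Algorithm.Gcd"
definition Lcm_gold :: "gold set \<Rightarrow> gold" where
 "Lcm_gold = Euclidean_Algorithm.Lcm"

instance
  by standard (simp_all add: gcd_gold_def lcm_gold_def Gcd_gold_def Lcm_gold_def)

end

lemma balanced_normalize: "x \<noteq> 0 \<Longrightarrow> balanced (normalize x)" for x :: gold
  using canonical_gold_rep canonical_def unfolding normalize_gold_def by blast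

lemma abs_gnorm_normalize [simp]: "\<bar>gnorm (normalize x)\<bar> = \<bar>gnorm x\<bar>" for x :: gold
proof (cases "x = 0")
  case False
  then have "\<bar>gnorm (unit_factor x)\<bar> = 1"
    by (simp add: gold_is_unit_iff[symmetric])
  moreover have "gnorm x = gnorm (unit_factor x) * gnorm (normalize x)"
    by (metis gnorm_times unit_factor_mult_normalize)
  ultimately show ?thesis by (simp add: abs_mult)
qed simp

subsection \<open>The residue map modulo \<open>\<surd>5\<close>\<close>

text \<open>Reduction modulo sqrt 5 = 2 tau - 1: there tau is the inverse of 2, which is 3 modulo
  5.\<close>

definition kap :: "gold \<Rightarrow> int" where
  "kap x = (gre x + 3 * gim x) mod 5"

definition gsqrt5 :: gold where
  "gsqrt5 = Gold (- 1) 2"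

lemma gsqrt5_dvd_iff: "gsqrt5 dvd x \<longleftrightarrow> kap x = 0"
proof
  assume "gsqrt5 dvd x"
  then obtain y where y: "x = gsqrt5 * y" by (rule dvdE)
  have "gre x + 3 * gim x = 5 * (gre y + gim y)"
    unfolding y by (simp add: gsqrt5_def)
  then show "kap x = 0" by (simp add: kap_def)
next
  assume "kap x = 0"
  then obtain k where k: "gre x + 3 * gim x = 5 * k" unfolding kap_def by auto
  \<comment> \<open>The cofactor is \<open>x * gsqrt5\<close> divided by 5, since
    \<open>gsqrt5\<close> squares to 5.\<close>
  have "x = gsqrt5 * Gold (gim x - k) (2 * k - gim x)"
    using k by (simp add: gsqrt5_def gold_eq_iff)
  then show "gsqrt5 dvd x" by (rule dvdI)
qed

lemma kap_mult: "kap (x * y) = (kap x * kap y) mod 5"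
proof -
  have eq: "gre (x * y) + 3 * gim (x * y)
      = (gre x + 3 * gim x) * (gre y + 3 * gim y) - 5 * (gim x * gim y)"
    by (simp add: algebra_simps)
  have "(a - 5 * b) mod 5 = a mod 5" for a b :: int
    by presburger
  then have "kap (x * y) = ((gre x + 3 * gim x) * (gre y + 3 * gim y)) mod 5"
    unfolding kap_def eq .
  then show ?thesis by (simp only: kap_def mod_mult_eq)
qed

lemma gnorm_gsqrt5: "gnorm gsqrt5 = - 5"
  by (simp add: gsqrt5_def gnorm_def)

text \<open>Its norm has absolute value 5, while a product of two nonunits has norm at least 16 in
  absolute value.\<close>

lemma prime_elem_gsqrt5: "prime_elem gsqrt5"
proof (rule irreducible_imp_prime_elem)
  show "Factorial_Ring.irreducible gsqrt5"
  proof (rule Factorial_Ring.irreducibleI)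
    show "gsqrt5 \<noteq> 0" using gnorm_gsqrt5 by auto
    show "\<not> gsqrt5 dvd 1" by (simp add: gold_is_unit_iff gnorm_gsqrt5)
    fix a b assume "gsqrt5 = a * b"
    then have *: "5 = \<bar>gnorm a\<bar> * \<bar>gnorm b\<bar>"
      using gnorm_gsqrt5 by (metis abs_minus_cancel abs_mult abs_numeral gnorm_times)
    moreover have "a \<noteq> 0" "b \<noteq> 0" using * by auto
    moreover have False if "4 \<le> \<bar>gnorm a\<bar>" "4 \<le> \<bar>gnorm b\<bar>"
      using mult_mono[OF that] * by simp
    ultimately show "a dvd 1 \<or> b dvd 1"
      using gnorm_nonunit_ge_4 by blast
  qed
qed

text \<open>\<open>prime\<close> demands normalized elements, so the associate of sqrt 5 that can
  belong to a set of primes is used.\<close>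

definition pi5 :: gold where
  "pi5 = normalize gsqrt5"

lemma prime_pi5: "prime pi5"
  unfolding pi5_def using prime_elem_gsqrt5 by simp

lemma abs_gnorm_pi5: "\<bar>gnorm pi5\<bar> = 5"
  unfolding pi5_def by (simp add: gnorm_gsqrt5)

lemma pi5_dvd_iff: "pi5 dvd x \<longleftrightarrow> kap x = 0"
  unfolding pi5_def by (simp add: gsqrt5_dvd_iff)

subsection \<open>The zeta value\<close>

text \<open>Two roles meet here: the term of the zeta series at 2, and the proportion of pairs (a,
  b) for which both coefficients are divisible by \<open>x\<close>.\<close>

definition wt :: "gold \<Rightarrow> real" where
  "wt x = 1 / (real_of_int (gnorm x))\<^sup>2"

lemma wt_mult: "wt (x * y) = wt x * wt y"
  by (simp add: wt_def power_mult_distrib)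

lemma wt_nonneg [simp]: "0 \<le> wt x"
  by (simp add: wt_def)

lemma wt_eqI: "\<bar>gnorm x\<bar> = \<bar>gnorm y\<bar> \<Longrightarrow> wt x = wt y"
  unfolding wt_def by (metis of_int_abs power2_abs)

lemma wt_normalize [simp]: "wt (normalize x) = wt x"
  by (rule wt_eqI) simp

definition reps :: "gold set" where
  "reps = {x. x \<noteq> 0 \<and> normalize x = x}"

lemma summable_inverse_square_int:
  "(\<lambda>n :: int. 1 / (1 + \<bar>real_of_int n\<bar>)\<^sup>2) summable_on UNIV"
proof -
  define f where "f = (\<lambda>n :: int. 1 / (1 + \<bar>real_of_int n\<bar>)\<^sup>2)"
  have "summable (\<lambda>n :: nat. 1 / (real n + 1)\<^sup>2)"
    using inverse_squares_sums by (simp add: sums_iff add.commute)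
  then have nat: "(\<lambda>n :: nat. 1 / (real n + 1)\<^sup>2) summable_on UNIV"
    by (intro norm_summable_imp_summable_on) simp
  have "f summable_on (range int)"
    by (subst summable_on_reindex) (use nat in \<open>auto simp: f_def o_def add.commute\<close>)
  moreover have "f summable_on (range (\<lambda>n. - int n))"
    by (subst summable_on_reindex) (use nat in \<open>auto simp: f_def o_def add.commute inj_on_def\<close>)
  ultimately have "f summable_on (range int \<union> range (\<lambda>n. - int n))"
    by (rule summable_on_union)
  moreover have "range int \<union> range (\<lambda>n. - int n) = UNIV"
    by (auto simp: image_def) (metis int_cases2)
  ultimately show ?thesis by (simp add: f_def)
qed

lemma summable_on_mult_Times:
  fixes f :: "'a \<Rightarrow> real" and g :: "'b \<Rightarrow> real"
  assumes "f summable_on A" "g summable_on B" "\<And>x. x \<in> A \<Longrightarrow> 0 \<le> f x" "\<And>y. y \<in> B \<Longrightarrow> 0 \<le> g y"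
  shows "(\<lambda>p. f (fst p) * g (snd p)) summable_on A \<times> B"
proof (rule summable_on_SigmaI)
  show "((\<lambda>y. f (fst (x, y)) * g (snd (x, y))) has_sum f x * infsum g B) B" for x
    using assms(2) by (simp add: has_sum_cmult_right)
  show "(\<lambda>x. f x * infsum g B) summable_on A"
    using assms(1) by (rule summable_on_cmult_left)
qed (use assms in auto)

lemma abs_gim_le: "\<bar>real_of_int (gim x)\<bar> \<le> \<bar>rv x\<bar> + \<bar>rv' x\<bar>"
proof -
  have "\<bar>real_of_int (gim x)\<bar> * 1 \<le> \<bar>real_of_int (gim x)\<bar> * (2 * golden - 1)"
    using golden_gt by (intro mult_left_mono) auto
  also have "\<dots> = \<bar>rv x - rv' x\<bar>"
    using golden_gt by (simp add: rv_minus_rv' abs_mult)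
  finally show ?thesis by linarith
qed

lemma abs_gre_le: "\<bar>real_of_int (gre x)\<bar> \<le> 3 * (\<bar>rv x\<bar> + \<bar>rv' x\<bar>)"
proof -
  have "real_of_int (gre x) = rv x - gim x * golden" by (simp add: rv_def)
  then have "\<bar>real_of_int (gre x)\<bar> \<le> \<bar>rv x\<bar> + \<bar>real_of_int (gim x)\<bar> * golden"
    using golden_gt abs_triangle_ineq4[of "rv x" "gim x * golden"] by (simp add: abs_mult)
  moreover have "\<bar>real_of_int (gim x)\<bar> * golden \<le> (\<bar>rv x\<bar> + \<bar>rv' x\<bar>) * 2"
    using abs_gim_le golden_bounds by (intro mult_mono) auto
  moreover have "0 \<le> \<bar>rv' x\<bar>" by simp
  moreover have "m \<le> A + g \<Longrightarrow> g \<le> (A + B) * 2 \<Longrightarrow> 0 \<le> B \<Longrightarrow> m \<le> 3 * (A + B)" for m A B g :: real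
    unfolding ring_distribs by linarith
  ultimately show ?thesis by blast
qed

text \<open>For a balanced element both integer coefficients are bounded by a multiple of the root
  of the norm, so \<open>wt\<close> is dominated by a product of two convergent one-variable series.
  The factors 7, 3 and 4 give 84, which is rounded up to 100 and squared.\<close>

lemma wt_reps_le:
  assumes "x \<in> reps"
  shows "wt x \<le> 10000 * (1 / (1 + \<bar>real_of_int (gre x)\<bar>)\<^sup>2 * (1 / (1 + \<bar>real_of_int (gim x)\<bar>)\<^sup>2))"
proof -
  have x: "x \<noteq> 0" "balanced x"
    using assms balanced_normalize[of x] by (auto simp: reps_def)
  define a where "a = \<bar>rv x\<bar>"
  have a': "\<bar>rv' x\<bar> \<le> a" "a \<le> golden\<^sup>2 * \<bar>rv' x\<bar>"
    using x by (auto simp: balanced_def a_def)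
  have "1 \<le> a * \<bar>rv' x\<bar>" using abs_gnorm_ge_1[OF x(1)] by (simp add: a_def)
  also have "\<dots> \<le> a * a" using a' by (intro mult_left_mono) (auto simp: a_def)
  finally have a1: "1 \<le> a"
    by (metis a_def abs_ge_zero abs_square_less_1 abs_idempotent linorder_not_less power2_eq_square)
  have "a * a \<le> a * (golden\<^sup>2 * \<bar>rv' x\<bar>)"
    using a' a1 by (intro mult_left_mono) auto
  also have "\<dots> = golden\<^sup>2 * \<bar>real_of_int (gnorm x)\<bar>"
    using abs_gnorm[of x] by (simp add: a_def)
  also have "\<dots> \<le> 4 * \<bar>real_of_int (gnorm x)\<bar>"
    using golden_bounds golden_square by (intro mult_right_mono) (auto simp: power2_eq_square)
  finally have aa: "a * a \<le> 4 * \<bar>real_of_int (gnorm x)\<bar>" .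
  have "1 + \<bar>real_of_int (gre x)\<bar> \<le> 7 * a" "1 + \<bar>real_of_int (gim x)\<bar> \<le> 3 * a"
    using order_trans[OF abs_gre_le[of x], of "6 * a"] order_trans[OF abs_gim_le[of x], of "2 * a"]
      a'(1) a1 unfolding a_def[symmetric] by simp_all
  then have "(1 + \<bar>real_of_int (gre x)\<bar>) * (1 + \<bar>real_of_int (gim x)\<bar>) \<le> (7 * a) * (3 * a)"
    using a1 by (intro mult_mono) auto
  also have "\<dots> \<le> 100 * \<bar>real_of_int (gnorm x)\<bar>" using aa by simp
  finally have "((1 + \<bar>real_of_int (gre x)\<bar>) * (1 + \<bar>real_of_int (gim x)\<bar>))\<^sup>2 \<le> (100 * \<bar>real_of_int (gnorm x)\<bar>)\<^sup>2"
    by (intro power_mono) auto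
  then have "(1 + \<bar>real_of_int (gre x)\<bar>)\<^sup>2 * (1 + \<bar>real_of_int (gim x)\<bar>)\<^sup>2 \<le> 10000 * (real_of_int (gnorm x))\<^sup>2"
    by (simp add: power_mult_distrib)
  moreover have "0 < (real_of_int (gnorm x))\<^sup>2" using x by simp
  moreover have "0 < (1 + \<bar>real_of_int (gre x)\<bar>)\<^sup>2 * (1 + \<bar>real_of_int (gim x)\<bar>)\<^sup>2"
    by (intro mult_pos_pos zero_less_power) linarith+
  ultimately show ?thesis unfolding wt_def by (simp add: field_simps)
qed

lemma summable_wt_reps: "wt summable_on reps"
proof (rule summable_on_comparison_test)
  let ?f = "\<lambda>n :: int. 1 / (1 + \<bar>real_of_int n\<bar>)\<^sup>2"
  have "(\<lambda>p. ?f (fst p) * ?f (snd p)) summable_on UNIV \<times> UNIV"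
    by (intro summable_on_mult_Times summable_inverse_square_int) auto
  then have "(\<lambda>p. ?f (fst p) * ?f (snd p)) summable_on (\<lambda>x. (gre x, gim x)) ` reps"
    by (rule summable_on_subset_banach) auto
  then have "((\<lambda>p. ?f (fst p) * ?f (snd p)) \<circ> (\<lambda>x. (gre x, gim x))) summable_on reps"
    by (subst (asm) summable_on_reindex) (auto simp: inj_on_def gold_eq_iff)
  then show "(\<lambda>x. 10000 * (?f (gre x) * ?f (gim x))) summable_on reps"
    by (intro summable_on_cmult_right) (simp add: o_def)
qed (use wt_reps_le in auto)

definition zeta_gold :: real where
  "zeta_gold = (\<Sum>\<^sub>\<infinity>x\<in>reps. wt x)"

lemma one_in_reps: "1 \<in> reps"
  by (simp add: reps_def)

subsection \<open>The alternating sum over squarefree products\<close>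

text \<open>These stand for the squarefree ideals: \<open>\<Prod>S\<close> generates the ideal and
  \<open>(- 1) ^ card S\<close> is its Moebius value.\<close>

definition prime_sets :: "gold set set" where
  "prime_sets = {S. finite S \<and> (\<forall>p\<in>S. prime p)}"

text \<open>Adjoining a fixed element pairs each subset with one of opposite sign; this is the
  Moebius identity in terms of subsets.\<close>

lemma sum_alternating_Pow:
  assumes "finite A" shows "(\<Sum>S\<in>Pow A. (- 1) ^ card S) = (if A = {} then 1 else 0 :: real)"
  using assms
proof (induction A)
  case (insert a A)
  have fin: "finite S" if "S \<in> Pow A" for S
    using that insert(1) finite_subset by auto
  have notin: "a \<notin> S" if "S \<in> Pow A" for S
    using that insert by auto
  have "(\<Sum>S\<in>Pow (insert a A). (- 1) ^ card S)
      = (\<Sum>S\<in>Pow A. (- 1) ^ card S) + (\<Sum>S\<in>insert a ` Pow A. (- 1) ^ card S :: real)"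
    unfolding Pow_insert using insert by (intro sum.union_disjoint) auto
  also have "(\<Sum>S\<in>insert a ` Pow A. (- 1) ^ card S :: real) = (\<Sum>S\<in>Pow A. (- 1) ^ card (insert a S))"
    using insert(2) by (subst sum.reindex) (auto simp: inj_on_def o_def)
  also have "\<dots> = (\<Sum>S\<in>Pow A. - ((- 1) ^ card S))"
    using fin notin by (intro sum.cong) auto
  finally show ?case by (simp add: sum_negf)
qed simp

lemma prod_primes_dvd_iff:
  assumes "S \<in> prime_sets"
  shows "\<Prod>S dvd x \<longleftrightarrow> (\<forall>p\<in>S. p dvd x)"
proof
  assume "\<Prod>S dvd x"
  then show "\<forall>p\<in>S. p dvd x"
    using assms dvd_prodI[of S _ "\<lambda>p. p"] by (auto simp: prime_sets_def intro: dvd_trans)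
next
  have "finite S" "\<forall>p\<in>S. prime p" using assms by (auto simp: prime_sets_def)
  then show "\<forall>p\<in>S. p dvd x \<Longrightarrow> \<Prod>S dvd x"
  proof (induction S)
    case (insert p S)
    have "coprime p (\<Prod>S)"
      using insert by (intro prod_coprime_right primes_coprime) auto
    then show ?case using insert by (simp add: divides_mult)
  qed simp
qed

lemma prime_dvd_prod_primes_iff:
  assumes "S \<in> prime_sets" "prime p"
  shows "p dvd \<Prod>S \<longleftrightarrow> p \<in> S"
proof -
  have "p dvd \<Prod>S \<longleftrightarrow> (\<exists>q\<in>S. p dvd q)"
    using assms by (intro prime_dvd_prod_iff) (auto simp: prime_sets_def)
  also have "\<dots> \<longleftrightarrow> p \<in> S"
    using assms by (auto simp: prime_sets_def dest: primes_dvd_imp_eq intro: bexI[of _ p])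
  finally show ?thesis .
qed

lemma prod_primes_nonzero: "S \<in> prime_sets \<Longrightarrow> \<Prod>S \<noteq> 0"
  by (auto simp: prime_sets_def)

text \<open>The chosen normalization need not be multiplicative, so a product of primes is
  normalized once more to land in \<open>reps\<close>. The set is recovered as the set of prime
  divisors.\<close>

lemma inj_on_normalize_prod: "inj_on (\<lambda>S. normalize (\<Prod>S)) prime_sets"
proof (rule inj_onI)
  fix S R assume S: "S \<in> prime_sets" "R \<in> prime_sets" and eq: "normalize (\<Prod>S) = normalize (\<Prod>R)"
  have "p dvd \<Prod>S \<longleftrightarrow> p dvd \<Prod>R" for p
    using eq by (metis dvd_normalize_iff)
  then have "p \<in> S \<longleftrightarrow> p \<in> R" if "prime p" for p
    using prime_dvd_prod_primes_iff[OF S(1) that] prime_dvd_prod_primes_iff[OF S(2) that] by simp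
  then show "S = R" using S by (auto simp: prime_sets_def)
qed

lemma summable_wt_prime_sets: "(\<lambda>S. wt (\<Prod>S)) summable_on prime_sets"
proof -
  have "wt summable_on (\<lambda>S. normalize (\<Prod>S)) ` prime_sets"
    using summable_wt_reps by (rule summable_on_subset_banach) (auto simp: reps_def prod_primes_nonzero)
  then show ?thesis
    by (subst (asm) summable_on_reindex[OF inj_on_normalize_prod]) (simp add: o_def)
qed

definition sign_wt :: "gold set \<Rightarrow> real" where
  "sign_wt S = (- 1) ^ card S * wt (\<Prod>S)"

lemma abs_sign_wt: "\<bar>sign_wt S\<bar> = wt (\<Prod>S)"
  by (simp add: sign_wt_def abs_mult)

lemma summable_sign_wt: "sign_wt summable_on prime_sets"
  by (rule abs_summable_summable) (simp add: abs_sign_wt summable_wt_prime_sets)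

lemma normalize_quot_unique:
  fixes d x :: gold
  assumes "x \<in> reps" "d \<noteq> 0" shows "normalize (normalize (d * x) div d) = x"
proof -
  obtain y where y: "normalize (d * x) = d * y" by (meson dvd_def dvd_normalize_iff dvd_triv_left)
  have "d * y dvd d * x" "d * x dvd d * y"
    unfolding y[symmetric] by simp_all
  then have "normalize y = normalize x"
    using assms(2) by (intro normalization_semidom_class.associatedI) simp_all
  then show ?thesis using assms y by (simp add: reps_def)
qed

text \<open>Moebius inversion. The absolutely convergent double sum over a squarefree
  \<open>\<Prod>S\<close> and a cofactor x is regrouped by their normalized product n: the pairs
  over n correspond to the sets of primes dividing n, and their signs cancel unless n = 1.\<close>

lemma sign_wt_sum_times_zeta:
  "(\<Sum>\<^sub>\<infinity>S\<in>prime_sets. sign_wt S) * zeta_gold = 1"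
proof -
  define f where "f = (\<lambda>q. sign_wt (fst q) * wt (snd q))"
  define h where "h = (\<lambda>q :: gold set \<times> gold. (normalize (\<Prod>(fst q) * snd q), fst q))"
  define g where "g = (\<lambda>q :: gold \<times> gold set. (- 1) ^ card (snd q) * wt (fst q))"
  define B where "B = (\<lambda>n :: gold. Pow {p. prime p \<and> p dvd n})"
  have fin: "finite {p. prime p \<and> p dvd n}" if "n \<in> reps" for n
    using that prime_factors_dvd[of n] finite_set_mset[of "prime_factorization n"] by (simp add: reps_def)
  have "(\<lambda>p. wt (\<Prod>(fst p)) * wt (snd p)) summable_on prime_sets \<times> reps"
    by (intro summable_on_mult_Times summable_wt_prime_sets summable_wt_reps) auto
  moreover have "norm (f q) = wt (\<Prod>(fst q)) * wt (snd q)" for q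
    by (simp add: f_def abs_mult abs_sign_wt)
  ultimately have summ: "f summable_on prime_sets \<times> reps"
    by (simp add: abs_summable_summable)
  have "infsum f (prime_sets \<times> reps) = (\<Sum>\<^sub>\<infinity>S\<in>prime_sets. \<Sum>\<^sub>\<infinity>x\<in>reps. f (S, x))"
    by (rule infsum_Sigma_banach[OF summ, symmetric])
  also have "\<dots> = (\<Sum>\<^sub>\<infinity>S\<in>prime_sets. sign_wt S * zeta_gold)"
    by (simp add: f_def zeta_gold_def infsum_cmult_right')
  finally have prod: "infsum f (prime_sets \<times> reps) = (\<Sum>\<^sub>\<infinity>S\<in>prime_sets. sign_wt S) * zeta_gold"
    by (simp add: infsum_cmult_left')
  have bij: "bij_betw h (prime_sets \<times> reps) (Sigma reps B)"
  proof (rule bij_betwI[where g = "\<lambda>(n, S). (S, normalize (n div \<Prod>S))"])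
    show "h \<in> prime_sets \<times> reps \<rightarrow> Sigma reps B"
    proof (rule funcsetI)
      fix q assume "q \<in> prime_sets \<times> reps"
      then have q: "fst q \<in> prime_sets" "snd q \<in> reps" by auto
      then have "normalize (\<Prod>(fst q) * snd q) \<in> reps"
        using prod_primes_nonzero[of "fst q"] by (simp add: reps_def)
      moreover have "p dvd \<Prod>(fst q)" if "p \<in> fst q" for p
        using that prod_primes_dvd_iff[OF q(1), of "\<Prod>(fst q)"] dvd_refl by blast
      ultimately show "h q \<in> Sigma reps B"
        using q unfolding h_def B_def by (auto simp: prime_sets_def)
    qed
    have B: "S \<in> prime_sets" "\<Prod>S dvd n" if "n \<in> reps" "S \<in> B n" for n S
    proof -
      show S: "S \<in> prime_sets"
        using that(2) finite_subset[OF _ fin[OF that(1)]] by (auto simp: B_def prime_sets_def)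
      show "\<Prod>S dvd n"
        unfolding prod_primes_dvd_iff[OF S] using that(2) by (auto simp: B_def)
    qed
    show "(\<lambda>(n, S). (S, normalize (n div \<Prod>S))) \<in> Sigma reps B \<rightarrow> prime_sets \<times> reps"
    proof (rule funcsetI)
      fix q assume "q \<in> Sigma reps B"
      then obtain n S where q: "q = (n, S)" "n \<in> reps" "S \<in> B n" by auto
      have "normalize (n div \<Prod>S) \<in> reps"
        using B(2)[OF q(2,3)] q(2) by (simp add: reps_def dvd_div_eq_0_iff)
      then show "(\<lambda>(n, S). (S, normalize (n div \<Prod>S))) q \<in> prime_sets \<times> reps"
        using B(1)[OF q(2,3)] q(1) by simp
    qed
    show "(\<lambda>(n, S). (S, normalize (n div \<Prod>S))) (h q) = q" if "q \<in> prime_sets \<times> reps" for q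
    proof -
      have "fst q \<in> prime_sets" "snd q \<in> reps" using that by auto
      then show ?thesis
        using normalize_quot_unique[of "snd q" "\<Prod>(fst q)"] prod_primes_nonzero[of "fst q"]
        by (simp add: h_def)
    qed
    show "h ((\<lambda>(n, S). (S, normalize (n div \<Prod>S))) q) = q" if qB: "q \<in> Sigma reps B" for q
    proof -
      from qB obtain n S where q: "q = (n, S)" "n \<in> reps" "S \<in> B n" by auto
      have "normalize (\<Prod>S * normalize (n div \<Prod>S)) = n"
        using B(2)[OF q(2,3)] q(2) by (simp add: reps_def)
      then show ?thesis by (simp add: q(1) h_def)
    qed
  qed
  have fg: "g (h p) = f p" for p
    by (simp add: f_def g_def h_def wt_mult sign_wt_def)
  have "infsum f (prime_sets \<times> reps) = infsum g (Sigma reps B)"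
    using infsum_reindex_bij_betw[OF bij, of g] by (simp add: fg)
  also have "\<dots> = (\<Sum>\<^sub>\<infinity>n\<in>reps. \<Sum>\<^sub>\<infinity>S\<in>B n. g (n, S))"
    using summable_on_reindex_bij_betw[OF bij, of g] summ by (intro infsum_Sigma_banach[symmetric]) (simp add: fg)
  also have "\<dots> = (\<Sum>\<^sub>\<infinity>n\<in>reps. if n = 1 then 1 else 0)"
  proof (rule infsum_cong)
    fix n assume n: "n \<in> reps"
    have "(\<Sum>\<^sub>\<infinity>S\<in>B n. g (n, S)) = (\<Sum>S\<in>B n. (- 1) ^ card S) * wt n"
      using fin[OF n] by (simp add: B_def g_def sum_distrib_right)
    also have "\<dots> = (if {p. prime p \<and> p dvd n} = {} then 1 else 0) * wt n"
      unfolding B_def using sum_alternating_Pow[OF fin[OF n]] by simp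
    also have "{p. prime p \<and> p dvd n} = {} \<longleftrightarrow> n = 1"
    proof
      assume "{p. prime p \<and> p dvd n} = {}"
      then have "n dvd 1" using prime_divisor_exists[of n] n by (auto simp: reps_def)
      then show "n = 1" using n by (auto simp: reps_def is_unit_normalize)
    next
      assume "n = 1" then show "{p. prime p \<and> p dvd n} = {}" by (auto simp: not_prime_unit)
    qed
    finally show "(\<Sum>\<^sub>\<infinity>S\<in>B n. g (n, S)) = (if n = 1 then 1 else 0)"
      by (simp add: wt_def)
  qed
  also have "\<dots> = (\<Sum>\<^sub>\<infinity>n\<in>{1 :: gold}. 1)"
    by (rule infsum_cong_neutral) (auto simp: one_in_reps)
  finally show ?thesis using prod by simp
qed

definition prime_sets' :: "gold set set" where
  "prime_sets' = {S \<in> prime_sets. pi5 \<notin> S}"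

text \<open>Removes the Euler factor of the prime above 5. Inserting \<open>pi5\<close>, of norm 5
  up to sign, multiplies a term by -1/25, so the full sum is 24/25 of the restricted one.\<close>

lemma sign_wt_sum_coprime_5:
  "(\<Sum>\<^sub>\<infinity>S\<in>prime_sets'. sign_wt S) = 25 / (24 * zeta_gold)"
proof -
  let ?A = "\<Sum>\<^sub>\<infinity>S\<in>prime_sets'. sign_wt S"
  have inj: "inj_on (insert pi5) prime_sets'"
    unfolding prime_sets'_def by (auto intro!: inj_onI dest: insert_ident[THEN iffD1, rotated 2])
  have un: "prime_sets = prime_sets' \<union> insert pi5 ` prime_sets'"
  proof (intro equalityI subsetI)
    fix S assume S: "S \<in> prime_sets"
    show "S \<in> prime_sets' \<union> insert pi5 ` prime_sets'"
    proof (cases "pi5 \<in> S")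
      case True
      then have "S = insert pi5 (S - {pi5})" by auto
      moreover have "S - {pi5} \<in> prime_sets'" using S by (auto simp: prime_sets_def prime_sets'_def)
      ultimately show ?thesis by blast
    qed (use S in \<open>auto simp: prime_sets'_def\<close>)
  qed (auto simp: prime_sets_def prime_sets'_def prime_pi5)
  have ins: "sign_wt (insert pi5 S) = - (1 / 25) * sign_wt S" if "S \<in> prime_sets'" for S
  proof -
    have "wt pi5 = 1 / 25"
    proof -
      have "\<bar>gnorm pi5\<bar>\<^sup>2 = 25" unfolding abs_gnorm_pi5 by simp
      then have "(gnorm pi5)\<^sup>2 = 25" by simp
      then show ?thesis unfolding wt_def of_int_power[symmetric] by simp
    qed
    then show ?thesis
      using that by (simp add: prime_sets'_def prime_sets_def sign_wt_def wt_mult)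
  qed
  have summ: "sign_wt summable_on prime_sets'" "sign_wt summable_on insert pi5 ` prime_sets'"
    using summable_sign_wt un by (auto intro: summable_on_subset_banach)
  have "(\<Sum>\<^sub>\<infinity>S\<in>prime_sets. sign_wt S) = ?A + (\<Sum>\<^sub>\<infinity>S\<in>insert pi5 ` prime_sets'. sign_wt S)"
    unfolding un by (intro infsum_Un_disjoint summ) (auto simp: prime_sets'_def)
  also have "(\<Sum>\<^sub>\<infinity>S\<in>insert pi5 ` prime_sets'. sign_wt S) = (\<Sum>\<^sub>\<infinity>S\<in>prime_sets'. - (1 / 25) * sign_wt S)"
    by (subst infsum_reindex[OF inj]) (auto simp: o_def ins intro!: infsum_cong)
  also have "\<dots> = - (1 / 25) * ?A"
    by (rule infsum_cmult_right')
  finally have "(\<Sum>\<^sub>\<infinity>S\<in>prime_sets. sign_wt S) = 24 / 25 * ?A" by simp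
  with sign_wt_sum_times_zeta have "24 / 25 * ?A * zeta_gold = 1" by simp
  then show ?thesis
    by (cases "zeta_gold = 0") (auto simp: field_simps)
qed

section \<open>The ring of integers of the cyclotomic field\<close>

lemma gold_of_int_eq_0 [simp]: "(of_int n :: gold) = 0 \<longleftrightarrow> n = 0"
  by (simp add: gold_eq_iff)

section \<open>The fifth root of unity over the golden field\<close>

lemma zeta5_cis: "zeta5 = cis (2 * pi / 5)"
  by (simp add: zeta5_def cis_conv_exp mult_ac)

text \<open>Twice and three times 72 degrees add up to a full turn, so the double and triple angle
  formulas agree at c; after removing the root 1, c is the positive root of a quadratic.\<close>

lemma cos_72: "cos (2 * pi / 5) = (golden - 1) / 2"
proof -
  define c where "c = cos (2 * pi / 5)"
  have "3 * (2 * pi / 5) = 2 * pi - 2 * (2 * pi / 5)" by (simp add: field_simps)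
  then have "cos (3 * (2 * pi / 5)) = cos (2 * (2 * pi / 5))"
    by (simp only: cos_2pi_minus)
  then have "4 * c ^ 3 - 3 * c = 2 * c\<^sup>2 - 1"
    unfolding cos_treble_cos cos_double_cos c_def .
  then have "(c - 1) * (4 * c\<^sup>2 + 2 * c - 1) = 0"
    by (simp add: algebra_simps power2_eq_square power3_eq_cube)
  moreover have c: "c < 1" "0 < c"
  proof -
    have "cos (2 * pi / 5) < cos 0" by (intro cos_monotone_0_pi) auto
    then show "c < 1" by (simp add: c_def)
    show "0 < c" unfolding c_def by (intro cos_gt_zero) auto
  qed
  ultimately have "4 * c\<^sup>2 + 2 * c - 1 = 0" by simp
  then have "(4 * c + 1)\<^sup>2 = 5" by (simp add: power2_eq_square algebra_simps)
  then have "4 * c + 1 = sqrt 5" using c by (intro real_sqrt_unique[symmetric]) auto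
  then show ?thesis by (simp add: golden_def c_def field_simps)
qed

lemma Re_zeta5: "Re zeta5 = (golden - 1) / 2"
  by (simp add: zeta5_cis cos_72)

lemma Im_zeta5_pos: "0 < Im zeta5"
  unfolding zeta5_cis by (simp add: sin_gt_zero)

lemma Im_zeta5_square: "(Im zeta5)\<^sup>2 = (golden + 2) / 4"
proof -
  have "(Re zeta5)\<^sup>2 + (Im zeta5)\<^sup>2 = 1"
    by (simp add: zeta5_cis)
  then show ?thesis unfolding Re_zeta5 using golden_square
    by (simp add: power2_eq_square field_simps)
qed

text \<open>The minimal polynomial over the golden field: the relative norm of \<open>zeta5\<close>
  is 1 and its relative trace is 2 cos 72 = \<open>golden - 1\<close>.\<close>

lemma zeta5_square: "zeta5\<^sup>2 = of_real (golden - 1) * zeta5 - 1"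
proof -
  have "Im zeta5 * Im zeta5 = (golden + 2) / 4" "golden * golden = golden + 1"
    using Im_zeta5_square golden_square by (simp_all add: power2_eq_square)
  then show ?thesis
    by (simp add: complex_eq_iff power2_eq_square Re_zeta5 field_simps)
qed

lemma Re_zeta5_square: "Re (zeta5\<^sup>2) = - golden / 2"
  unfolding zeta5_square using golden_square by (simp add: Re_zeta5 field_simps)

lemma Im_zeta5_square': "Im (zeta5\<^sup>2) = (golden - 1) * Im zeta5"
  unfolding zeta5_square by simp

text \<open>The conjugate relation: \<open>zeta5\<close> becomes its square and
  \<open>golden - 1\<close> becomes \<open>- golden\<close>. It makes \<open>emb'\<close> multiply
  by the same formula as \<open>emb\<close>.\<close>

lemma zeta5_square_square: "(zeta5\<^sup>2)\<^sup>2 = of_real (- golden) * zeta5\<^sup>2 - 1"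
proof -
  have "(zeta5\<^sup>2)\<^sup>2 = (of_real (golden - 1) * zeta5 - 1)\<^sup>2" by (simp add: zeta5_square)
  also have "\<dots> = of_real ((golden - 1)\<^sup>2) * zeta5\<^sup>2 - 2 * (of_real (golden - 1) * zeta5 - 1) - 1"
    by (simp add: power2_eq_square algebra_simps)
  also have "\<dots> = of_real ((golden - 1)\<^sup>2 - 2) * zeta5\<^sup>2 - 1"
    unfolding zeta5_square[symmetric] by (simp add: algebra_simps)
  also have "(golden - 1)\<^sup>2 - 2 = - golden"
    using golden_square by (simp add: power2_eq_square algebra_simps)
  finally show ?thesis .
qed

definition emb :: "gold \<Rightarrow> gold \<Rightarrow> complex" where
  "emb a b = of_real (rv a) + of_real (rv b) * zeta5"

text \<open>The image of \<open>emb a b\<close> under \<open>sigma\<close>, which sends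
  \<open>zeta5\<close> to its square and hence tau to 1 - tau; \<open>sigma_emb\<close> proves
  this.\<close>

definition emb' :: "gold \<Rightarrow> gold \<Rightarrow> complex" where
  "emb' a b = of_real (rv' a) + of_real (rv' b) * zeta5\<^sup>2"

text \<open>The inverse of tau. It occurs both as the relative trace of \<open>zeta5\<close> and as
  the factor by which points hide each other.\<close>

abbreviation gphi :: gold where "gphi \<equiv> Gold (- 1) 1"

lemma rv_gphi: "rv gphi = golden - 1" "rv' gphi = - golden"
  by (simp_all add: rv_def rv'_def)

lemma emb_add: "emb a b + emb c d = emb (a + c) (b + d)" "emb' a b + emb' c d = emb' (a + c) (b + d)"
  by (simp_all add: emb_def emb'_def algebra_simps)

lemma emb_minus: "- emb a b = emb (- a) (- b)" "- emb' a b = emb' (- a) (- b)"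
  by (simp_all add: emb_def emb'_def)

lemma emb_mult: "emb a b * emb c d = emb (a * c - b * d) (a * d + b * c + gphi * b * d)"
proof -
  have "emb a b * emb c d = of_real (rv a * rv c) + of_real (rv a * rv d + rv b * rv c) * zeta5
      + of_real (rv b * rv d) * zeta5\<^sup>2"
    by (simp add: emb_def algebra_simps power2_eq_square)
  also have "\<dots> = emb (a * c - b * d) (a * d + b * c + gphi * b * d)"
    unfolding zeta5_square by (simp add: emb_def rv_gphi algebra_simps)
  finally show ?thesis .
qed

lemma emb'_mult: "emb' a b * emb' c d = emb' (a * c - b * d) (a * d + b * c + gphi * b * d)"
proof -
  have "emb' a b * emb' c d = of_real (rv' a * rv' c) + of_real (rv' a * rv' d + rv' b * rv' c) * zeta5\<^sup>2
      + of_real (rv' b * rv' d) * (zeta5\<^sup>2)\<^sup>2"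
    by (simp add: emb'_def algebra_simps power2_eq_square)
  also have "\<dots> = emb' (a * c - b * d) (a * d + b * c + gphi * b * d)"
    unfolding zeta5_square_square by (simp add: emb'_def rv_gphi algebra_simps)
  finally show ?thesis .
qed

lemma emb_eq_iff [simp]: "emb a b = emb c d \<longleftrightarrow> a = c \<and> b = d"
proof
  assume eq: "emb a b = emb c d"
  then have "Im (emb a b) = Im (emb c d)" by simp
  then have "rv b = rv d" using Im_zeta5_pos by (simp add: emb_def)
  with eq show "a = c \<and> b = d" by (simp add: emb_def)
qed simp

lemma emb'_eq_iff [simp]: "emb' a b = emb' c d \<longleftrightarrow> a = c \<and> b = d"
proof
  assume eq: "emb' a b = emb' c d"
  then have "Im (emb' a b) = Im (emb' c d)" by simp
  then have "rv' b = rv' d" using Im_zeta5_pos golden_gt by (simp add: emb'_def Im_zeta5_square' )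
  with eq show "a = c \<and> b = d" by (simp add: emb'_def)
qed simp

lemma emb_1: "emb 1 0 = 1" "emb' 1 0 = 1"
  by (simp_all add: emb_def emb'_def)

lemma emb_zeta5: "emb 0 1 = zeta5" "emb' 0 1 = zeta5\<^sup>2"
  by (simp_all add: emb_def emb'_def)

lemma of_real_mult_emb: "of_real (rv c) * emb a b = emb (c * a) (c * b)" "of_real (rv' c) * emb' a b = emb' (c * a) (c * b)"
  by (simp_all add: emb_def emb'_def algebra_simps)

lemma scaleR_emb: "rv c *\<^sub>R emb a b = emb (c * a) (c * b)" "rv' c *\<^sub>R emb' a b = emb' (c * a) (c * b)"
  by (simp_all add: scaleR_conv_of_real of_real_mult_emb)

lemma emb_eq_0_iff [simp]: "emb a b = 0 \<longleftrightarrow> a = 0 \<and> b = 0" "emb' a b = 0 \<longleftrightarrow> a = 0 \<and> b = 0"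
proof -
  have "emb 0 0 = 0" "emb' 0 0 = 0" by (simp_all add: emb_def emb'_def)
  then show "emb a b = 0 \<longleftrightarrow> a = 0 \<and> b = 0" "emb' a b = 0 \<longleftrightarrow> a = 0 \<and> b = 0"
    by (metis emb_eq_iff, metis emb'_eq_iff)
qed

subsection \<open>The generated rings\<close>

abbreviation (input) CR :: "complex ring" where "CR \<equiv> ring_of_type_algebra"

lemma CR_simps [simp]:
  "carrier CR = UNIV" "x \<otimes>\<^bsub>CR\<^esub> y = x * y" "x \<oplus>\<^bsub>CR\<^esub> y = x + y" "\<one>\<^bsub>CR\<^esub> = 1" "\<zero>\<^bsub>CR\<^esub> = 0"
  by (simp_all add: ring_of_type_algebra_def)

lemma CR_field: "field CR"
  by (rule field_from_type_algebra)

lemma CR_a_inv [simp]: "\<ominus>\<^bsub>CR\<^esub> x = - x"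
proof -
  interpret field CR by (rule CR_field)
  show ?thesis using minus_equality[of "- x" x] by simp
qed

lemma CR_m_inv [simp]: "x \<noteq> 0 \<Longrightarrow> inv\<^bsub>CR\<^esub> x = 1 / x"
proof -
  interpret field CR by (rule CR_field)
  show "x \<noteq> 0 \<Longrightarrow> inv\<^bsub>CR\<^esub> x = 1 / x" by (rule inv_char) auto
qed

lemma subring_of_complex_simps [simp]:
  "carrier (subring_of_complex A) = A" "x \<otimes>\<^bsub>subring_of_complex A\<^esub> y = x * y"
  "x \<oplus>\<^bsub>subring_of_complex A\<^esub> y = x + y" "\<one>\<^bsub>subring_of_complex A\<^esub> = 1" "\<zero>\<^bsub>subring_of_complex A\<^esub> = 0"
  by (simp_all add: subring_of_complex_def ring_of_type_algebra_def)

lemma emb_in_Z_zeta5: "emb a b \<in> Z_zeta5"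
proof -
  have add: "x \<in> Z_zeta5 \<Longrightarrow> y \<in> Z_zeta5 \<Longrightarrow> x + y \<in> Z_zeta5"
    and mult: "x \<in> Z_zeta5 \<Longrightarrow> y \<in> Z_zeta5 \<Longrightarrow> x * y \<in> Z_zeta5"
    and neg: "x \<in> Z_zeta5 \<Longrightarrow> - x \<in> Z_zeta5" for x y
    using generate_ring.eng_add[of x CR "{zeta5}" y] generate_ring.eng_mult[of x CR "{zeta5}" y]
      generate_ring.a_inv[of x CR "{zeta5}"] by (simp_all add: Z_zeta5_def)
  have one: "1 \<in> Z_zeta5" and z: "zeta5 \<in> Z_zeta5"
    using generate_ring.one[of CR "{zeta5}"] generate_ring.incl[of zeta5 "{zeta5}" CR]
    by (simp_all add: Z_zeta5_def)
  have zero: "0 \<in> Z_zeta5" using add[OF one neg[OF one]] by simp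
  have int: "of_int k \<in> Z_zeta5" for k
  proof (induction k rule: int_induct[of _ 0])
    case (step2 i)
    then show ?case using add[OF step2(2) neg[OF one]] by simp
  qed (use zero add one in auto)
  \<comment> \<open>\<open>zeta5 + zeta5 ^ 4\<close> is 2 cos 72 = tau - 1; this brings the
    coefficients from the golden ring into the generated ring.\<close>
  have "emb gphi 0 = emb 0 1 + emb 0 1 * (emb 0 1 * (emb 0 1 * emb 0 1))"
    unfolding emb_mult emb_add by (simp add: gold_eq_iff)
  then have "emb gphi 0 = zeta5 + zeta5 * (zeta5 * (zeta5 * zeta5))"
    by (simp add: emb_zeta5)
  then have phi: "emb gphi 0 \<in> Z_zeta5"
    using add[OF z mult[OF z mult[OF z mult[OF z z]]]] by simp
  have re: "of_real (rv c) \<in> Z_zeta5" for c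
  proof -
    have "of_real (rv c) = of_int (gre c + gim c) + of_int (gim c) * emb gphi 0"
      by (simp add: rv_def emb_def rv_gphi algebra_simps)
    then show ?thesis using add mult int phi by simp
  qed
  show ?thesis unfolding emb_def by (intro add mult re z)
qed

lemma Z_zeta5_eq: "Z_zeta5 = {emb a b | a b. True}"
proof (intro equalityI subsetI)
  fix x assume "x \<in> Z_zeta5"
  then have "x \<in> generate_ring CR {zeta5}" by (simp add: Z_zeta5_def)
  then show "x \<in> {emb a b | a b. True}"
  proof induction
    case one
    then show ?case using emb_1(1)[symmetric] by (simp only: CR_simps) blast
  next
    case (incl h)
    then show ?case using emb_zeta5(1)[symmetric] by auto
  next
    case (a_inv h)
    then show ?case by (auto simp: emb_minus)
  next
    case (eng_add h1 h2)
    then show ?case by (auto simp: emb_add)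
  next
    case (eng_mult h1 h2)
    then show ?case by (auto simp: emb_mult)
  qed
qed (auto intro: emb_in_Z_zeta5)

text \<open>Integer denominators suffice because inverses are rationalized twice: the complex
  conjugate brings the denominator into the golden ring, and \<open>gconj\<close> of the result
  brings it into the integers.\<close>

lemma Q_zeta5_eq: "Q_zeta5 = {emb a b / of_int n | a b n. n \<noteq> 0}"
proof (intro equalityI subsetI)
  fix x assume "x \<in> Q_zeta5"
  then have "x \<in> generate_field CR {zeta5}" by (simp add: Q_zeta5_def)
  then show "x \<in> {emb a b / of_int n | a b n. n \<noteq> 0}"
  proof induction
    case one
    have "(1 :: complex) = emb 1 0 / of_int 1" by (simp add: emb_1)
    then show ?case unfolding CR_simps using zero_neq_one[where 'a = int] by (metis (mono_tags, lifting) mem_Collect_eq)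
  next
    case (incl h)
    then have "h = emb 0 1 / of_int 1" by (simp add: emb_zeta5)
    then show ?case using zero_neq_one[where 'a = int] by (metis (mono_tags, lifting) mem_Collect_eq)
  next
    case (a_inv h)
    then obtain a b n where "h = emb a b / of_int n" "n \<noteq> 0" by auto
    then have "- h = emb (- a) (- b) / of_int n" by (simp add: emb_minus[symmetric])
    then show ?case using \<open>n \<noteq> 0\<close> by (simp only: CR_a_inv) blast
  next
    case (m_inv h)
    then obtain a b n where h: "h = emb a b / of_int n" "n \<noteq> 0" by auto
    \<comment> \<open>The relative norm. The complex conjugate of \<open>emb a b\<close> is
      \<open>emb (a + b * gphi) (- b)\<close>, because the conjugate of \<open>zeta5\<close> is
      \<open>golden - 1 - zeta5\<close>.\<close>
    define c where "c = a * a + a * b * gphi + b * b"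
    have nz: "emb a b \<noteq> 0" using h m_inv by auto
    have "emb a b * emb (a + b * gphi) (- b) = emb c 0"
      unfolding emb_mult c_def by (simp add: algebra_simps)
    moreover have "emb (a + b * gphi) (- b) \<noteq> 0"
      using nz by auto
    ultimately have c0: "c \<noteq> 0" using nz by (metis emb_eq_0_iff(1) mult_eq_0_iff)
    then have N: "gnorm c \<noteq> 0" by simp
    have "emb a b * emb (a + b * gphi) (- b) * emb (gconj c) 0 = emb (c * gconj c) 0"
      using \<open>emb a b * emb (a + b * gphi) (- b) = emb c 0\<close> by (simp add: emb_mult)
    also have "\<dots> = of_int (gnorm c)" by (simp add: mult_gconj emb_def del: rv_mult)
    finally have *: "emb a b * (emb (a + b * gphi) (- b) * emb (gconj c) 0) = of_int (gnorm c)"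
      by (simp add: mult.assoc)
    have "1 / h = of_int n / emb a b" using h by simp
    also have "\<dots> = of_int n * (emb (a + b * gphi) (- b) * emb (gconj c) 0) / of_int (gnorm c)"
    proof -
      have "k / e = k * u / v" if "e \<noteq> 0" "v \<noteq> 0" "e * u = v" for k e u v :: complex
        using that by (auto simp: field_simps)
      from this[OF nz _ *] show ?thesis using N by simp
    qed
    also have "of_int n * (emb (a + b * gphi) (- b) * emb (gconj c) 0)
       = emb (of_int n) 0 * (emb (a + b * gphi) (- b) * emb (gconj c) 0)"
      by (simp add: emb_def)
    finally obtain p q where "1 / h = emb p q / of_int (gnorm c)" unfolding emb_mult by blast
    moreover have "h \<noteq> 0" using m_inv by simp
    ultimately show ?case using N CR_m_inv[of h] by (simp only:) blast
  next
    case (eng_add h1 h2)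
    then obtain a b n c d m where h: "h1 = emb a b / of_int n" "n \<noteq> 0" "h2 = emb c d / of_int m" "m \<noteq> 0"
      by auto
    have "h1 + h2 = (of_real (rv (of_int m)) * emb a b + of_real (rv (of_int n)) * emb c d) / of_int (n * m)"
      using h by (simp add: field_simps)
    then show ?case using h unfolding of_real_mult_emb emb_add CR_simps
      by (metis (mono_tags, lifting) mem_Collect_eq mult_eq_0_iff)
  next
    case (eng_mult h1 h2)
    then obtain a b n c d m where h: "h1 = emb a b / of_int n" "n \<noteq> 0" "h2 = emb c d / of_int m" "m \<noteq> 0"
      by auto
    have "h1 * h2 = (emb a b * emb c d) / of_int (n * m)"
      using h by simp
    then show ?case using h unfolding emb_mult CR_simps
      by (metis (mono_tags, lifting) mem_Collect_eq mult_eq_0_iff)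
  qed
next
  fix x assume "x \<in> {emb a b / of_int n | a b n. n \<noteq> 0}"
  then obtain a b n where x: "x = emb a b / of_int n" "n \<noteq> 0" by auto
  interpret field CR by (rule CR_field)
  have sub: "y \<in> Q_zeta5" if "y \<in> Z_zeta5" for y
  proof -
    have "y \<in> generate_ring CR {zeta5}" using that by (simp add: Z_zeta5_def)
    then show ?thesis unfolding Q_zeta5_def
      by induction (auto intro: generate_field.intros simp del: CR_simps CR_a_inv)
  qed
  have "emb (of_int n) 0 \<in> Q_zeta5" "emb a b \<in> Q_zeta5"
    using emb_in_Z_zeta5 sub by auto
  then have "emb a b \<otimes>\<^bsub>CR\<^esub> inv\<^bsub>CR\<^esub> (emb (of_int n) 0) \<in> Q_zeta5"
    using x unfolding Q_zeta5_def by (intro generate_field.eng_mult generate_field.m_inv) auto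
  moreover have "emb a b \<otimes>\<^bsub>CR\<^esub> inv\<^bsub>CR\<^esub> (emb (of_int n) 0) = x"
    using x by (subst CR_m_inv) (auto simp: emb_def)
  ultimately show "x \<in> Q_zeta5" by simp
qed

subsection \<open>The maps \<open>\<sigma>\<close> and \<open>\<kappa>\<close>\<close>

text \<open>An explicit automorphism, showing that the condition defining \<open>sigma\<close> can
  be satisfied. By \<open>emb_quot_eq_iff\<close> the value is independent of the chosen
  fraction.\<close>

definition sigma0 :: "complex \<Rightarrow> complex" where
  "sigma0 x = (SOME y. \<exists>a b n. n \<noteq> 0 \<and> x = emb a b / of_int n \<and> y = emb' a b / of_int n)"

lemma emb_quot_eq_iff:
  assumes "n \<noteq> 0" "m \<noteq> 0"
  shows "emb a b / of_int n = emb c d / of_int m \<longleftrightarrow> emb' a b / of_int n = emb' c d / of_int m"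
proof -
  have "emb a b / of_int n = emb c d / of_int m \<longleftrightarrow>
      of_real (rv (of_int m)) * emb a b = of_real (rv (of_int n)) * emb c d"
    using assms by (simp add: field_simps)
  also have "\<dots> \<longleftrightarrow> of_real (rv' (of_int m)) * emb' a b = of_real (rv' (of_int n)) * emb' c d"
    unfolding of_real_mult_emb by simp
  also have "\<dots> \<longleftrightarrow> emb' a b / of_int n = emb' c d / of_int m"
    using assms by (simp add: field_simps)
  finally show ?thesis .
qed

lemma sigma0_eq:
  assumes "n \<noteq> 0" shows "sigma0 (emb a b / of_int n) = emb' a b / of_int n"
  unfolding sigma0_def
proof (rule someI2)
  show "\<exists>c d m. m \<noteq> 0 \<and> emb a b / of_int n = emb c d / of_int m \<and> emb' a b / of_int n = emb' c d / of_int m"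
    using assms by blast
qed (use emb_quot_eq_iff assms in metis)

lemma Q_zeta5_cases:
  assumes "x \<in> Q_zeta5" obtains a b n where "n \<noteq> 0" "x = emb a b / of_int n"
  using assms unfolding Q_zeta5_eq by blast

lemma emb_quot_in_Q_zeta5: "n \<noteq> 0 \<Longrightarrow> emb a b / of_int n \<in> Q_zeta5"
  unfolding Q_zeta5_eq by blast

text \<open>Rewrites the square of \<open>zeta5\<close> in the basis 1, \<open>zeta5\<close>, so
  that \<open>sigma0\<close> maps the field into itself; the converse formula that follows gives
  surjectivity.\<close>

lemma emb'_eq_emb: "emb' a b = emb (gconj a - gconj b) (gphi * gconj b)"
  unfolding emb'_def emb_def zeta5_square by (simp add: rv_gconj rv_gphi algebra_simps)

lemma emb_eq_emb': "emb a b = emb' (gconj a + gconj (b * Gold 0 1)) (gconj (b * Gold 0 1))"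
proof -
  have g: "gconj (x * y) = gconj x * gconj y" "gconj (gconj x) = x" for x y
    by (simp_all add: gconj_def gold_eq_iff algebra_simps)
  have "gphi * Gold 0 1 = 1" by (simp add: gold_eq_iff)
  then have "gphi * (Gold 0 1 * b) = b" by (metis mult.assoc mult_1)
  moreover have "gconj (x + y) = gconj x + gconj y" for x y
    by (simp add: gconj_def gold_eq_iff)
  ultimately show ?thesis by (simp add: emb'_eq_emb g mult_ac)
qed

lemma sigma0_iso: "sigma0 \<in> ring_iso (subring_of_complex Q_zeta5) (subring_of_complex Q_zeta5)"
proof -
  have mult: "sigma0 (x * y) = sigma0 x * sigma0 y" and add: "sigma0 (x + y) = sigma0 x + sigma0 y"
    if xQ: "x \<in> Q_zeta5" and yQ: "y \<in> Q_zeta5" for x y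
  proof -
    from xQ obtain a b n where x: "n \<noteq> 0" "x = emb a b / of_int n" by (rule Q_zeta5_cases)
    from yQ obtain c d m where y: "m \<noteq> 0" "y = emb c d / of_int m" by (rule Q_zeta5_cases)
    have "x * y = (emb a b * emb c d) / of_int (n * m)" using x y by simp
    then have "sigma0 (x * y) = (emb' a b * emb' c d) / of_int (n * m)"
      unfolding emb_mult emb'_mult using sigma0_eq[of "n * m"] x y by simp
    then show "sigma0 (x * y) = sigma0 x * sigma0 y" using x y sigma0_eq by simp
    have "x + y = (of_real (rv (of_int m)) * emb a b + of_real (rv (of_int n)) * emb c d) / of_int (n * m)"
      using x y by (simp add: field_simps)
    then have "sigma0 (x + y) = (of_real (rv' (of_int m)) * emb' a b + of_real (rv' (of_int n)) * emb' c d) / of_int (n * m)"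
      unfolding of_real_mult_emb emb_add using sigma0_eq[of "n * m"] x y by simp
    moreover have "sigma0 x = emb' a b / of_int n" "sigma0 y = emb' c d / of_int m"
      unfolding x(2) y(2) using x(1) y(1) by (simp_all add: sigma0_eq)
    moreover have "(of_real (rv' (of_int m)) * p + of_real (rv' (of_int n)) * q) / of_int (n * m) = p / of_int n + q / of_int m" for p q :: complex
      using x(1) y(1) by (simp add: add_divide_distrib)
    ultimately show "sigma0 (x + y) = sigma0 x + sigma0 y" by (simp only:)
  qed
  have in_Q: "sigma0 x \<in> Q_zeta5" if "x \<in> Q_zeta5" for x
    using that by (elim Q_zeta5_cases) (simp add: sigma0_eq emb'_eq_emb emb_quot_in_Q_zeta5)
  have "inj_on sigma0 Q_zeta5"
    using emb_quot_eq_iff sigma0_eq by (intro inj_onI) (metis Q_zeta5_cases)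
  moreover have "y \<in> sigma0 ` Q_zeta5" if yQ: "y \<in> Q_zeta5" for y
  proof -
    from yQ obtain c d m where y: "m \<noteq> 0" "y = emb c d / of_int m" by (rule Q_zeta5_cases)
    obtain a b where "emb c d = emb' a b" using emb_eq_emb' by blast
    then have "y = sigma0 (emb a b / of_int m)" using y sigma0_eq by simp
    then show ?thesis using emb_quot_in_Q_zeta5[OF y(1)] by blast
  qed
  ultimately have "bij_betw sigma0 Q_zeta5 Q_zeta5"
    using in_Q by (auto simp: bij_betw_def)
  moreover have "sigma0 1 = 1"
    using sigma0_eq[of 1 1 0] by (simp add: emb_1)
  ultimately show ?thesis
    using mult add in_Q by (auto simp: ring_iso_def intro!: ring_hom_memI)
qed

lemma sigma0_zeta5: "sigma0 zeta5 = zeta5\<^sup>2"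
  using sigma0_eq[of 1 0 1] by (simp add: emb_zeta5)

lemma Z_subset_Q: "Z_zeta5 \<subseteq> Q_zeta5"
  using emb_quot_in_Q_zeta5[of 1] by (auto simp: Z_zeta5_eq)

lemma Z_zeta5_closed:
  "1 \<in> Z_zeta5" "zeta5 \<in> Z_zeta5"
  "x \<in> Z_zeta5 \<Longrightarrow> - x \<in> Z_zeta5"
  "x \<in> Z_zeta5 \<Longrightarrow> y \<in> Z_zeta5 \<Longrightarrow> x + y \<in> Z_zeta5"
  "x \<in> Z_zeta5 \<Longrightarrow> y \<in> Z_zeta5 \<Longrightarrow> x * y \<in> Z_zeta5"
  unfolding Z_zeta5_def
  using generate_ring.eng_add[of x CR "{zeta5}" y] generate_ring.eng_mult[of x CR "{zeta5}" y]
      generate_ring.a_inv[of x CR "{zeta5}"]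
      generate_ring.one[of CR "{zeta5}"] generate_ring.incl[of zeta5 "{zeta5}" CR] by simp_all

text \<open>Induction over the generation of the ring by \<open>zeta5\<close>. It pins down the
  values of \<open>sigma\<close> and \<open>kappa\<close>, which are given only through a
  choice.\<close>

lemma ring_hom_agree_on_Z_zeta5:
  assumes h: "h \<in> ring_hom (subring_of_complex A) S" and k: "k \<in> ring_hom (subring_of_complex A) S"
    and S: "ring S" and A: "Z_zeta5 \<subseteq> A" and z: "h zeta5 = k zeta5" and x: "x \<in> Z_zeta5"
  shows "h x = k x"
proof -
  interpret S: ring S by (rule S)
  have neg: "f (- y) = \<ominus>\<^bsub>S\<^esub> f y" if f: "f \<in> ring_hom (subring_of_complex A) S" and y: "y \<in> Z_zeta5" for f y
  proof -
    have cl: "f u \<in> carrier S" if "u \<in> Z_zeta5" for u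
      using ring_hom_closed[OF f] that A by auto
    have ad: "f (u + v) = f u \<oplus>\<^bsub>S\<^esub> f v" if "u \<in> Z_zeta5" "v \<in> Z_zeta5" for u v
      using ring_hom_add[OF f, of u v] that A by auto
    have z0: "0 \<in> Z_zeta5" using Z_zeta5_closed(4)[OF Z_zeta5_closed(1) Z_zeta5_closed(3)[OF Z_zeta5_closed(1)]] by simp
    have "f 0 \<oplus>\<^bsub>S\<^esub> f 0 = f 0" using ad[OF z0 z0] by simp
    then have "f 0 = \<zero>\<^bsub>S\<^esub>" using cl[OF z0] by (metis S.add.l_cancel_one')
    then have "f (- y) \<oplus>\<^bsub>S\<^esub> f y = \<zero>\<^bsub>S\<^esub>" using ad[OF Z_zeta5_closed(3)[OF y] y] by simp
    then show ?thesis using cl y Z_zeta5_closed(3) by (metis S.minus_equality)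
  qed
  have "x \<in> generate_ring CR {zeta5}" using x by (simp add: Z_zeta5_def)
  then have "x \<in> Z_zeta5 \<and> h x = k x"
  proof induction
    case one
    then show ?case using ring_hom_one[OF h] ring_hom_one[OF k] Z_zeta5_closed(1) by simp
  next
    case (incl y)
    then show ?case using z Z_zeta5_closed(2) by simp
  next
    case (a_inv y)
    then show ?case using neg[OF h, of y] neg[OF k, of y] Z_zeta5_closed(3) by simp
  next
    case (eng_add u v)
    then show ?case using ring_hom_add[OF h, of u v] ring_hom_add[OF k, of u v] A Z_zeta5_closed(4)[of u v]
      by (simp add: subset_iff)
  next
    case (eng_mult u v)
    then show ?case using ring_hom_mult[OF h, of u v] ring_hom_mult[OF k, of u v] A Z_zeta5_closed(5)[of u v]
      by (simp add: subset_iff)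
  qed
  then show ?thesis ..
qed

lemma ring_subring_of_complex:
  assumes "1 \<in> A" "\<And>x. x \<in> A \<Longrightarrow> - x \<in> A" "\<And>x y. x \<in> A \<Longrightarrow> y \<in> A \<Longrightarrow> x + y \<in> A"
    "\<And>x y. x \<in> A \<Longrightarrow> y \<in> A \<Longrightarrow> x * y \<in> A"
  shows "ring (subring_of_complex A)"
proof -
  interpret field CR by (rule CR_field)
  show ?thesis unfolding subring_of_complex_def
    by (intro subring_is_ring subringI) (use assms in auto)
qed

lemma ring_Q_zeta5: "ring (subring_of_complex Q_zeta5)"
  by (intro ring_subring_of_complex)
    (use generate_field.one[of CR "{zeta5}"] generate_field.a_inv[of _ CR "{zeta5}"]
      generate_field.eng_add[of _ CR "{zeta5}"] generate_field.eng_mult[of _ CR "{zeta5}"] in \<open>simp_all add: Q_zeta5_def\<close>)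

lemma sigma_emb: "sigma (emb a b) = emb' a b"
proof -
  have ex: "sigma \<in> ring_iso (subring_of_complex Q_zeta5) (subring_of_complex Q_zeta5) \<and> sigma zeta5 = zeta5 ^ 2"
    unfolding sigma_def by (rule someI[of _ sigma0]) (use sigma0_iso sigma0_zeta5 in auto)
  have h: "sigma \<in> ring_hom (subring_of_complex Q_zeta5) (subring_of_complex Q_zeta5)"
      "sigma0 \<in> ring_hom (subring_of_complex Q_zeta5) (subring_of_complex Q_zeta5)"
    using ex sigma0_iso unfolding ring_iso_def by blast+
  have "sigma (emb a b) = sigma0 (emb a b)"
    by (rule ring_hom_agree_on_Z_zeta5[OF h ring_Q_zeta5 Z_subset_Q _ emb_in_Z_zeta5])
      (simp add: ex sigma0_zeta5)
  then show ?thesis using sigma0_eq[of 1 a b] by simp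
qed

definition kap2 :: "gold \<Rightarrow> gold \<Rightarrow> int" where
  "kap2 a b = (kap a + kap b) mod 5"

lemma kap_add: "kap (x + y) = (kap x + kap y) mod 5"
  unfolding kap_def by (simp add: mod_add_eq algebra_simps)

lemma kap_cong: "kap x = kap y \<longleftrightarrow> kap (x - y) = 0"
  unfolding kap_def mod_eq_dvd_iff dvd_eq_mod_eq_0[symmetric] by (simp add: algebra_simps)

lemma kap2_alt: "kap2 a b = kap (a + b)"
  by (simp add: kap2_def kap_add)

lemma kap2_mult: "kap2 (a * c - b * d) (a * d + b * c + gphi * b * d) = (kap2 a b * kap2 c d) mod 5"
proof -
  \<comment> \<open>Under \<open>zeta5\<close> -> 1 the relation for the square of
    \<open>zeta5\<close> turns into \<open>gphi = 2\<close>, which is true modulo sqrt 5; the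
    discrepancy is a multiple of \<open>gphi - 2\<close>.\<close>
  have "a * c - b * d + (a * d + b * c + gphi * b * d) - (a + b) * (c + d) = (gphi - 1 - 1) * (b * d)"
    by (simp add: algebra_simps)
  moreover have "kap (gphi - 1 - 1) = 0" unfolding kap_def gold_sel by simp
  ultimately have "kap (a * c - b * d + (a * d + b * c + gphi * b * d)) = kap ((a + b) * (c + d))"
    unfolding kap_cong[of _ "(a + b) * (c + d)"] by (simp only: kap_mult) simp
  then show ?thesis unfolding kap2_alt by (simp add: kap_mult)
qed

lemma kappa_emb: "kappa (emb a b) = kap2 a b"
proof -
  \<comment> \<open>The explicit homomorphism that shows the choice defining \<open>kappa\<close> to
    be satisfiable, and with which it must then agree.\<close>
  define k0 where "k0 x = (THE r. \<exists>a b. x = emb a b \<and> r = kap2 a b)" for x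
  have k0: "k0 (emb a b) = kap2 a b" for a b
    unfolding k0_def by (rule the_equality) auto
  interpret residues 5 "residue_ring 5" by unfold_locales auto
  have hom: "k0 \<in> ring_hom (subring_of_complex Z_zeta5) (residue_ring 5)"
  proof (rule ring_hom_memI)
    fix x assume "x \<in> carrier (subring_of_complex Z_zeta5)"
    then obtain a b where "x = emb a b" by (auto simp: Z_zeta5_eq)
    then show "k0 x \<in> carrier (residue_ring 5)"
      using pos_mod_bound[of 5 "kap a + kap b"] by (simp add: k0 residue_ring_def kap2_def)
  next
    fix x y assume "x \<in> carrier (subring_of_complex Z_zeta5)" "y \<in> carrier (subring_of_complex Z_zeta5)"
    then obtain a b c d where xy: "x = emb a b" "y = emb c d" by (auto simp: Z_zeta5_eq)
    show "k0 (x \<otimes>\<^bsub>subring_of_complex Z_zeta5\<^esub> y) = k0 x \<otimes>\<^bsub>residue_ring 5\<^esub> k0 y"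
      unfolding xy subring_of_complex_simps emb_mult k0 kap2_mult by (simp add: residue_ring_def)
    show "k0 (x \<oplus>\<^bsub>subring_of_complex Z_zeta5\<^esub> y) = k0 x \<oplus>\<^bsub>residue_ring 5\<^esub> k0 y"
      unfolding xy subring_of_complex_simps emb_add k0 kap2_alt
      by (simp add: residue_ring_def kap_add[symmetric] algebra_simps)
  next
    show "k0 \<one>\<^bsub>subring_of_complex Z_zeta5\<^esub> = \<one>\<^bsub>residue_ring 5\<^esub>"
      using k0[of 1 0] by (simp add: emb_1 residue_ring_def kap2_def kap_def)
  qed
  have one: "k0 zeta5 = 1"
    using k0[of 0 1] by (simp add: emb_zeta5 kap2_def kap_def)
  have ex: "kappa \<in> ring_hom (subring_of_complex Z_zeta5) (residue_ring 5) \<and> kappa zeta5 = 1"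
    unfolding kappa_def by (rule someI[of _ k0]) (use hom one in auto)
  have "ring (residue_ring 5)" using cring by (simp add: cring_def)
  then have "kappa (emb a b) = k0 (emb a b)"
    using ex one by (intro ring_hom_agree_on_Z_zeta5[OF _ hom _ subset_refl _ emb_in_Z_zeta5]) simp_all
  then show ?thesis by (simp add: k0)
qed

subsection \<open>Index of a principal ideal\<close>

lemma gold_numeral_sel [simp]: "gre (numeral k) = numeral k" "gim (numeral k) = 0"
  using gold_of_int_sel[of "numeral k"] unfolding of_int_numeral by auto

lemma gold_int_dvd_iff: "of_int k dvd x \<longleftrightarrow> k dvd gre x \<and> k dvd gim x"
proof
  assume "of_int k dvd x"
  then obtain y where "x = of_int k * y" by (rule dvdE)
  then show "k dvd gre x \<and> k dvd gim x" by simp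
next
  assume "k dvd gre x \<and> k dvd gim x"
  then obtain a b where "gre x = k * a" "gim x = k * b" by (auto elim!: dvdE)
  then have "x = of_int k * Gold a b" by (simp add: gold_eq_iff)
  then show "of_int k dvd x" by (rule dvdI)
qed

text \<open>A Hermite normal form. With \<open>c\<close> the content of \<open>g\<close> and
  \<open>M\<close> the absolute norm of its primitive part \<open>h\<close>, the multiples of
  \<open>g\<close> contain \<open>c * (e + tau)\<close> and the integer \<open>c * M\<close>.
  Reducing first the tau-coefficient modulo \<open>c\<close> and then the other one modulo
  \<open>c * M\<close> leaves a box of \<open>c * M * c\<close> residues, the absolute norm of
  \<open>g\<close>.\<close>

lemma ex_residue_system:
  assumes "g \<noteq> 0"
  obtains T where "finite T" "card T = nat \<bar>gnorm g\<bar>" "\<And>x. \<exists>t\<in>T. g dvd x - t"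
    "\<And>s t. s \<in> T \<Longrightarrow> t \<in> T \<Longrightarrow> g dvd s - t \<Longrightarrow> s = t"
proof -
  define c where "c = gcd (gre g) (gim g)"
  have c: "c > 0" using assms by (auto simp: c_def gold_eq_iff)
  define m n where "m = gre g div c" and "n = gim g div c"
  have mn: "gre g = c * m" "gim g = c * n" by (simp_all add: m_def n_def c_def)
  define h where "h = Gold m n"
  have gh: "g = of_int c * h" by (simp add: gold_eq_iff h_def mn)
  have "c * gcd m n = c * 1"
    using gcd_mult_distrib_int[of c m n] c by (simp add: mn[symmetric] c_def[symmetric])
  then have cop: "gcd m n = 1" using c by simp
  define M where "M = \<bar>gnorm h\<bar>"
  have "h \<noteq> 0" using assms gh by auto
  then have M: "M > 0" by (simp add: M_def)
  have norm_g: "\<bar>gnorm g\<bar> = (c * M) * c"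
    unfolding gh by (simp add: M_def abs_mult gnorm_def[of "of_int c"] power2_eq_square)
  have "gcd n (m + n) = 1" using cop by (simp add: add.commute[of m n] gcd.commute[of n m])
  \<comment> \<open>The left side is the tau-coefficient of \<open>h * Gold p q\<close>, so this
    multiple of \<open>h\<close> has the form \<open>e + tau\<close>.\<close>
  then obtain p q where pq: "p * n + q * (m + n) = 1"
    using bezout_int[of n "m + n"] by metis
  define e where "e = gre (h * Gold p q)"
  have hpq: "g * Gold p q = Gold (c * e) c"
  proof -
    have "gim (h * Gold p q) = 1" using pq by (simp add: h_def algebra_simps)
    then have "h * Gold p q = Gold e 1" by (simp add: gold_eq_iff e_def)
    then have "g * Gold p q = of_int c * Gold e 1" unfolding gh by (simp add: mult.assoc)
    then show ?thesis by (simp add: gold_eq_iff)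
  qed
  have "gnorm h dvd M" by (simp add: M_def)
  then obtain l where l: "M = gnorm h * l" by (rule dvdE)
  have gM: "g dvd of_int (c * M)"
  proof -
    have "of_int (c * M) = of_int c * of_int (gnorm h) * of_int l"
      by (simp add: l mult.assoc)
    also have "\<dots> = g * (gconj h * of_int l)"
      unfolding gh mult_gconj[symmetric] by (simp add: mult_ac)
    finally show ?thesis by (rule dvdI)
  qed
  define T where "T = (\<lambda>(i, j). Gold i j) ` ({0..<c * M} \<times> {0..<c})"
  have inj: "inj_on (\<lambda>(i, j). Gold i j) ({0..<c * M} \<times> {0..<c})"
    by (auto simp: inj_on_def)
  have "card T = nat \<bar>gnorm g\<bar>"
    unfolding T_def card_image[OF inj] norm_g using c M by (simp add: nat_mult_distrib)
  moreover have "finite T" by (simp add: T_def)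
  moreover have "\<exists>t\<in>T. g dvd x - t" for x
  proof -
    define j where "j = gim x mod c"
    define y where "y = x - of_int (gim x div c) * (g * Gold p q)"
    have y: "gim y = j" unfolding y_def hpq j_def by (simp add: minus_div_mult_eq_mod)
    define i where "i = gre y mod (c * M)"
    define z where "z = y - of_int (gre y div (c * M)) * of_int (c * M)"
    have "z = Gold i j"
      unfolding gold_eq_iff z_def gold_sel gold_of_int_sel y i_def by (simp add: minus_div_mult_eq_mod)
    moreover have "g dvd x - z"
    proof -
      have "x - z = of_int (gim x div c) * (g * Gold p q) + of_int (gre y div (c * M)) * of_int (c * M)"
        by (simp add: z_def y_def)
      then show ?thesis using gM by (simp add: dvd_mult dvd_mult2 del: of_int_mult)
    qed
    moreover have "Gold i j \<in> T"
      using c M by (auto simp: T_def i_def j_def intro!: image_eqI[of _ _ "(i, j)"])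
    ultimately show ?thesis by blast
  qed
  moreover have "s = t" if s: "s \<in> T" and t: "t \<in> T" and dvd: "g dvd s - t" for s t
  proof -
    obtain i j where ij: "s = Gold i j" "0 \<le> i" "i < c * M" "0 \<le> j" "j < c" using s by (auto simp: T_def)
    obtain i' j' where ij': "t = Gold i' j'" "0 \<le> i'" "i' < c * M" "0 \<le> j'" "j' < c" using t by (auto simp: T_def)
    have "of_int c dvd s - t" using dvd gh by (metis dvd_mult_left)
    then have cd: "c dvd i - i'" "c dvd j - j'" by (simp_all add: gold_int_dvd_iff ij ij')
    have jj: "j = j'"
    proof (rule ccontr)
      assume "j \<noteq> j'"
      then have "c \<le> \<bar>j - j'\<bar>" using zdvd_imp_le[of c "\<bar>j - j'\<bar>"] cd(2) by auto
      then show False using ij ij' by linarith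
    qed
    obtain k where k: "i - i' = c * k" using cd(1) by (rule dvdE)
    have st: "s - t = of_int c * of_int k"
      using jj k by (simp add: gold_eq_iff ij ij')
    then have "h dvd of_int k" using dvd c gh by (simp add: dvd_times_left_cancel_iff)
    then obtain y where y: "of_int k = h * y" by (rule dvdE)
    have "of_int k * gconj h = of_int (gnorm h) * y"
      unfolding y mult_gconj[symmetric] by (simp add: mult_ac)
    then have "of_int (gnorm h) dvd of_int k * gconj h" by simp
    then have "gnorm h dvd k * (m + n)" "gnorm h dvd k * n"
      by (simp_all add: gold_int_dvd_iff gconj_def h_def)
    \<comment> \<open>Up to sign, \<open>m + n\<close> and \<open>n\<close> are the coefficients of
      \<open>gconj h\<close>; they are coprime, so the gcd is k up to sign.\<close>
    then have "gnorm h dvd gcd (k * (m + n)) (k * n)" by simp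
    also have "gcd (k * (m + n)) (k * n) = \<bar>k\<bar>"
      using cop by (simp add: gcd_mult_distrib_int[symmetric])
    finally have "M dvd k" by (simp add: M_def)
    then have "c * M dvd i - i'" unfolding k by simp
    have "i = i'"
    proof (rule ccontr)
      assume "i \<noteq> i'"
      then have "c * M \<le> \<bar>i - i'\<bar>" using zdvd_imp_le[of "c * M" "\<bar>i - i'\<bar>"] \<open>c * M dvd i - i'\<close> by auto
      then show False using ij ij' by linarith
    qed
    then show ?thesis using jj ij ij' by simp
  qed
  ultimately show ?thesis using that by blast
qed

subsection \<open>The Dedekind zeta function\<close>

definition cg :: "gold \<Rightarrow> complex" where
  "cg a = of_real (rv a)"

lemma cg_simps [simp]:
  "cg 0 = 0" "cg 1 = 1" "cg (a + b) = cg a + cg b" "cg (a - b) = cg a - cg b" "cg (- a) = - cg a"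
  "cg (a * b) = cg a * cg b" "cg (of_int k) = of_int k" "cg (a ^ j) = cg a ^ j"
  "cg a = cg b \<longleftrightarrow> a = b" "cg a = 0 \<longleftrightarrow> a = 0"
  by (simp_all add: cg_def)

lemma cg_numeral [simp]: "cg (numeral k) = numeral k"
  using cg_simps(7)[of "numeral k"] unfolding of_int_numeral .

lemma cg_sum: "cg (sum f A) = (\<Sum>x\<in>A. cg (f x))"
  by (induction A rule: infinite_finite_induct) auto

lemma real_subfieldE:
  assumes "x \<in> real_subfield" obtains a n where "n \<noteq> 0" "x = cg a / of_int n"
proof -
  from assms have "x \<in> Q_zeta5" "Im x = 0" by (auto simp: real_subfield_def complex_is_Real_iff)
  then obtain a b n where x: "n \<noteq> 0" "x = emb a b / of_int n" by (elim Q_zeta5_cases)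
  then have "x = of_real (1 / of_int n) * emb a b" by simp
  then have "Im x = 1 / of_int n * (rv b * Im zeta5)" by (simp only:) (simp add: emb_def)
  then have "b = 0" using \<open>Im x = 0\<close> x Im_zeta5_pos by simp
  then show ?thesis using that[of n a] x by (simp add: emb_def cg_def)
qed

lemma cg_in_real_subfield: "cg a \<in> real_subfield"
proof -
  have "cg a = emb a 0 / of_int 1" by (simp add: cg_def emb_def)
  then have "cg a \<in> Q_zeta5" using emb_quot_in_Q_zeta5[of 1 a 0] by simp
  then show ?thesis by (simp add: real_subfield_def cg_def)
qed

lemma algebraic_int_cg: "algebraic_int (cg a)"
proof (rule algebraic_int.intros)
  let ?p = "[:of_int (gnorm a), - of_int (2 * gre a + gim a), 1 :: complex:]"
  show "Polynomial.lead_coeff ?p = 1" by simp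
  show "\<forall>i. Polynomial.coeff ?p i \<in> \<int>" by (auto simp: coeff_pCons split: nat.split)
  have "a * a - of_int (2 * gre a + gim a) * a + of_int (gnorm a) = 0"
    by (simp add: gold_eq_iff gnorm_def power2_eq_square algebra_simps)
  then have "cg (a * a - of_int (2 * gre a + gim a) * a + of_int (gnorm a)) = cg 0" by (simp only:)
  then show "poly ?p (cg a) = 0"
    by (simp add: algebra_simps)
qed

text \<open>The rational root argument over the golden ring: clearing denominators in a monic
  equation makes \<open>s\<close> divide a power of \<open>r\<close>, to which it is
  coprime.\<close>

lemma algebraic_int_quotient:
  assumes "algebraic_int (cg r / cg s)" "coprime r s" "s \<noteq> 0"
  shows "s dvd 1"
proof -
  from assms(1) obtain p where p: "Polynomial.lead_coeff p = 1" "\<forall>i. Polynomial.coeff p i \<in> \<int>" "poly p (cg r / cg s) = 0"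
    by (auto simp: algebraic_int.simps)
  have "\<forall>i. \<exists>c. Polynomial.coeff p i = of_int c"
    using p(2) by (meson Ints_cases)
  then obtain c where c: "\<And>i. Polynomial.coeff p i = of_int (c i)" by (auto dest: choice)
  define k where "k = Polynomial.degree p"
  have ck: "c k = 1" using p(1) c[of k] by (simp add: k_def)
  have "0 = poly p (cg r / cg s) * cg s ^ k" using p(3) by simp
  also have "\<dots> = (\<Sum>i\<le>k. cg (of_int (c i) * r ^ i * s ^ (k - i)))"
    unfolding poly_altdef k_def[symmetric] sum_distrib_right
  proof (intro sum.cong refl)
    fix i assume "i \<in> {..k}"
    then have "cg s ^ k = cg s ^ i * cg s ^ (k - i)" by (simp add: power_add[symmetric])
    then show "Polynomial.coeff p i * (cg r / cg s) ^ i * cg s ^ k = cg (of_int (c i) * r ^ i * s ^ (k - i))"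
      using assms(3) by (simp add: c power_divide)
  qed
  also have "\<dots> = cg (\<Sum>i\<le>k. of_int (c i) * r ^ i * s ^ (k - i))"
    by (simp only: cg_sum)
  finally have "(\<Sum>i\<le>k. of_int (c i) * r ^ i * s ^ (k - i)) = 0"
    using cg_simps(10) by metis
  moreover have "{..k} = insert k {..<k}" by auto
  ultimately have "r ^ k = - (\<Sum>i<k. of_int (c i) * r ^ i * s ^ (k - i))"
    by (simp add: ck eq_neg_iff_add_eq_0)
  moreover have "s dvd (\<Sum>i<k. of_int (c i) * r ^ i * s ^ (k - i))"
    by (intro dvd_sum dvd_mult) (simp add: dvd_power)
  ultimately have "s dvd r ^ k" by simp
  moreover have "coprime (r ^ k) s" using assms(2) by simp
  ultimately show "s dvd 1"
    by (metis coprime_common_divisor dvd_refl)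
qed

text \<open>An element of the field is a fraction over the golden ring; in lowest terms its
  denominator must be a unit if it is integral.\<close>

lemma integers_eq: "{x \<in> real_subfield. algebraic_int x} = range cg"
proof (intro equalityI subsetI)
  fix x assume "x \<in> {x \<in> real_subfield. algebraic_int x}"
  then have x: "x \<in> real_subfield" "algebraic_int x" by auto
  obtain a n where an: "n \<noteq> 0" "x = cg a / of_int n" using real_subfieldE[OF x(1)] .
  have "gcd a (of_int n) \<noteq> 0" using an by simp
  then obtain r s where rs: "a = r * gcd a (of_int n)" "of_int n = s * gcd a (of_int n)" "coprime r s"
    using gcd_coprime_exists by metis
  have s0: "s \<noteq> 0" using rs an by auto
  have "cg a / cg (of_int n) = cg r / cg s"
    using \<open>gcd a (of_int n) \<noteq> 0\<close> s0 rs(1,2)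
    by (metis cg_simps(6,10) mult_divide_mult_cancel_right)
  then have eq: "x = cg r / cg s" using an by simp
  then have "s dvd 1" using algebraic_int_quotient x(2) rs(3) s0 by metis
  then obtain t where "1 = s * t" by (rule dvdE)
  then have "cg s * cg t = 1" by (metis cg_simps(2,6))
  then have "x = cg (r * t)" unfolding eq using s0 by (simp add: field_simps)
  then show "x \<in> range cg" by blast
qed (auto intro: cg_in_real_subfield algebraic_int_cg)

abbreviation OK :: "complex ring" where "OK \<equiv> ring_of_integers real_subfield"

lemma OK_eq: "OK = subring_of_complex (range cg)"
  by (simp add: ring_of_integers_def integers_eq)

lemma OK_simps [simp]:
  "carrier OK = range cg" "x \<otimes>\<^bsub>OK\<^esub> y = x * y" "x \<oplus>\<^bsub>OK\<^esub> y = x + y" "\<one>\<^bsub>OK\<^esub> = 1" "\<zero>\<^bsub>OK\<^esub> = 0"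
  by (simp_all add: OK_eq)

lemma ring_OK: "ring OK"
  unfolding OK_eq
proof (rule ring_subring_of_complex)
  show "1 \<in> range cg" by (metis cg_simps(2) rangeI)
  fix x y assume x: "x \<in> range cg"
  then obtain a where a: "x = cg a" by blast
  show "- x \<in> range cg" unfolding a cg_simps(5)[symmetric] by (rule rangeI)
  assume "y \<in> range cg"
  then obtain b where b: "y = cg b" by blast
  show "x + y \<in> range cg" unfolding a b cg_simps(3)[symmetric] by (rule rangeI)
  show "x * y \<in> range cg" unfolding a b cg_simps(6)[symmetric] by (rule rangeI)
qed

lemma OK_a_inv: "\<ominus>\<^bsub>OK\<^esub> cg a = - cg a"
proof -
  interpret ring OK by (rule ring_OK)
  have "- cg a \<in> carrier OK" by (metis OK_simps(1) cg_simps(5) rangeI)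
  then show ?thesis using minus_equality[of "- cg a" "cg a"] by simp
qed

definition pideal :: "gold \<Rightarrow> complex set" where
  "pideal g = cg ` {x. g dvd x}"

lemma cg_in_pideal_iff [simp]: "cg x \<in> pideal g \<longleftrightarrow> g dvd x"
  by (auto simp: pideal_def)

lemma ideal_pideal: "ideal (pideal g) OK"
proof (rule idealI[OF ring_OK])
  interpret ring OK by (rule ring_OK)
  show "subgroup (pideal g) (add_monoid OK)"
  proof (rule add.subgroupI)
    show "pideal g \<subseteq> carrier OK" by (auto simp: pideal_def)
    have "cg 0 \<in> pideal g" unfolding cg_in_pideal_iff by simp
    then show "pideal g \<noteq> {}" by blast
  next
    fix a assume "a \<in> pideal g"
    then obtain x where "a = cg x" "g dvd x" by (auto simp: pideal_def)
    then show "\<ominus>\<^bsub>OK\<^esub> a \<in> pideal g"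
      using cg_in_pideal_iff[of "- x" g] by (simp add: OK_a_inv del: cg_in_pideal_iff)
  next
    fix a b assume "a \<in> pideal g" "b \<in> pideal g"
    then obtain x y where "a = cg x" "g dvd x" "b = cg y" "g dvd y" by (auto simp: pideal_def)
    then show "a \<oplus>\<^bsub>OK\<^esub> b \<in> pideal g"
      using cg_in_pideal_iff[of "x + y" g] by (simp del: cg_in_pideal_iff)
  qed
next
  fix a x assume "a \<in> pideal g" "x \<in> carrier OK"
  then obtain b y where "a = cg b" "g dvd b" "x = cg y" by (auto simp: pideal_def)
  then show "x \<otimes>\<^bsub>OK\<^esub> a \<in> pideal g" "a \<otimes>\<^bsub>OK\<^esub> x \<in> pideal g"
    using cg_in_pideal_iff[of "y * b" g] cg_in_pideal_iff[of "b * y" g] by (simp_all del: cg_in_pideal_iff)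
qed

lemma ideal_is_pideal:
  assumes "ideal I OK" "I \<noteq> {0}"
  obtains g where "g \<noteq> 0" "I = pideal g"
proof -
  interpret ideal I OK by fact
  have sub: "I \<subseteq> range cg" using a_subset by simp
  have "0 \<in> I" using additive_subgroup.zero_closed[OF is_additive_subgroup] by simp
  define J where "J = {x. cg x \<in> I}"
  have IJ: "I = cg ` J" using sub by (auto simp: J_def)
  have J: "x \<in> J \<Longrightarrow> y \<in> J \<Longrightarrow> x + y \<in> J" "x \<in> J \<Longrightarrow> z * x \<in> J" for x y z
    using additive_subgroup.a_closed[OF is_additive_subgroup, of "cg x" "cg y"] I_l_closed[of "cg x" "cg z"] by (simp_all add: J_def)
  have "\<exists>x. x \<in> J \<and> x \<noteq> 0" using assms(2) \<open>0 \<in> I\<close> IJ by force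
  \<comment> \<open>A nonzero element of least norm generates the ideal, because remainders modulo
    it remain in \<open>J\<close> and are smaller.\<close>
  define g where "g = arg_min euclidean_size (\<lambda>x. x \<in> J \<and> x \<noteq> 0)"
  have g: "g \<in> J" "g \<noteq> 0" and min: "\<And>x. x \<in> J \<Longrightarrow> x \<noteq> 0 \<Longrightarrow> euclidean_size g \<le> euclidean_size x"
    using arg_min_nat_lemma[of "\<lambda>x. x \<in> J \<and> x \<noteq> 0" _ euclidean_size] \<open>\<exists>x. x \<in> J \<and> x \<noteq> 0\<close>
    unfolding g_def by blast+
  have "x \<in> J \<longleftrightarrow> g dvd x" for x
  proof
    assume "g dvd x" then show "x \<in> J" using J(2)[OF g(1)] by (metis dvdE mult.commute)
  next
    assume x: "x \<in> J"
    have "x mod g = x + (- (x div g)) * g" by (simp add: minus_div_mult_eq_mod[symmetric])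
    then have "x mod g \<in> J" using J(1)[OF x J(2)[OF g(1)]] by metis
    then have "x mod g = 0" using min[of "x mod g"] mod_size_less[OF g(2), of x] by fastforce
    then show "g dvd x" by auto
  qed
  then have "J = {x. g dvd x}" by blast
  then have "I = pideal g" unfolding IJ pideal_def by simp
  then show ?thesis using that g by blast
qed

lemma pideal_normalize: "pideal (normalize g) = pideal g"
  by (simp add: pideal_def)

lemma coset_pideal_eq_iff:
  "pideal g +>\<^bsub>OK\<^esub> cg x = pideal g +>\<^bsub>OK\<^esub> cg y \<longleftrightarrow> g dvd x - y"
proof -
  have mem: "z \<in> pideal g +>\<^bsub>OK\<^esub> cg w \<longleftrightarrow> (\<exists>v. z = cg v \<and> g dvd v - w)" for z w
  proof
    assume "z \<in> pideal g +>\<^bsub>OK\<^esub> cg w"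
    then obtain u where "g dvd u" "z = cg u + cg w" by (auto simp: a_r_coset_def' pideal_def)
    then show "\<exists>v. z = cg v \<and> g dvd v - w" by (intro exI[of _ "u + w"]) simp
  next
    assume "\<exists>v. z = cg v \<and> g dvd v - w"
    then obtain v where "z = cg v" "g dvd v - w" by blast
    then show "z \<in> pideal g +>\<^bsub>OK\<^esub> cg w"
      by (auto simp: a_r_coset_def' pideal_def intro!: exI[of _ "v - w"])
  qed
  show ?thesis
  proof
    assume "pideal g +>\<^bsub>OK\<^esub> cg x = pideal g +>\<^bsub>OK\<^esub> cg y"
    moreover have "cg x \<in> pideal g +>\<^bsub>OK\<^esub> cg x" unfolding mem by auto
    ultimately have "cg x \<in> pideal g +>\<^bsub>OK\<^esub> cg y" by simp
    then show "g dvd x - y" unfolding mem by auto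
  next
    assume d: "g dvd x - y"
    have "g dvd v - x \<longleftrightarrow> g dvd v - y" for v
    proof -
      have "v - y = (v - x) + (x - y)" by simp
      then show ?thesis using d by (metis dvd_add_left_iff)
    qed
    then show "pideal g +>\<^bsub>OK\<^esub> cg x = pideal g +>\<^bsub>OK\<^esub> cg y"
      unfolding set_eq_iff mem by blast
  qed
qed

lemma ideal_norm_pideal:
  assumes "g \<noteq> 0" shows "ideal_norm real_subfield (pideal g) = nat \<bar>gnorm g\<bar>"
proof -
  obtain T where T: "finite T" "card T = nat \<bar>gnorm g\<bar>" "\<And>x. \<exists>t\<in>T. g dvd x - t"
    "\<And>s t. s \<in> T \<Longrightarrow> t \<in> T \<Longrightarrow> g dvd s - t \<Longrightarrow> s = t"
    by (rule ex_residue_system[OF assms]) blast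
  have "carrier (OK Quot pideal g) = (\<lambda>x. pideal g +>\<^bsub>OK\<^esub> cg x) ` UNIV"
    by (auto simp: FactRing_def A_RCOSETS_def')
  also have "\<dots> = (\<lambda>x. pideal g +>\<^bsub>OK\<^esub> cg x) ` T"
  proof (intro equalityI subsetI)
    fix y assume "y \<in> range (\<lambda>x. pideal g +>\<^bsub>OK\<^esub> cg x)"
    then obtain x where y: "y = pideal g +>\<^bsub>OK\<^esub> cg x" by blast
    obtain t where "t \<in> T" "g dvd x - t" using T(3) by blast
    then show "y \<in> (\<lambda>x. pideal g +>\<^bsub>OK\<^esub> cg x) ` T"
      unfolding y using coset_pideal_eq_iff by blast
  qed auto
  finally have "ideal_norm real_subfield (pideal g) = card ((\<lambda>x. pideal g +>\<^bsub>OK\<^esub> cg x) ` T)"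
    by (simp add: ideal_norm_def)
  also have "\<dots> = card T"
    by (intro card_image inj_onI T(4)) (simp_all add: coset_pideal_eq_iff)
  finally show ?thesis using T(2) by simp
qed

lemma bij_betw_pideal: "bij_betw pideal reps {I. ideal I OK \<and> I \<noteq> {0}}"
proof (rule bij_betw_imageI)
  have dvd: "g dvd x \<longleftrightarrow> cg x \<in> pideal g" for g x by simp
  show "inj_on pideal reps"
  proof (rule inj_onI)
    fix g h assume gh: "g \<in> reps" "h \<in> reps" "pideal g = pideal h"
    then have "g dvd x \<longleftrightarrow> h dvd x" for x unfolding dvd by simp
    from this[of g] this[of h] have "h dvd g \<and> g dvd h" by simp
    then have "g dvd h" "h dvd g" by blast+
    then have "normalize g = normalize h"
      by (rule normalization_semidom_class.associatedI)
    then show "g = h" using gh by (simp add: reps_def)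
  qed
  show "pideal ` reps = {I. ideal I OK \<and> I \<noteq> {0}}"
  proof (intro equalityI subsetI)
    fix I assume "I \<in> pideal ` reps"
    then obtain g where g: "I = pideal g" "g \<noteq> 0" by (auto simp: reps_def)
    have "cg g \<in> pideal g" "cg g \<noteq> 0" using g by simp_all
    then have "pideal g \<noteq> {0}" by blast
    then show "I \<in> {I. ideal I OK \<and> I \<noteq> {0}}" using ideal_pideal g(1) by blast
  next
    fix I assume "I \<in> {I. ideal I OK \<and> I \<noteq> {0}}"
    then have "ideal I OK" "I \<noteq> {0}" by simp_all
    then obtain g where g: "g \<noteq> 0" "I = pideal g" by (rule ideal_is_pideal)
    have "I = pideal (normalize g)" by (simp only: g pideal_normalize)
    moreover have "normalize g \<in> reps" using g(1) by (simp add: reps_def)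
    ultimately show "I \<in> pideal ` reps" by (rule image_eqI)
  qed
qed

lemma dedekind_zeta_real_subfield: "dedekind_zeta real_subfield 2 = zeta_gold"
proof -
  have "dedekind_zeta real_subfield 2
      = (\<Sum>\<^sub>\<infinity>g\<in>reps. 1 / real (ideal_norm real_subfield (pideal g)) powr 2)"
    unfolding dedekind_zeta_def
    by (rule infsum_reindex_bij_betw[OF bij_betw_pideal, symmetric])
  also have "\<dots> = zeta_gold"
    unfolding zeta_gold_def
  proof (rule infsum_cong)
    fix g assume "g \<in> reps"
    then have "g \<noteq> 0" by (simp add: reps_def)
    then show "1 / real (ideal_norm real_subfield (pideal g)) powr 2 = wt g"
      by (simp add: ideal_norm_pideal wt_def powr_numeral)
  qed
  finally show ?thesis .
qed

section \<open>Counting lattice points\<close>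

abbreviation vol :: "complex set \<Rightarrow> real" where "vol \<equiv> measure lebesgue"

subsection \<open>A fundamental domain\<close>

text \<open>The imaginary part is taken as first coordinate so that slices are horizontal lines, on
  which the shear of a parallelogram is a mere translation.\<close>

lemma lborel_complex_eq: "(lborel :: complex measure) = distr (lborel \<Otimes>\<^sub>M lborel) borel (\<lambda>(b, a). Complex a b)"
proof (rule lborel_eqI)
  have cm [measurable]: "(\<lambda>(b, a). Complex a b) \<in> borel_measurable (lborel \<Otimes>\<^sub>M lborel)"
    unfolding lborel_prod case_prod_unfold by (intro borel_measurable_complex_iff[THEN iffD2])
      (simp_all add: borel_measurable_continuous_onI continuous_on_fst continuous_on_snd)
  fix l u :: complex
  assume le: "\<And>b. b \<in> Basis \<Longrightarrow> l \<bullet> b \<le> u \<bullet> b"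
  have "(\<lambda>(b, a). Complex a b) -` box l u = {Im l<..<Im u} \<times> {Re l<..<Re u}"
    by (auto simp: in_box_complex_iff)
  then have "emeasure (distr (lborel \<Otimes>\<^sub>M lborel) borel (\<lambda>(b, a). Complex a b)) (box l u)
      = emeasure (lborel \<Otimes>\<^sub>M lborel) ({Im l<..<Im u} \<times> {Re l<..<Re u})"
    by (subst emeasure_distr) (auto simp: space_pair_measure)
  also have "\<dots> = ennreal (Im u - Im l) * ennreal (Re u - Re l)"
    using le[of 1] le[of \<i>] by (subst lborel.emeasure_pair_measure_Times) (auto simp: Basis_complex_def)
  also have "\<dots> = ennreal (\<Prod>b\<in>Basis. (u - l) \<bullet> b)"
    using le[of 1] le[of \<i>] by (simp add: Basis_complex_def ennreal_mult mult.commute)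
  finally show "emeasure (distr (lborel \<Otimes>\<^sub>M lborel) borel (\<lambda>(b, a). Complex a b)) (box l u) = ennreal (\<Prod>b\<in>Basis. (u - l) \<bullet> b)" .
qed simp

text \<open>Cavalieri's principle: every nonempty slice is a translate of one set of length
  \<open>q\<close>, the translation being proportional to the height.\<close>

lemma emeasure_parallelogram:
  assumes meas: "{z :: complex. P (Im z) \<and> Q (Re z - Im z * c)} \<in> sets borel"
    and P: "emeasure lborel {b. P b} = ennreal p" "{b. P b} \<in> sets borel"
    and Q: "\<And>t. emeasure lborel {a. Q (a - t)} = ennreal q" and "0 \<le> p" "0 \<le> q"
  shows "emeasure lborel {z :: complex. P (Im z) \<and> Q (Re z - Im z * c)} = ennreal (p * q)"
proof -
  let ?S = "{z :: complex. P (Im z) \<and> Q (Re z - Im z * c)}"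
  have cm [measurable]: "(\<lambda>(b, a). Complex a b) \<in> borel_measurable (lborel \<Otimes>\<^sub>M lborel)"
    unfolding lborel_prod case_prod_unfold by (intro borel_measurable_complex_iff[THEN iffD2])
      (simp_all add: borel_measurable_continuous_onI continuous_on_fst continuous_on_snd)
  have S2: "(\<lambda>(b, a). Complex a b) -` ?S \<inter> space (lborel \<Otimes>\<^sub>M lborel) \<in> sets (lborel \<Otimes>\<^sub>M lborel)"
    by (rule measurable_sets[OF cm meas])
  have "emeasure lborel ?S = emeasure (distr (lborel \<Otimes>\<^sub>M lborel) borel (\<lambda>(b, a). Complex a b)) ?S"
    by (subst lborel_complex_eq) simp
  also have "\<dots> = emeasure (lborel \<Otimes>\<^sub>M lborel) ((\<lambda>(b, a). Complex a b) -` ?S \<inter> space (lborel \<Otimes>\<^sub>M lborel))"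
    using meas by (intro emeasure_distr) auto
  also have "\<dots> = (\<integral>\<^sup>+b. emeasure lborel (Pair b -` ((\<lambda>(b, a). Complex a b) -` ?S \<inter> space (lborel \<Otimes>\<^sub>M lborel))) \<partial>lborel)"
    by (rule lborel.emeasure_pair_measure_alt[OF S2])
  also have "\<dots> = (\<integral>\<^sup>+b. ennreal q * indicator {b. P b} b \<partial>lborel)"
  proof (rule nn_integral_cong)
    fix b :: real
    have "Pair b -` ((\<lambda>(b, a). Complex a b) -` ?S \<inter> space (lborel \<Otimes>\<^sub>M lborel)) = (if P b then {a. Q (a - b * c)} else {})"
      by (auto simp: space_pair_measure)
    then show "emeasure lborel (Pair b -` ((\<lambda>(b, a). Complex a b) -` ?S \<inter> space (lborel \<Otimes>\<^sub>M lborel))) = ennreal q * indicator {b. P b} b"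
      using Q[of "b * c"] by simp
  qed
  also have "\<dots> = ennreal q * ennreal p"
    using P by (subst nn_integral_cmult_indicator) auto
  finally show ?thesis using assms by (simp add: ennreal_mult mult.commute)
qed

section \<open>Coordinates in the two planes and the fundamental domain\<close>

definition s1 :: real where "s1 = Im zeta5"
definition s2 :: real where "s2 = Im (zeta5\<^sup>2)"

lemma s12: "0 < s1" "0 < s2" "s1 * s2 = (2 * golden - 1) / 4"
proof -
  show "0 < s1" using Im_zeta5_pos by (simp add: s1_def)
  then show "0 < s2" using golden_gt by (simp add: s2_def s1_def Im_zeta5_square')
  have "s1 * s2 = (golden - 1) * (Im zeta5)\<^sup>2"
    unfolding s1_def s2_def Im_zeta5_square' by (simp add: power2_eq_square)
  also have "\<dots> = (golden * golden + golden - 2) / 4"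
    unfolding Im_zeta5_square by (simp add: field_simps)
  finally show "s1 * s2 = (2 * golden - 1) / 4" unfolding golden_square by simp
qed

text \<open>These extend the coefficients of lattice points to all complex numbers:
  \<open>ac\<close>, \<open>bc\<close> belong to the real basis 1, \<open>zeta5\<close>, the primed
  ones to 1 and the square of \<open>zeta5\<close>.\<close>

definition bc :: "complex \<Rightarrow> real" where "bc x = Im x / s1"
definition ac :: "complex \<Rightarrow> real" where "ac x = Re x - bc x * Re zeta5"
definition bc' :: "complex \<Rightarrow> real" where "bc' x = Im x / s2"
definition ac' :: "complex \<Rightarrow> real" where "ac' x = Re x - bc' x * Re (zeta5\<^sup>2)"

lemma coords: "x = of_real (ac x) + of_real (bc x) * zeta5" "y = of_real (ac' y) + of_real (bc' y) * zeta5\<^sup>2"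
proof -
  have "s1 \<noteq> 0" "s2 \<noteq> 0" using s12 by simp_all
  then show "x = of_real (ac x) + of_real (bc x) * zeta5"
    by (simp add: complex_eq_iff ac_def bc_def s1_def)
  show "y = of_real (ac' y) + of_real (bc' y) * zeta5\<^sup>2"
    using \<open>s2 \<noteq> 0\<close> unfolding complex_eq_iff plus_complex.sel Re_complex_of_real Im_complex_of_real
    by (simp add: ac'_def bc'_def s2_def del: Re_power_real Im_power_real)
qed

lemma coords_diff_emb:
  "bc (x - emb a b) = bc x - rv b" "ac (x - emb a b) = ac x - rv a"
  "bc' (x - emb' a b) = bc' x - rv' b" "ac' (x - emb' a b) = ac' x - rv' a"
proof -
  have nz: "s1 \<noteq> 0" "s2 \<noteq> 0" using s12 by simp_all
  show b: "bc (x - emb a b) = bc x - rv b"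
    using nz by (simp add: bc_def emb_def diff_divide_distrib s1_def)
  show "ac (x - emb a b) = ac x - rv a"
    unfolding ac_def b by (simp add: emb_def algebra_simps)
  have re_im: "Re (emb' a b) = rv' a + rv' b * Re (zeta5\<^sup>2)" "Im (emb' a b) = rv' b * s2"
    by (simp_all add: emb'_def s2_def)
  show b': "bc' (x - emb' a b) = bc' x - rv' b"
    using nz by (simp add: bc'_def re_im diff_divide_distrib)
  show "ac' (x - emb' a b) = ac' x - rv' a"
    unfolding ac'_def b' minus_complex.sel re_im by (simp add: algebra_simps)
qed

abbreviation root5 :: real where "root5 \<equiv> 2 * golden - 1"

lemma root5_pos: "0 < root5" and root5_less: "root5 < 3"
  using golden_bounds by simp_all

text \<open>A fundamental domain for \<open>ker \<kappa>\<close>, of index 5 in \<open>\<int>[\<zeta>]\<close>, which is why \<open>ac x\<close> ranges over an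
  interval of length 5. In the coordinates \<open>bc x\<close>, \<open>bc x - bc' y\<close>, \<open>ac x\<close>, \<open>ac x - ac' y\<close> the lattice is triangular.\<close>

definition tile :: "(complex \<times> complex) set" where
  "tile = {(x, y). 0 \<le> bc x \<and> bc x < 1 \<and> 0 \<le> ac x \<and> ac x < 5 \<and>
     bc x - root5 < bc' y \<and> bc' y \<le> bc x \<and> ac x - root5 < ac' y \<and> ac' y \<le> ac x}"

text \<open>The estimates give 6 and 8; the common bound 11 is the radius of all neighbourhoods in
  the counting below.\<close>

lemma tile_bounded:
  assumes "(x, y) \<in> tile" shows "norm x < 11" "norm y < 11"
proof -
  have nz: "norm zeta5 = 1" by (simp add: zeta5_cis)
  have t: "\<bar>ac x\<bar> < 5" "\<bar>bc x\<bar> \<le> 1" "\<bar>ac' y\<bar> < 5" "\<bar>bc' y\<bar> \<le> 3"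
    using assms root5_less by (auto simp: tile_def)
  have "norm x \<le> \<bar>ac x\<bar> + \<bar>bc x\<bar>"
    by (subst coords(1)) (rule norm_triangle_le, simp add: norm_mult nz)
  then show "norm x < 11" using t by linarith
  have "norm y \<le> \<bar>ac' y\<bar> + \<bar>bc' y\<bar>"
    by (subst coords(2)) (rule norm_triangle_le, simp add: norm_mult norm_power nz)
  then show "norm y < 11" using t by linarith
qed

lemma int_floor_unique:
  assumes "0 < (d :: real)"
  shows "(x - d < of_int n * d \<and> of_int n * d \<le> x) \<longleftrightarrow> n = \<lfloor>x / d\<rfloor>"
proof -
  have "x - d < of_int n * d \<longleftrightarrow> x / d < of_int n + 1" "of_int n * d \<le> x \<longleftrightarrow> of_int n \<le> x / d"
    using assms by (simp_all add: field_simps)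
  then show ?thesis by (metis floor_eq_iff)
qed

text \<open>The translates of the tile by the points of one class partition the space. The
  triangular system is solved in turn: the difference coordinates, in steps of sqrt 5, fix
  \<open>gim b\<close> and \<open>gim a\<close>; the unit interval fixes \<open>gre b\<close>; the
  interval of length 5 and the class fix \<open>gre a\<close>.\<close>

lemma tile_unique:
  assumes k: "k \<in> {0..<5}"
  shows "\<exists>!(a, b). kap2 a b = k \<and> (x - emb a b, y - emb' a b) \<in> tile"
proof -
  define nb where "nb = \<lfloor>(bc x - bc' y) / root5\<rfloor>"
  define na where "na = \<lfloor>(ac x - ac' y) / root5\<rfloor>"
  define mb where "mb = \<lfloor>bc x - nb * golden\<rfloor>"
  \<comment> \<open>The value of \<open>gre a\<close> that would make
    \<open>gre (a + b) + 3 * gim (a + b)\<close> equal to \<open>k\<close>. Only its residue modulo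
    5 matters, and \<open>ma\<close> is its representative in the interval required by the
    tile.\<close>
  define r where "r = k - 3 * na - (mb + 3 * nb)"
  define ma where "ma = r + 5 * \<lfloor>(ac x - na * golden - r) / 5\<rfloor>"
  have gap: "rv c - rv' c = of_int (gim c) * root5" for c
    by (rule rv_minus_rv')
  have tile_iff: "(x - emb a b, y - emb' a b) \<in> tile \<longleftrightarrow>
      gim b = nb \<and> gim a = na \<and> gre b = mb \<and> 0 \<le> ac x - rv a \<and> ac x - rv a < 5" for a b
  proof -
    have "bc x - rv b - root5 < bc' y - rv' b \<and> bc' y - rv' b \<le> bc x - rv b \<longleftrightarrow>
        bc x - bc' y - root5 < of_int (gim b) * root5 \<and> of_int (gim b) * root5 \<le> bc x - bc' y"
      unfolding gap[symmetric] by linarith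
    moreover have "ac x - rv a - root5 < ac' y - rv' a \<and> ac' y - rv' a \<le> ac x - rv a \<longleftrightarrow>
        ac x - ac' y - root5 < of_int (gim a) * root5 \<and> of_int (gim a) * root5 \<le> ac x - ac' y"
      unfolding gap[symmetric] by linarith
    moreover have "0 \<le> bc x - rv b \<and> bc x - rv b < 1 \<longleftrightarrow> gre b = mb" if "gim b = nb"
    proof -
      have "gre b = mb \<longleftrightarrow> of_int (gre b) \<le> bc x - nb * golden \<and> bc x - nb * golden < of_int (gre b) + 1"
        unfolding mb_def by (metis floor_eq_iff)
      also have "\<dots> \<longleftrightarrow> 0 \<le> bc x - rv b \<and> bc x - rv b < 1"
        unfolding rv_def that by linarith
      finally show ?thesis by blast
    qed
    ultimately show ?thesis
      unfolding tile_def coords_diff_emb mem_Collect_eq prod.case nb_def na_def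
        int_floor_unique[OF root5_pos, symmetric]
      using int_floor_unique[OF root5_pos] nb_def by blast
  qed
  have kap2_iff: "kap2 a b = k \<longleftrightarrow> 5 dvd gre a - r" if "gim b = nb" "gim a = na" "gre b = mb" for a b
  proof -
    have "kap2 a b = k \<longleftrightarrow> (gre (a + b) + 3 * gim (a + b)) mod 5 = k mod 5"
      using k by (simp add: kap2_alt kap_def)
    also have "\<dots> \<longleftrightarrow> 5 dvd gre a - r"
      unfolding mod_eq_dvd_iff using that by (simp add: r_def algebra_simps)
    finally show ?thesis .
  qed
  have "kap2 a b = k \<and> (x - emb a b, y - emb' a b) \<in> tile \<longleftrightarrow> a = Gold ma na \<and> b = Gold mb nb" for a b
  proof
    assume *: "kap2 a b = k \<and> (x - emb a b, y - emb' a b) \<in> tile"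
    then have c: "gim b = nb" "gim a = na" "gre b = mb" "0 \<le> ac x - rv a" "ac x - rv a < 5"
      unfolding tile_iff by blast+
    then obtain t where t: "gre a - r = 5 * t" using * kap2_iff by (auto elim: dvdE)
    then have ga: "real_of_int (gre a) = of_int r + 5 * of_int t" by linarith
    have "of_int t \<le> (ac x - na * golden - r) / 5" "(ac x - na * golden - r) / 5 < of_int t + 1"
      using c(4,5) unfolding rv_def c(2) ga by simp_all
    then have "t = \<lfloor>(ac x - na * golden - r) / 5\<rfloor>" by (metis floor_eq_iff)
    then have "gre a = ma" using t unfolding ma_def by linarith
    then show "a = Gold ma na \<and> b = Gold mb nb" using c by (simp add: gold_eq_iff)
  next
    assume *: "a = Gold ma na \<and> b = Gold mb nb"
    then have c: "gim b = nb" "gim a = na" "gre b = mb" "gre a = ma" by simp_all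
    define t where "t = \<lfloor>(ac x - na * golden - r) / 5\<rfloor>"
    have ma: "ma = r + 5 * t" by (simp add: ma_def t_def)
    have "of_int t \<le> (ac x - na * golden - r) / 5" "(ac x - na * golden - r) / 5 < of_int t + 1"
      unfolding t_def by linarith+
    then have "0 \<le> ac x - rv a" "ac x - rv a < 5"
      unfolding rv_def c ma by simp_all
    moreover have "kap2 a b = k" using kap2_iff[OF c(1-3)] c(4) ma by simp
    ultimately show "kap2 a b = k \<and> (x - emb a b, y - emb' a b) \<in> tile"
      unfolding tile_iff using c by blast
  qed
  then show ?thesis by auto
qed

lemma coords_measurable [measurable]:
  "bc \<in> borel_measurable borel" "ac \<in> borel_measurable borel"
  "bc' \<in> borel_measurable borel" "ac' \<in> borel_measurable borel"
proof -
  have "s1 \<noteq> 0" "s2 \<noteq> 0" using s12 by simp_all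
  then show "bc \<in> borel_measurable borel" "ac \<in> borel_measurable borel"
    "bc' \<in> borel_measurable borel" "ac' \<in> borel_measurable borel"
    unfolding bc_def[abs_def] ac_def[abs_def] bc'_def[abs_def] ac'_def[abs_def]
    by (intro borel_measurable_continuous_onI continuous_intros; simp)+
qed

lemma tile_sets: "tile \<in> sets borel"
proof -
  have [measurable]: "(\<lambda>p. f (fst p)) \<in> borel_measurable borel" "(\<lambda>p. f (snd p)) \<in> borel_measurable borel"
    if "f \<in> borel_measurable borel" for f :: "complex \<Rightarrow> real"
    by (rule measurable_compose[OF _ that], simp add: borel_measurable_continuous_onI continuous_on_fst continuous_on_snd)+
  have "{p :: complex \<times> complex. 0 \<le> bc (fst p) \<and> bc (fst p) < 1 \<and> 0 \<le> ac (fst p) \<and> ac (fst p) < 5 \<and>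
     bc (fst p) - root5 < bc' (snd p) \<and> bc' (snd p) \<le> bc (fst p) \<and>
     ac (fst p) - root5 < ac' (snd p) \<and> ac' (snd p) \<le> ac (fst p)} \<in> sets borel"
    by measurable
  then show ?thesis by (simp add: tile_def case_prod_unfold)
qed

text \<open>Five times the covolume sqrt 125 / 4 of the full lattice, 125 being the discriminant of
  the cyclotomic field.\<close>

definition covol :: real where "covol = 25 * root5 / 4"

lemma covol_pos: "0 < covol"
  using root5_pos by (simp add: covol_def)

text \<open>Fubini: \<open>x\<close> ranges over a parallelogram of area \<open>5 * s1\<close>, and
  each slice is a parallelogram whose position depends on \<open>x\<close> while its area,
  \<open>5 * s2\<close>, does not. The product \<open>s1 * s2\<close> is sqrt 5 / 4.\<close>

lemma emeasure_tile: "emeasure (lborel :: (complex \<times> complex) measure) tile = ennreal covol"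
proof -
  define A where "A = {x. 0 \<le> bc x \<and> bc x < 1 \<and> 0 \<le> ac x \<and> ac x < 5}"
  have A: "A \<in> sets borel" unfolding A_def by measurable
  have A_eq: "A = {z. (0 \<le> Im z / s1 \<and> Im z / s1 < 1) \<and> 0 \<le> Re z - Im z * (Re zeta5 / s1) \<and> Re z - Im z * (Re zeta5 / s1) < 5}"
    unfolding A_def bc_def ac_def by (simp add: conj_assoc)
  have "{b. 0 \<le> b / s1 \<and> b / s1 < 1} = {0..<s1}"
    using s12(1) by (auto simp: pos_divide_less_eq pos_le_divide_eq)
  moreover have "{a. 0 \<le> a - t \<and> a - t < 5} = {t..<t + 5}" for t :: real
    by auto
  ultimately have mA: "emeasure lborel A = ennreal (s1 * 5)"
    unfolding A_eq using s12(1) by (intro emeasure_parallelogram A[unfolded A_eq]) simp_all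
  have slice: "emeasure lborel (Pair x -` tile) = ennreal (s2 * root5 * root5) * indicator A x" for x
  proof (cases "x \<in> A")
    case True
    let ?B = "{y. bc x - root5 < bc' y \<and> bc' y \<le> bc x \<and> ac x - root5 < ac' y \<and> ac' y \<le> ac x}"
    have B: "?B \<in> sets borel" by measurable
    have B_eq: "?B = {z. (bc x - root5 < Im z / s2 \<and> Im z / s2 \<le> bc x) \<and>
        ac x - root5 < Re z - Im z * (Re (zeta5\<^sup>2) / s2) \<and> Re z - Im z * (Re (zeta5\<^sup>2) / s2) \<le> ac x}"
      unfolding bc'_def ac'_def by (simp add: conj_assoc)
    have "{b. bc x - root5 < b / s2 \<and> b / s2 \<le> bc x} = {s2 * (bc x - root5)<..s2 * bc x}"
      using s12(2) by (auto simp: pos_less_divide_eq pos_divide_le_eq mult.commute)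
    moreover have "s2 * (bc x - root5) \<le> s2 * bc x" "s2 * bc x - s2 * (bc x - root5) = s2 * root5"
      using s12(2) root5_pos by (simp_all add: algebra_simps)
    moreover have "{a. ac x - root5 < a - t \<and> a - t \<le> ac x} = {ac x - root5 + t<..ac x + t}" for t :: real
      by auto
    ultimately have "emeasure lborel ?B = ennreal (s2 * root5 * root5)"
      unfolding B_eq using s12(2) root5_pos by (intro emeasure_parallelogram B[unfolded B_eq]) simp_all
    moreover have "Pair x -` tile = ?B" using True by (auto simp: tile_def A_def)
    ultimately show ?thesis using True by simp
  next
    case False
    then have "Pair x -` tile = {}" by (auto simp: tile_def A_def)
    then show ?thesis using False by simp
  qed
  have "emeasure (lborel :: (complex \<times> complex) measure) tile = emeasure (lborel \<Otimes>\<^sub>M lborel) tile"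
    by (simp add: lborel_prod)
  also have "\<dots> = (\<integral>\<^sup>+x. emeasure lborel (Pair x -` tile) \<partial>lborel)"
    using tile_sets unfolding borel_prod[symmetric] by (intro lborel.emeasure_pair_measure_alt) simp
  also have "\<dots> = ennreal (s2 * root5 * root5) * ennreal (s1 * 5)"
    unfolding slice using A mA by (subst nn_integral_cmult_indicator) auto
  also have "\<dots> = ennreal (s2 * root5 * root5 * (s1 * 5))"
    using s12 root5_pos by (simp add: ennreal_mult[symmetric])
  also have "s2 * root5 * root5 * (s1 * 5) = s1 * s2 * (root5 * root5) * 5"
    by simp
  also have "root5 * root5 = 5"
    using golden_square by (simp add: algebra_simps)
  finally show ?thesis unfolding s12(3) by (simp add: covol_def)
qed

definition shifted_tile :: "gold \<Rightarrow> gold \<Rightarrow> (complex \<times> complex) set" where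
  "shifted_tile a b = {(x, y). (x - emb a b, y - emb' a b) \<in> tile}"

lemma shifted_tile_sets: "shifted_tile a b \<in> sets borel"
  and emeasure_shifted_tile: "emeasure lborel (shifted_tile a b) = ennreal covol"
proof -
  let ?v = "(- emb a b, - emb' a b)"
  have meas: "(+) ?v \<in> borel_measurable borel"
    by (intro borel_measurable_continuous_onI continuous_intros)
  have eq: "shifted_tile a b = (+) ?v -` tile"
    by (auto simp: shifted_tile_def)
  show "shifted_tile a b \<in> sets borel"
    using measurable_sets[OF meas tile_sets] by (simp add: eq)
  have "emeasure lborel tile = emeasure (distr lborel borel ((+) ?v)) tile"
    by (simp only: lborel_distr_plus)
  also have "\<dots> = emeasure lborel (shifted_tile a b)"
    using meas tile_sets by (subst emeasure_distr) (auto simp: eq)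
  finally show "emeasure lborel (shifted_tile a b) = ennreal covol"
    by (simp add: emeasure_tile)
qed

subsection \<open>Comparison of counts and volumes\<close>

definition points :: "int \<Rightarrow> complex set \<Rightarrow> complex set \<Rightarrow> (gold \<times> gold) set" where
  "points k A V = {(a, b). kap2 a b = k \<and> emb a b \<in> A \<and> emb' a b \<in> V}"

definition infl :: "real \<Rightarrow> complex set \<Rightarrow> complex set" where
  "infl r A = (\<Union>v\<in>A. ball v r)"

text \<open>The inner parallel set, taken through complements so that closedness and the scaling
  rule follow from those of \<open>infl\<close>.\<close>

definition defl :: "real \<Rightarrow> complex set \<Rightarrow> complex set" where
  "defl r A = - infl r (- A)"

lemma mem_defl_iff: "x \<in> defl r A \<longleftrightarrow> ball x r \<subseteq> A"
  by (auto simp: defl_def infl_def subset_iff dist_commute)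

lemma infl_open: "open (infl r A)" by (auto simp: infl_def)
lemma defl_closed: "closed (defl r A)" by (simp add: defl_def closed_def infl_open)

lemma infl_mono: "r \<le> s \<Longrightarrow> A \<subseteq> B \<Longrightarrow> infl r A \<subseteq> infl s B"
  unfolding infl_def by (meson UN_mono subset_ball)

lemma defl_antimono: "r \<le> s \<Longrightarrow> defl s A \<subseteq> defl r A"
  by (meson mem_defl_iff subsetI subset_ball subset_trans)

lemma infl_bounded:
  assumes "bounded A" shows "bounded (infl r A)"
proof -
  obtain C where "\<And>x. x \<in> A \<Longrightarrow> norm x \<le> C" using assms by (auto simp: bounded_iff)
  then have "norm x \<le> C + r" if "x \<in> infl r A" for x
    using that unfolding infl_def by (auto simp: dist_norm) (smt (verit) norm_triangle_sub norm_minus_commute)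
  then show ?thesis by (auto simp: bounded_iff)
qed

lemma finite_bounded_gold: "finite {a. \<bar>rv a\<bar> \<le> R \<and> \<bar>rv' a\<bar> \<le> R}"
proof -
  have "{a. \<bar>rv a\<bar> \<le> R \<and> \<bar>rv' a\<bar> \<le> R} \<subseteq> (\<lambda>(m, n). Gold m n) ` ({- \<lceil>6 * R\<rceil>..\<lceil>6 * R\<rceil>} \<times> {- \<lceil>6 * R\<rceil>..\<lceil>6 * R\<rceil>})"
  proof
    fix a assume "a \<in> {a. \<bar>rv a\<bar> \<le> R \<and> \<bar>rv' a\<bar> \<le> R}"
    then have "\<bar>real_of_int (gre a)\<bar> \<le> 6 * R" "\<bar>real_of_int (gim a)\<bar> \<le> 6 * R"
      using abs_gre_le[of a] abs_gim_le[of a] unfolding ring_distribs by auto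
    then have "\<bar>gre a\<bar> \<le> \<lceil>6 * R\<rceil>" "\<bar>gim a\<bar> \<le> \<lceil>6 * R\<rceil>" by linarith+
    then show "a \<in> (\<lambda>(m, n). Gold m n) ` ({- \<lceil>6 * R\<rceil>..\<lceil>6 * R\<rceil>} \<times> {- \<lceil>6 * R\<rceil>..\<lceil>6 * R\<rceil>})"
      by (intro image_eqI[of _ _ "(gre a, gim a)"]) auto
  qed
  then show ?thesis by (rule finite_subset) auto
qed

lemma finite_emb_bounded:
  assumes "bounded A" "bounded V"
  shows "finite {(a, b). emb a b \<in> A \<and> emb' a b \<in> V}"
proof -
  obtain C where C: "\<And>x. x \<in> A \<Longrightarrow> norm x \<le> C" using assms by (auto simp: bounded_iff)
  obtain C' where C': "\<And>x. x \<in> V \<Longrightarrow> norm x \<le> C'" using assms by (auto simp: bounded_iff)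
  define R where "R = (\<bar>C\<bar> + \<bar>C'\<bar>) / s1 + (\<bar>C\<bar> + \<bar>C'\<bar>) / s2"
  have R: "0 \<le> R" using s12 by (simp add: R_def)
  have "{(a, b). emb a b \<in> A \<and> emb' a b \<in> V} \<subseteq> {a. \<bar>rv a\<bar> \<le> \<bar>C\<bar> + \<bar>C'\<bar> + R \<and> \<bar>rv' a\<bar> \<le> \<bar>C\<bar> + \<bar>C'\<bar> + R} \<times> {a. \<bar>rv a\<bar> \<le> R \<and> \<bar>rv' a\<bar> \<le> R}"
  proof
    fix p assume "p \<in> {(a, b). emb a b \<in> A \<and> emb' a b \<in> V}"
    then obtain a b where ab: "emb a b \<in> A" "emb' a b \<in> V" "p = (a, b)" by blast
    have n: "norm (emb a b) \<le> \<bar>C\<bar> + \<bar>C'\<bar>" "norm (emb' a b) \<le> \<bar>C\<bar> + \<bar>C'\<bar>"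
      using C[OF ab(1)] C'[OF ab(2)] by linarith+
    have "Im (emb a b) = rv b * s1" "Im (emb' a b) = rv' b * s2"
      by (simp_all add: emb_def emb'_def s1_def s2_def)
    then have "\<bar>rv b\<bar> * s1 \<le> \<bar>C\<bar> + \<bar>C'\<bar>" "\<bar>rv' b\<bar> * s2 \<le> \<bar>C\<bar> + \<bar>C'\<bar>"
      using n abs_Im_le_cmod[of "emb a b"] abs_Im_le_cmod[of "emb' a b"] s12 by (simp_all add: abs_mult)
    then have "\<bar>rv b\<bar> \<le> (\<bar>C\<bar> + \<bar>C'\<bar>) / s1" "\<bar>rv' b\<bar> \<le> (\<bar>C\<bar> + \<bar>C'\<bar>) / s2"
      using s12 by (simp_all add: field_simps)
    moreover have "0 \<le> (\<bar>C\<bar> + \<bar>C'\<bar>) / s1" "0 \<le> (\<bar>C\<bar> + \<bar>C'\<bar>) / s2"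
      using s12 by simp_all
    ultimately have b: "\<bar>rv b\<bar> \<le> R" "\<bar>rv' b\<bar> \<le> R" unfolding R_def by linarith+
    have nz: "norm zeta5 = 1" by (simp add: zeta5_cis)
    have "of_real (rv a) = emb a b - of_real (rv b) * zeta5" "of_real (rv' a) = emb' a b - of_real (rv' b) * zeta5\<^sup>2"
      by (simp_all add: emb_def emb'_def)
    then have "norm (of_real (rv a) :: complex) \<le> norm (emb a b) + norm (of_real (rv b) * zeta5)"
      "norm (of_real (rv' a) :: complex) \<le> norm (emb' a b) + norm (of_real (rv' b) * zeta5\<^sup>2)"
      by (metis norm_triangle_ineq4)+
    then have "\<bar>rv a\<bar> \<le> norm (emb a b) + \<bar>rv b\<bar>" "\<bar>rv' a\<bar> \<le> norm (emb' a b) + \<bar>rv' b\<bar>"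
      by (simp_all add: norm_mult norm_power nz)
    then have "\<bar>rv a\<bar> \<le> \<bar>C\<bar> + \<bar>C'\<bar> + R" "\<bar>rv' a\<bar> \<le> \<bar>C\<bar> + \<bar>C'\<bar> + R"
      using n b by linarith+
    then show "p \<in> {a. \<bar>rv a\<bar> \<le> \<bar>C\<bar> + \<bar>C'\<bar> + R \<and> \<bar>rv' a\<bar> \<le> \<bar>C\<bar> + \<bar>C'\<bar> + R} \<times> {a. \<bar>rv a\<bar> \<le> R \<and> \<bar>rv' a\<bar> \<le> R}"
      using b ab(3) by simp
  qed
  then show ?thesis by (rule finite_subset) (intro finite_cartesian_product finite_bounded_gold)
qed

lemma finite_points: "bounded A \<Longrightarrow> bounded V \<Longrightarrow> finite (points k A V)"
  using finite_emb_bounded[of A V] by (rule rev_finite_subset) (auto simp: points_def)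

lemma lmeasurable_infl: "bounded A \<Longrightarrow> infl r A \<in> lmeasurable"
  using lmeasurable_open[OF infl_bounded infl_open] .

lemma emeasure_lborel_lmeasurable:
  fixes A :: "complex set"
  assumes "A \<in> lmeasurable" "A \<in> sets borel"
  shows "emeasure lborel A = ennreal (vol A)"
proof -
  have "emeasure lebesgue A = ennreal (vol A)"
    using assms(1) by (rule emeasure_eq_measure2)
  moreover have "emeasure lebesgue A = emeasure lborel A"
    using assms(2) by simp
  ultimately show ?thesis by simp
qed

lemma emeasure_infl: "bounded A \<Longrightarrow> emeasure lborel (infl r A) = ennreal (vol (infl r A))"
  using infl_open[of r A] by (intro emeasure_lborel_lmeasurable lmeasurable_infl) auto

lemma emeasure_complex_Times:
  fixes A B :: "complex set"
  assumes "A \<in> sets borel" "B \<in> sets borel"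
  shows "emeasure lborel (A \<times> B) = emeasure lborel A * emeasure lborel B"
proof -
  have "emeasure (lborel \<Otimes>\<^sub>M lborel) (A \<times> B) = emeasure lborel A * emeasure lborel B"
    using assms by (intro lborel.emeasure_pair_measure_Times) auto
  then show ?thesis by (simp add: lborel_prod)
qed

text \<open>The tiles attached to the counted points are disjoint. Having size below 11 they stay
  inside the product of neighbourhoods, and since every point lies in some tile they cover the
  product of inner parallel sets.\<close>

lemma points_volume_bounds:
  assumes k: "k \<in> {0..<5}" and bd: "bounded A" "bounded V"
  shows "covol * card (points k A V) \<le> vol (infl 11 A) * vol (infl 11 V)" (is ?upper)
    and "vol (defl 11 A) * vol (defl 11 V) \<le> covol * card (points k A V)" (is ?lower)
proof -
  let ?P = "points k A V"
  define U where "U = (\<Union>(a, b)\<in>?P. shifted_tile a b)"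
  have fin: "finite ?P" using bd by (rule finite_points)
  have disj: "disjoint_family_on (\<lambda>(a, b). shifted_tile a b) ?P"
    unfolding disjoint_family_on_def
  proof (intro ballI impI)
    fix p q assume pq: "p \<in> ?P" "q \<in> ?P" "p \<noteq> q"
    obtain a b c d where eq: "p = (a, b)" "q = (c, d)" by (metis surj_pair)
    note p = pq[unfolded eq]
    have "shifted_tile a b \<inter> shifted_tile c d = {}"
    proof (rule ccontr)
      assume "shifted_tile a b \<inter> shifted_tile c d \<noteq> {}"
      then obtain x y where "(x - emb a b, y - emb' a b) \<in> tile" "(x - emb c d, y - emb' c d) \<in> tile"
        by (auto simp: shifted_tile_def)
      then have "(a, b) = (c, d)"
        using tile_unique[OF k, of x y] p by (auto simp: points_def)
      then show False using p by simp
    qed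
    then show "(case p of (a, b) \<Rightarrow> shifted_tile a b) \<inter> (case q of (a, b) \<Rightarrow> shifted_tile a b) = {}"
      by (simp add: eq)
  qed
  have eU: "emeasure lborel U = ennreal (covol * card ?P)"
  proof -
    have "emeasure lborel U = (\<Sum>(a, b)\<in>?P. emeasure lborel (shifted_tile a b))"
      unfolding U_def using fin disj shifted_tile_sets
      by (subst sum_emeasure[symmetric]) (auto simp: case_prod_unfold)
    also have "\<dots> = ennreal (covol * card ?P)"
      using covol_pos by (simp add: emeasure_shifted_tile case_prod_unfold ennreal_mult ennreal_of_nat_eq_real_of_nat mult.commute)
    finally show ?thesis .
  qed
  have U_sets: "U \<in> sets borel"
    unfolding U_def using fin shifted_tile_sets by (intro sets.finite_UN) auto
  show ?upper
  proof -
    have "U \<subseteq> infl 11 A \<times> infl 11 V"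
    proof
      fix p assume "p \<in> U"
      then obtain x y a b where *: "emb a b \<in> A" "emb' a b \<in> V" "(x - emb a b, y - emb' a b) \<in> tile" "p = (x, y)"
        unfolding U_def shifted_tile_def points_def by blast
      then have "x \<in> ball (emb a b) 11" "y \<in> ball (emb' a b) 11"
        using tile_bounded[OF *(3)] by (simp_all add: dist_norm norm_minus_commute)
      then show "p \<in> infl 11 A \<times> infl 11 V" using * unfolding infl_def by blast
    qed
    then have "emeasure lborel U \<le> emeasure lborel (infl 11 A \<times> infl 11 V)"
      by (intro emeasure_mono) (auto simp: infl_open open_Times)
    also have "\<dots> = ennreal (vol (infl 11 A) * vol (infl 11 V))"
      using bd by (simp add: emeasure_complex_Times infl_open emeasure_infl ennreal_mult)
    finally show ?thesis unfolding eU by (subst (asm) ennreal_le_iff) auto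
  qed
  show ?lower
  proof -
    have "defl 11 A \<times> defl 11 V \<subseteq> U"
    proof clarify
      fix x y assume x: "x \<in> defl 11 A" and y: "y \<in> defl 11 V"
      obtain a b where ab: "kap2 a b = k" "(x - emb a b, y - emb' a b) \<in> tile"
        using tile_unique[OF k, of x y] by blast
      then have "emb a b \<in> ball x 11" "emb' a b \<in> ball y 11"
        using tile_bounded[OF ab(2)] by (simp_all add: dist_norm)
      then have "emb a b \<in> A" "emb' a b \<in> V" using x y unfolding mem_defl_iff by auto
      then show "(x, y) \<in> U" using ab unfolding U_def points_def shifted_tile_def by blast
    qed
    have sub: "defl 11 B \<subseteq> B" for B
      using centre_in_ball[of _ "11 :: real"] unfolding subset_iff mem_defl_iff by (metis zero_less_numeral)
    have cl: "defl 11 B \<in> sets borel" "emeasure lborel (defl 11 B) = ennreal (vol (defl 11 B))" if "bounded B" for B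
    proof -
      show "defl 11 B \<in> sets borel" using defl_closed by simp
      moreover have "defl 11 B \<in> lmeasurable"
        using defl_closed bounded_subset[OF that sub] by (intro lmeasurable_compact) (simp add: compact_eq_bounded_closed)
      ultimately show "emeasure lborel (defl 11 B) = ennreal (vol (defl 11 B))"
        by (intro emeasure_lborel_lmeasurable)
    qed
    have "ennreal (vol (defl 11 A) * vol (defl 11 V)) = emeasure lborel (defl 11 A \<times> defl 11 V)"
      using bd by (simp add: emeasure_complex_Times cl ennreal_mult)
    also have "\<dots> \<le> emeasure lborel U"
      using \<open>defl 11 A \<times> defl 11 V \<subseteq> U\<close> U_sets by (intro emeasure_mono) auto
    finally show ?thesis unfolding eU using covol_pos by (subst (asm) ennreal_le_iff) auto
  qed
qed

subsection \<open>Shrinking neighbourhoods\<close>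

text \<open>The neighbourhoods of radius 1 / (n + 1) decrease to the closure, which exceeds
  \<open>A\<close> by a null set; monotonicity in r passes from the sequence to all small
  radii.\<close>

lemma tendsto_measure_infl:
  assumes "bounded A" "negligible (frontier A)"
  shows "((\<lambda>r. vol (infl r A)) \<longlongrightarrow> vol A) (at_right 0)"
proof (rule tendstoI)
  fix e :: real assume "0 < e"
  define F where "F = (\<lambda>n :: nat. infl (1 / (1 + real n)) A)"
  have meas: "F n \<in> lmeasurable" for n
    unfolding F_def using assms(1) by (rule lmeasurable_infl)
  have "(\<Inter>n. F n) = closure A"
  proof (intro equalityI subsetI)
    fix x assume x: "x \<in> (\<Inter>n. F n)"
    show "x \<in> closure A"
      unfolding closure_approachable
    proof (intro allI impI)
      fix d :: real assume "0 < d"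
      then obtain n where n: "1 / (1 + real n) < d"
        by (metis add.commute nat_approx_posE of_nat_Suc)
      have "x \<in> F n" using x by blast
      then obtain v where "v \<in> A" "dist v x < 1 / (1 + real n)" by (auto simp: F_def infl_def)
      then show "\<exists>y\<in>A. dist y x < d" using n by (intro bexI[of _ v]) auto
    qed
  next
    fix x assume x: "x \<in> closure A"
    have "x \<in> F n" for n
    proof -
      have "0 < 1 / (1 + real n)" by simp
      then obtain y where "y \<in> A" "dist y x < 1 / (1 + real n)"
        using x unfolding closure_approachable by blast
      then show ?thesis by (auto simp: F_def infl_def)
    qed
    then show "x \<in> (\<Inter>n. F n)" by blast
  qed
  moreover have "(\<lambda>n. vol (F n)) \<longlonglongrightarrow> vol (\<Inter>n. F n)"
  proof (rule Lim_measure_decseq)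
    show "range F \<subseteq> sets lebesgue" using meas by (auto simp: fmeasurable_def)
    show "decseq F" unfolding F_def by (intro decseq_SucI infl_mono) (auto simp: field_simps)
    show "emeasure lebesgue (F i) \<noteq> \<infinity>" for i using meas[of i] fmeasurableD2 by fastforce
  qed
  ultimately have "(\<lambda>n. vol (F n)) \<longlonglongrightarrow> vol A"
    using measure_closure[OF assms] by simp
  then have "eventually (\<lambda>n. dist (vol (F n)) (vol A) < e) sequentially"
    using \<open>0 < e\<close> by (rule tendstoD)
  then obtain n where n: "dist (vol (F n)) (vol A) < e"
    by (auto simp: eventually_sequentially)
  have "eventually (\<lambda>r. r \<in> {0<..<1 / (1 + real n)}) (at_right 0)"
    by (rule eventually_at_right_real) simp
  then show "eventually (\<lambda>r. dist (vol (infl r A)) (vol A) < e) (at_right 0)"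
  proof eventually_elim
    case (elim r)
    then have "infl r A \<subseteq> F n" unfolding F_def by (intro infl_mono) auto
    then have "vol (infl r A) \<le> vol (F n)"
      using meas[of n] lmeasurable_infl[OF assms(1), of r] by (intro measure_mono_fmeasurable) (auto simp: fmeasurable_def)
    moreover have "A \<subseteq> infl r A" using elim by (auto simp: infl_def)
    then have "vol A \<le> vol (infl r A)"
      using measurable_Jordan[OF assms] lmeasurable_infl[OF assms(1), of r] by (intro measure_mono_fmeasurable) (auto simp: fmeasurable_def)
    ultimately show ?case using n by (simp add: dist_real_def)
  qed
qed

lemma defl_subset: "0 < r \<Longrightarrow> defl r A \<subseteq> A"
  using centre_in_ball unfolding subset_iff mem_defl_iff by blast

lemma lmeasurable_defl:
  assumes "bounded A" "0 < r" shows "defl r A \<in> lmeasurable"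
  using defl_closed bounded_subset[OF assms(1) defl_subset[OF assms(2)]]
  by (intro lmeasurable_compact) (simp add: compact_eq_bounded_closed)

text \<open>The dual statement: the inner parallel sets increase to the interior, which again
  differs from \<open>A\<close> by a null set.\<close>

lemma tendsto_measure_defl:
  assumes "bounded A" "negligible (frontier A)"
  shows "((\<lambda>r. vol (defl r A)) \<longlongrightarrow> vol A) (at_right 0)"
proof (rule tendstoI)
  fix e :: real assume "0 < e"
  define F where "F = (\<lambda>n :: nat. defl (1 / (1 + real n)) A)"
  have meas: "F n \<in> lmeasurable" for n
    unfolding F_def using assms(1) by (intro lmeasurable_defl) auto
  have un: "(\<Union>n. F n) = interior A"
  proof (intro equalityI subsetI)
    fix x assume "x \<in> (\<Union>n. F n)"
    then obtain n where "ball x (1 / (1 + real n)) \<subseteq> A" by (auto simp: F_def mem_defl_iff)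
    moreover have "0 < 1 / (1 + real n)" by simp
    ultimately show "x \<in> interior A" unfolding mem_interior by blast
  next
    fix x assume "x \<in> interior A"
    then obtain d where d: "0 < d" "ball x d \<subseteq> A" unfolding mem_interior by blast
    then obtain n where n: "1 / (1 + real n) < d"
      by (metis add.commute nat_approx_posE of_nat_Suc)
    then have "ball x (1 / (1 + real n)) \<subseteq> A" using d subset_ball[of _ d x] by fastforce
    then show "x \<in> (\<Union>n. F n)" by (auto simp: F_def mem_defl_iff)
  qed
  have "(\<lambda>n. vol (F n)) \<longlonglongrightarrow> vol (\<Union>n. F n)"
  proof (rule Lim_measure_incseq)
    show "range F \<subseteq> sets lebesgue" using meas by (auto simp: fmeasurable_def)
    show "incseq F" unfolding F_def by (intro incseq_SucI defl_antimono) (auto simp: field_simps)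
    show "emeasure lebesgue (\<Union>n. F n) \<noteq> \<infinity>"
      unfolding un using lmeasurable_interior[OF assms(1)] fmeasurableD2 by fastforce
  qed
  then have "(\<lambda>n. vol (F n)) \<longlonglongrightarrow> vol A"
    using measure_interior[OF assms] un by simp
  then have "eventually (\<lambda>n. dist (vol (F n)) (vol A) < e) sequentially"
    using \<open>0 < e\<close> by (rule tendstoD)
  then obtain n where n: "dist (vol (F n)) (vol A) < e"
    by (auto simp: eventually_sequentially)
  have "eventually (\<lambda>r. r \<in> {0<..<1 / (1 + real n)}) (at_right 0)"
    by (rule eventually_at_right_real) simp
  then show "eventually (\<lambda>r. dist (vol (defl r A)) (vol A) < e) (at_right 0)"
  proof eventually_elim
    case (elim r)
    then have "F n \<subseteq> defl r A" unfolding F_def by (intro defl_antimono) auto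
    then have "vol (F n) \<le> vol (defl r A)"
      using meas[of n] lmeasurable_defl[OF assms(1), of r] elim by (intro measure_mono_fmeasurable) (auto simp: fmeasurable_def)
    moreover have "vol (defl r A) \<le> vol A"
      using measurable_Jordan[OF assms] lmeasurable_defl[OF assms(1), of r] defl_subset[of r A] elim
      by (intro measure_mono_fmeasurable) (auto simp: fmeasurable_def)
    ultimately show ?case using n by (simp add: dist_real_def)
  qed
qed

lemma infl_scaleR:
  assumes "t \<noteq> 0" shows "infl r ((*\<^sub>R) t ` A) = (*\<^sub>R) t ` infl (r / \<bar>t\<bar>) A"
proof -
  have "ball (t *\<^sub>R v) r = (*\<^sub>R) t ` ball v (r / \<bar>t\<bar>)" for v :: complex
  proof (intro equalityI subsetI)
    fix x assume x: "x \<in> ball (t *\<^sub>R v) r"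
    have "\<bar>t\<bar> * norm (v - (1 / t) *\<^sub>R x) = norm (t *\<^sub>R v - x)"
      using assms by (simp add: norm_scaleR[symmetric] scaleR_diff_right del: norm_scaleR)
    then have "(1 / t) *\<^sub>R x \<in> ball v (r / \<bar>t\<bar>)"
      using x assms by (simp add: dist_norm field_simps)
    moreover have "x = t *\<^sub>R (1 / t) *\<^sub>R x" using assms by simp
    ultimately show "x \<in> (*\<^sub>R) t ` ball v (r / \<bar>t\<bar>)" by blast
  next
    fix x assume "x \<in> (*\<^sub>R) t ` ball v (r / \<bar>t\<bar>)"
    then obtain y where "x = t *\<^sub>R y" "y \<in> ball v (r / \<bar>t\<bar>)" by blast
    then have y: "x = t *\<^sub>R y" "norm (v - y) < r / \<bar>t\<bar>" by (simp_all add: dist_norm)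
    have "norm (t *\<^sub>R v - x) = \<bar>t\<bar> * norm (v - y)"
      unfolding y(1) by (simp add: scaleR_diff_right[symmetric])
    then show "x \<in> ball (t *\<^sub>R v) r" using y(2) assms by (simp add: dist_norm field_simps)
  qed
  then show ?thesis unfolding infl_def by auto
qed

lemma defl_scaleR:
  assumes "t \<noteq> 0" shows "defl r ((*\<^sub>R) t ` A) = (*\<^sub>R) t ` defl (r / \<bar>t\<bar>) A"
proof -
  have "bij ((*\<^sub>R) t :: complex \<Rightarrow> complex)"
    using assms by (intro bij_betwI[where g = "(*\<^sub>R) (1 / t)"]) auto
  then show ?thesis
    unfolding defl_def by (simp add: bij_image_Compl_eq[symmetric] infl_scaleR[OF assms])
qed

lemma measure_scaleR: "vol ((*\<^sub>R) t ` (A :: complex set)) = t\<^sup>2 * vol A"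
  using measure_lebesgue_affine[of t 0 A] by simp

subsection \<open>Multiples of a fixed element\<close>

definition mult_points :: "gold \<Rightarrow> int \<Rightarrow> complex set \<Rightarrow> complex set \<Rightarrow> (gold \<times> gold) set" where
  "mult_points g k A V = {(a, b) \<in> points k A V. g dvd a \<and> g dvd b}"

lemma mult_points_unit: "u dvd 1 \<Longrightarrow> mult_points (g * u) k A V = mult_points g k A V"
  by (simp add: mult_points_def mult_unit_dvd_iff)

lemma kap_range: "kap x \<in> {0..<5}" "kap2 a b \<in> {0..<5}"
  by (simp_all add: kap_def kap2_def)

lemma ex_residue_quotient:
  assumes "(m :: int) \<in> {0..<5}" "m \<noteq> 0" "k \<in> {0..<5}"
  shows "\<exists>k'\<in>{0..<5}. \<forall>j\<in>{0..<5}. (m * j) mod 5 = k \<longleftrightarrow> j = k'"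
proof -
  have five: "{0..<5 :: int} = {0, 1, 2, 3, 4}" by auto
  have "m = 1 \<or> m = 2 \<or> m = 3 \<or> m = 4" using assms(1,2) by auto
  moreover have "k = 0 \<or> k = 1 \<or> k = 2 \<or> k = 3 \<or> k = 4" using assms(3) by auto
  ultimately show ?thesis unfolding five by (elim disjE) simp_all
qed

text \<open>Division by \<open>g\<close> turns multiples into arbitrary lattice points, rescales the
  two regions separately and multiplies the class by the inverse of \<open>kap g\<close> modulo 5.
  One \<open>k'\<close> serves all regions.\<close>

lemma card_mult_points:
  assumes "g \<noteq> 0" "kap g \<noteq> 0" "k \<in> {0..<5}"
  obtains k' where "k' \<in> {0..<5}"
    "\<And>A V. card (mult_points g k A V) = card (points k' ((*\<^sub>R) (1 / rv g) ` A) ((*\<^sub>R) (1 / rv' g) ` V))"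
proof -
  obtain k' where k': "k' \<in> {0..<5}" "\<And>j. j \<in> {0..<5} \<Longrightarrow> (kap g * j) mod 5 = k \<longleftrightarrow> j = k'"
    using ex_residue_quotient[OF kap_range(1) assms(2,3)] by blast
  have nz: "rv g \<noteq> 0" "rv' g \<noteq> 0" using assms by simp_all
  have kap: "kap2 (g * c) (g * d) = (kap g * kap2 c d) mod 5" for c d
    by (simp add: kap2_alt distrib_left[symmetric] kap_mult)
  have mem: "x \<in> (*\<^sub>R) (1 / t) ` A \<longleftrightarrow> t *\<^sub>R x \<in> A" if "t \<noteq> 0" for t x and A :: "complex set"
  proof
    assume "t *\<^sub>R x \<in> A"
    moreover have "x = (1 / t) *\<^sub>R t *\<^sub>R x" using that by simp
    ultimately show "x \<in> (*\<^sub>R) (1 / t) ` A" by blast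
  qed (use that in auto)
  have "card (mult_points g k A V) = card (points k' ((*\<^sub>R) (1 / rv g) ` A) ((*\<^sub>R) (1 / rv' g) ` V))" for A V
  proof -
    have "mult_points g k A V = (\<lambda>(c, d). (g * c, g * d)) ` points k' ((*\<^sub>R) (1 / rv g) ` A) ((*\<^sub>R) (1 / rv' g) ` V)"
    proof (intro equalityI subsetI)
      fix p assume "p \<in> mult_points g k A V"
      then obtain c d where p: "p = (g * c, g * d)" "kap2 (g * c) (g * d) = k"
        "emb (g * c) (g * d) \<in> A" "emb' (g * c) (g * d) \<in> V"
        by (auto simp: mult_points_def points_def elim!: dvdE)
      then have "(c, d) \<in> points k' ((*\<^sub>R) (1 / rv g) ` A) ((*\<^sub>R) (1 / rv' g) ` V)"
        unfolding points_def mem_Collect_eq prod.case mem[OF nz(1)] mem[OF nz(2)] scaleR_emb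
        using k'(2)[OF kap_range(2)[of c d]] kap[of c d] by simp
      then show "p \<in> (\<lambda>(c, d). (g * c, g * d)) ` points k' ((*\<^sub>R) (1 / rv g) ` A) ((*\<^sub>R) (1 / rv' g) ` V)"
        using p(1) by (intro image_eqI[of _ _ "(c, d)"]) auto
    next
      fix p assume "p \<in> (\<lambda>(c, d). (g * c, g * d)) ` points k' ((*\<^sub>R) (1 / rv g) ` A) ((*\<^sub>R) (1 / rv' g) ` V)"
      then obtain c d where p: "p = (g * c, g * d)" "(c, d) \<in> points k' ((*\<^sub>R) (1 / rv g) ` A) ((*\<^sub>R) (1 / rv' g) ` V)"
        by auto
      then have "kap2 c d = k'" "emb (g * c) (g * d) \<in> A" "emb' (g * c) (g * d) \<in> V"
        unfolding points_def mem_Collect_eq prod.case mem[OF nz(1)] mem[OF nz(2)] scaleR_emb by auto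
      then show "p \<in> mult_points g k A V"
        using k'(2)[OF kap_range(2)[of c d]] kap[of c d] p(1) by (simp add: mult_points_def points_def)
    qed
    moreover have "inj_on (\<lambda>(c, d). (g * c, g * d)) B" for B
      using assms(1) by (auto intro!: inj_onI)
    ultimately show ?thesis by (simp add: card_image)
  qed
  then show ?thesis using that k'(1) by blast
qed

lemma unit_kap_nonzero: "u dvd 1 \<Longrightarrow> kap u \<noteq> 0"
  using gsqrt5_dvd_iff[of u] prime_elem_gsqrt5 by (meson dvd_trans prime_elem_not_unit)

lemma kap_mult_nonzero: "kap x \<noteq> 0 \<Longrightarrow> kap y \<noteq> 0 \<Longrightarrow> kap (x * y) \<noteq> 0"
  unfolding gsqrt5_dvd_iff[symmetric] using prime_elem_gsqrt5 by (simp add: prime_elem_dvd_mult_iff)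

lemma wt_unit_mult: "u dvd 1 \<Longrightarrow> wt (g * u) = wt g"
  by (rule wt_eqI) (simp add: abs_mult gold_is_unit_iff)

text \<open>\<open>g\<close> and \<open>g * u\<close> have the same multiples, but dividing by
  \<open>g * u\<close> changes the two scales by \<open>1 / rv u\<close> and \<open>rv u\<close>.
  Measured in the original regions, the radius 11 becomes \<open>d1\<close> and \<open>d2\<close>.
  The unit is left free, because the limit and the uniform bound balance the radii
  differently.\<close>

lemma mult_points_bounds:
  assumes g: "g \<noteq> 0" "kap g \<noteq> 0" and k: "k \<in> {0..<5}" and bd: "bounded D" "bounded V"
    and T: "0 < T" and u: "u dvd 1" "0 < rv u"
  defines "d1 \<equiv> 11 * \<bar>rv g\<bar> * rv u / T" and "d2 \<equiv> 11 * \<bar>rv' g\<bar> / rv u"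
  shows "covol * card (mult_points g k ((*\<^sub>R) T ` D) V)
      \<le> T\<^sup>2 * wt g * (vol (infl d1 D) * vol (infl d2 V))" (is ?upper)
    and "T\<^sup>2 * wt g * (vol (defl d1 D) * vol (defl d2 V))
      \<le> covol * card (mult_points g k ((*\<^sub>R) T ` D) V)" (is ?lower)
proof -
  define G where "G = g * u"
  have "u \<noteq> 0" using u by auto
  then have G: "G \<noteq> 0" "kap G \<noteq> 0"
    using g kap_mult_nonzero unit_kap_nonzero u by (auto simp: G_def)
  obtain k' where k': "k' \<in> {0..<5}"
    "\<And>A V. card (mult_points G k A V) = card (points k' ((*\<^sub>R) (1 / rv G) ` A) ((*\<^sub>R) (1 / rv' G) ` V))"
    using card_mult_points[OF G k] by blast
  define A where "A = (*\<^sub>R) (T / rv G) ` D"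
  define B where "B = (*\<^sub>R) (1 / rv' G) ` V"
  have card: "card (mult_points g k ((*\<^sub>R) T ` D) V) = card (points k' A B)"
    using k'(2)[of "(*\<^sub>R) T ` D" V] mult_points_unit[OF u(1)]
    by (simp add: G_def A_def B_def image_image)
  have nz: "rv G \<noteq> 0" "rv' G \<noteq> 0" using G by simp_all
  have d1: "11 / \<bar>T / rv G\<bar> = d1"
    using T u(2) nz by (simp add: d1_def G_def abs_mult)
  have d2: "11 / \<bar>1 / rv' G\<bar> = d2"
    using abs_rv'_unit[OF u(1)] u(2) by (simp add: d2_def G_def abs_mult)
  have bd': "bounded A" "bounded B" unfolding A_def B_def using bd by (auto intro: bounded_scaling)
  have "(T / rv G)\<^sup>2 * (1 / rv' G)\<^sup>2 = T\<^sup>2 * wt G"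
    unfolding wt_def rv_mult_rv'[symmetric] by (simp add: power_divide power_mult_distrib)
  also have "wt G = wt g" unfolding G_def by (rule wt_unit_mult[OF u(1)])
  finally have wt: "(T / rv G)\<^sup>2 * (1 / rv' G)\<^sup>2 = T\<^sup>2 * wt g" .
  have inf: "vol (infl 11 A) * vol (infl 11 B)
      = T\<^sup>2 * wt g * (vol (infl d1 D) * vol (infl d2 V))"
  proof -
    have t: "T / rv G \<noteq> 0" "1 / rv' G \<noteq> 0" using T nz by simp_all
    show ?thesis
      unfolding A_def B_def infl_scaleR[OF t(1)] infl_scaleR[OF t(2)] measure_scaleR d1 d2 wt[symmetric]
      by (simp only: mult_ac)
  qed
  have def: "vol (defl 11 A) * vol (defl 11 B)
      = T\<^sup>2 * wt g * (vol (defl d1 D) * vol (defl d2 V))"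
  proof -
    have t: "T / rv G \<noteq> 0" "1 / rv' G \<noteq> 0" using T nz by simp_all
    show ?thesis
      unfolding A_def B_def defl_scaleR[OF t(1)] defl_scaleR[OF t(2)] measure_scaleR d1 d2 wt[symmetric]
      by (simp only: mult_ac)
  qed
  show ?upper ?lower
    using points_volume_bounds[OF k'(1) bd'] unfolding inf def card .
qed

lemma mult_points_limit:
  assumes g: "g \<noteq> 0" "kap g \<noteq> 0" and k: "k \<in> {0..<5}"
    and D: "bounded D" "negligible (frontier D)" and V: "bounded V" "negligible (frontier V)"
  shows "((\<lambda>T. card (mult_points g k ((*\<^sub>R) T ` D) V) / T\<^sup>2)
      \<longlongrightarrow> wt g * (vol D * vol V) / covol) at_top"
proof -
  \<comment> \<open>For \<open>rv u\<close> between \<open>sqrt T / golden\<close> and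
    \<open>sqrt T\<close>, the radii are at most 11 times \<open>\<bar>rv g\<bar> / sqrt T\<close>
    and \<open>golden * \<bar>rv' g\<bar> / sqrt T\<close>; \<open>K\<close> covers both.\<close>
  define K where "K = 11 * (\<bar>rv g\<bar> + golden * \<bar>rv' g\<bar>)"
  have K: "0 < K" using g golden_gt by (auto simp: K_def intro!: add_pos_pos)
  have r0: "filterlim (\<lambda>T. K / sqrt T) (at_right 0) at_top"
  proof (rule tendsto_imp_filterlim_at_right)
    have "LIM T at_top. sqrt T :> at_top" by (rule sqrt_at_top)
    then show "((\<lambda>T. K / sqrt T) \<longlongrightarrow> 0) at_top"
      by (rule real_tendsto_divide_at_top[OF tendsto_const])
    show "eventually (\<lambda>T. 0 < K / sqrt T) at_top"
      using eventually_gt_at_top[of 0] by eventually_elim (use K in simp)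
  qed
  let ?c = "\<lambda>T. card (mult_points g k ((*\<^sub>R) T ` D) V) / T\<^sup>2"
  let ?up = "\<lambda>r. wt g * (vol (infl r D) * vol (infl r V)) / covol"
  let ?lo = "\<lambda>r. wt g * (vol (defl r D) * vol (defl r V)) / covol"
  have ev: "?c T \<le> ?up (K / sqrt T) \<and> ?lo (K / sqrt T) \<le> ?c T" if T: "0 < T" for T
  proof -
    have sT: "0 < sqrt T" "sqrt T * sqrt T = T" using T by simp_all
    obtain u where u: "u dvd 1" "0 < rv u" "rv u \<le> sqrt T" "sqrt T < golden * rv u"
      using unit_near[OF sT(1)] .
    define d1 where "d1 = 11 * \<bar>rv g\<bar> * rv u / T"
    define d2 where "d2 = 11 * \<bar>rv' g\<bar> / rv u"
    have "d1 \<le> 11 * \<bar>rv g\<bar> * sqrt T / T"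
      unfolding d1_def using u T by (intro divide_right_mono mult_left_mono) auto
    also have "\<dots> = 11 * \<bar>rv g\<bar> / sqrt T"
      using sT T by (simp add: field_simps)
    also have "\<dots> \<le> K / sqrt T"
      using sT golden_gt unfolding K_def by (intro divide_right_mono) auto
    finally have d1: "d1 \<le> K / sqrt T" .
    have "1 / rv u \<le> golden / sqrt T"
      using u sT by (simp add: field_simps)
    then have "11 * \<bar>rv' g\<bar> * (1 / rv u) \<le> 11 * \<bar>rv' g\<bar> * (golden / sqrt T)"
      by (intro mult_left_mono) auto
    then have "d2 \<le> 11 * (golden * \<bar>rv' g\<bar>) / sqrt T"
      by (simp add: d2_def mult_ac)
    also have "\<dots> \<le> K / sqrt T"
      using sT unfolding K_def by (intro divide_right_mono) auto
    finally have d2: "d2 \<le> K / sqrt T" .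
    have d_pos: "0 < d1" "0 < d2" "0 < K / sqrt T"
      using g u T K sT by (simp_all add: d1_def d2_def)
    note b = mult_points_bounds[OF g k D(1) V(1) T u(1,2), folded d1_def d2_def]
    have "vol (infl d1 D) * vol (infl d2 V)
        \<le> vol (infl (K / sqrt T) D) * vol (infl (K / sqrt T) V)"
      using D V d1 d2 by (intro mult_mono measure_mono_fmeasurable infl_mono lmeasurable_infl fmeasurableD) auto
    then have "covol * card (mult_points g k ((*\<^sub>R) T ` D) V)
        \<le> T\<^sup>2 * wt g * (vol (infl (K / sqrt T) D) * vol (infl (K / sqrt T) V))"
      by (intro order_trans[OF b(1)] mult_left_mono) auto
    then have up: "?c T \<le> ?up (K / sqrt T)"
      using T covol_pos by (simp add: field_simps)
    have "vol (defl (K / sqrt T) D) * vol (defl (K / sqrt T) V)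
        \<le> vol (defl d1 D) * vol (defl d2 V)"
      using D V d1 d2 d_pos by (intro mult_mono measure_mono_fmeasurable defl_antimono lmeasurable_defl fmeasurableD) auto
    then have "T\<^sup>2 * wt g * (vol (defl (K / sqrt T) D) * vol (defl (K / sqrt T) V))
        \<le> covol * card (mult_points g k ((*\<^sub>R) T ` D) V)"
      by (intro order_trans[OF _ b(2)] mult_left_mono) auto
    then have "?lo (K / sqrt T) \<le> ?c T"
      using T covol_pos by (simp add: field_simps)
    with up show ?thesis ..
  qed
  show ?thesis
  proof (rule tendsto_sandwich)
    show "eventually (\<lambda>T. ?lo (K / sqrt T) \<le> ?c T) at_top"
      using eventually_gt_at_top[of 0] by eventually_elim (use ev in blast)
    show "eventually (\<lambda>T. ?c T \<le> ?up (K / sqrt T)) at_top"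
      using eventually_gt_at_top[of 0] by eventually_elim (use ev in blast)
    have "(?up \<longlongrightarrow> wt g * (vol D * vol V) / covol) (at_right 0)"
      using covol_pos by (intro tendsto_intros tendsto_measure_infl D V) auto
    then show "((\<lambda>T. ?up (K / sqrt T)) \<longlongrightarrow> wt g * (vol D * vol V) / covol) at_top"
      using r0 by (rule filterlim_compose)
    have "(?lo \<longlongrightarrow> wt g * (vol D * vol V) / covol) (at_right 0)"
      using covol_pos by (intro tendsto_intros tendsto_measure_defl D V) auto
    then show "((\<lambda>T. ?lo (K / sqrt T)) \<longlongrightarrow> wt g * (vol D * vol V) / covol) at_top"
      using r0 by (rule filterlim_compose)
  qed
qed

text \<open>Both squared absolute values are the conjugates of \<open>c\<^sup>2 + (\<tau> - 1) c d + d\<^sup>2\<close>.\<close>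

lemma norm_emb_mult_ge_1:
  assumes "c \<noteq> 0 \<or> d \<noteq> 0" shows "1 \<le> norm (emb c d) * norm (emb' c d)"
proof -
  define q where "q = c * c + gphi * c * d + d * d"
  have one: "(norm (of_real x + of_real y * z))\<^sup>2 = x * x + 2 * Re z * x * y + y * y" if "norm z = 1" for x y z
  proof -
    have "(norm (of_real x + of_real y * z))\<^sup>2 = (x + y * Re z)\<^sup>2 + (y * Im z)\<^sup>2"
      by (simp add: cmod_power2)
    also have "\<dots> = x * x + 2 * Re z * x * y + y * y * ((Re z)\<^sup>2 + (Im z)\<^sup>2)"
      by (simp add: power2_eq_square algebra_simps)
    also have "(Re z)\<^sup>2 + (Im z)\<^sup>2 = 1"
      using that cmod_power2[of z] by simp
    finally show ?thesis by simp
  qed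
  have "(norm (emb c d))\<^sup>2 = rv q"
    unfolding emb_def using one[of zeta5 "rv c" "rv d"]
    by (simp add: zeta5_cis[symmetric] Re_zeta5 q_def rv_gphi) (simp add: zeta5_cis)
  moreover have "(norm (emb' c d))\<^sup>2 = rv' q"
    using one[of "zeta5\<^sup>2" "rv' c" "rv' d"] unfolding emb'_def Re_zeta5_square
    by (simp add: q_def rv_gphi norm_power) (simp add: zeta5_cis)
  ultimately have *: "(norm (emb c d) * norm (emb' c d))\<^sup>2 = \<bar>rv q\<bar> * \<bar>rv' q\<bar>"
    by (metis abs_ge_zero abs_of_nonneg power_mult_distrib zero_le_power2)
  have "emb c d \<noteq> 0" using assms by auto
  then have "q \<noteq> 0" using \<open>(norm (emb c d))\<^sup>2 = rv q\<close> by auto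
  then have "1 \<le> (norm (emb c d) * norm (emb' c d))\<^sup>2"
    unfolding * by (rule abs_gnorm_ge_1)
  then have "1\<^sup>2 \<le> (norm (emb c d) * norm (emb' c d))\<^sup>2" by simp
  then show ?thesis by (rule power2_le_imp_le) simp
qed

text \<open>If anything is counted, it is a nonzero multiple of \<open>g\<close> because the class
  is nonzero, and \<open>norm_emb_mult_ge_1\<close> bounds the norm of \<open>g\<close> by
  \<open>T * R * R\<close>. With a unit adapted to \<open>rv' g\<close> instead of \<open>T\<close>,
  the radii are at most \<open>11 * R * R\<close> and \<open>11 * golden\<close>, whatever
  \<open>g\<close> and \<open>T\<close> are.\<close>

lemma mult_points_uniform_bound:
  assumes k: "k \<in> {1..<5}" and bd: "bounded D" "bounded V"
  obtains C where "\<And>g T. g \<noteq> 0 \<Longrightarrow> kap g \<noteq> 0 \<Longrightarrow> 0 < T \<Longrightarrow>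
    card (mult_points g k ((*\<^sub>R) T ` D) V) / T\<^sup>2 \<le> C * wt g"
proof -
  obtain R1 R2 where R12: "\<And>x. x \<in> D \<Longrightarrow> norm x \<le> R1" "\<And>x. x \<in> V \<Longrightarrow> norm x \<le> R2"
    using bd unfolding bounded_iff by blast
  define R where "R = \<bar>R1\<bar> + \<bar>R2\<bar>"
  have R: "\<And>x. x \<in> D \<Longrightarrow> norm x \<le> R" "\<And>x. x \<in> V \<Longrightarrow> norm x \<le> R"
    using R12 unfolding R_def by fastforce+
  define C where "C = vol (infl (11 * R * R) D) * vol (infl (11 * golden) V) / covol"
  have "card (mult_points g k ((*\<^sub>R) T ` D) V) / T\<^sup>2 \<le> C * wt g"
    if g: "g \<noteq> 0" "kap g \<noteq> 0" and T: "0 < T" for g T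
  proof (cases "mult_points g k ((*\<^sub>R) T ` D) V = {}")
    case True
    then show ?thesis using covol_pos by (simp add: C_def)
  next
    case False
    then obtain a b where ab: "(a, b) \<in> points k ((*\<^sub>R) T ` D) V" "g dvd a" "g dvd b"
      by (auto simp: mult_points_def)
    obtain c d where cd: "a = g * c" "b = g * d" using ab by (auto elim!: dvdE)
    have "kap2 a b \<noteq> 0" using ab k by (auto simp: points_def)
    then have "c \<noteq> 0 \<or> d \<noteq> 0" using cd by (auto simp: kap2_def kap_def)
    have "norm (emb a b) = \<bar>rv g\<bar> * norm (emb c d)" "norm (emb' a b) = \<bar>rv' g\<bar> * norm (emb' c d)"
      unfolding cd scaleR_emb[symmetric] by simp_all
    then have "\<bar>rv g\<bar> * \<bar>rv' g\<bar> * (norm (emb c d) * norm (emb' c d)) = norm (emb a b) * norm (emb' a b)"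
      by simp
    moreover have "\<bar>rv g\<bar> * \<bar>rv' g\<bar> * 1 \<le> \<bar>rv g\<bar> * \<bar>rv' g\<bar> * (norm (emb c d) * norm (emb' c d))"
      using norm_emb_mult_ge_1[OF \<open>c \<noteq> 0 \<or> d \<noteq> 0\<close>] by (intro mult_left_mono) auto
    moreover have "norm (emb a b) \<le> T * R" "norm (emb' a b) \<le> R"
    proof -
      show "norm (emb' a b) \<le> R" using ab R by (auto simp: points_def)
      from ab obtain y where "y \<in> D" "emb a b = T *\<^sub>R y" by (auto simp: points_def)
      then show "norm (emb a b) \<le> T * R" using R(1)[of y] T by simp
    qed
    then have "norm (emb a b) * norm (emb' a b) \<le> (T * R) * R"
      by (intro mult_mono) (auto intro: order_trans[OF norm_ge_zero])
    ultimately have N: "\<bar>rv g\<bar> * \<bar>rv' g\<bar> \<le> T * R * R" by linarith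
    have "0 < \<bar>rv' g\<bar>" using g by simp
    then obtain u where u: "u dvd 1" "0 < rv u" "rv u \<le> \<bar>rv' g\<bar>" "\<bar>rv' g\<bar> < golden * rv u"
      by (rule unit_near)
    define d1 where "d1 = 11 * \<bar>rv g\<bar> * rv u / T"
    define d2 where "d2 = 11 * \<bar>rv' g\<bar> / rv u"
    have "\<bar>rv g\<bar> * rv u \<le> \<bar>rv g\<bar> * \<bar>rv' g\<bar>" using u by (intro mult_left_mono) auto
    then have "\<bar>rv g\<bar> * rv u \<le> T * R * R" using N by linarith
    then have d1: "d1 \<le> 11 * R * R"
      using T by (simp add: d1_def field_simps)
    have d2: "d2 \<le> 11 * golden"
      using u by (simp add: d2_def field_simps)
    note b = mult_points_bounds(1)[OF g _ bd T u(1,2), of k, folded d1_def d2_def]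
    have "vol (infl d1 D) * vol (infl d2 V) \<le> C * covol"
      unfolding C_def using bd d1 d2 covol_pos
      by (simp, intro mult_mono measure_mono_fmeasurable infl_mono lmeasurable_infl fmeasurableD) auto
    then have "covol * card (mult_points g k ((*\<^sub>R) T ` D) V) \<le> T\<^sup>2 * wt g * (C * covol)"
      using k by (intro order_trans[OF b] mult_left_mono) auto
    then show ?thesis using T covol_pos by (simp add: field_simps)
  qed
  then show ?thesis using that by blast
qed

subsection \<open>Primitive points\<close>

text \<open>Dominated convergence for unordered sums: a finite \<open>J\<close> carries all but e /
  4 of the majorant, which bounds both tails, and on \<open>J\<close> only finitely many limits are
  involved.\<close>

lemma tannery_infsum:
  fixes f :: "'b \<Rightarrow> 'a \<Rightarrow> real"
  assumes M: "M summable_on I"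
    and bound: "eventually (\<lambda>t. \<forall>i\<in>I. \<bar>f t i\<bar> \<le> M i) F"
    and lim: "\<And>i. i \<in> I \<Longrightarrow> ((\<lambda>t. f t i) \<longlongrightarrow> g i) F" and F: "F \<noteq> bot"
  shows "((\<lambda>t. \<Sum>\<^sub>\<infinity>i\<in>I. f t i) \<longlongrightarrow> (\<Sum>\<^sub>\<infinity>i\<in>I. g i)) F"
proof (rule tendstoI)
  fix e :: real assume "0 < e"
  have g: "\<bar>g i\<bar> \<le> M i" if i: "i \<in> I" for i
  proof (rule tendsto_upperbound[OF tendsto_rabs[OF lim[OF i]] _ F])
    show "eventually (\<lambda>t. \<bar>f t i\<bar> \<le> M i) F"
      using bound by eventually_elim (use i in blast)
  qed
  have M0: "0 \<le> M i" if "i \<in> I" for i using g[OF that] by linarith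
  obtain J where J: "finite J" "J \<subseteq> I" "dist (sum M J) (infsum M I) \<le> e / 4"
    using infsum_finite_approximation[OF M, of "e / 4"] \<open>0 < e\<close> by auto
  have MJ: "M summable_on (I - J)" using M J(1) by (rule summable_on_cofin_subset)
  have split: "infsum h I = sum h J + infsum h (I - J)" if "h summable_on I" for h :: "'a \<Rightarrow> real"
  proof -
    have "infsum h (J \<union> (I - J)) = infsum h J + infsum h (I - J)"
      using J that by (intro infsum_Un_disjoint summable_on_cofin_subset) auto
    then show ?thesis using J by (simp add: Un_absorb1)
  qed
  have tail_M: "infsum M (I - J) \<le> e / 4"
    using split[OF M] J(3) by (simp add: dist_real_def)
  have tail: "\<bar>infsum h (I - J)\<bar> \<le> e / 4" and summ: "h summable_on I"
    if h: "\<And>i. i \<in> I \<Longrightarrow> \<bar>h i\<bar> \<le> M i" for h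
  proof -
    have "(\<lambda>i. \<bar>h i\<bar>) summable_on I"
      using M h by (rule summable_on_comparison_test) auto
    then show summ: "h summable_on I" using abs_summable_summable[of h I] by simp
    then have "h summable_on (I - J)" using J(1) by (rule summable_on_cofin_subset)
    then have "norm (infsum h (I - J)) \<le> infsum M (I - J)"
      using MJ h by (intro norm_infsum_le[OF has_sum_infsum has_sum_infsum]) auto
    then show "\<bar>infsum h (I - J)\<bar> \<le> e / 4" using tail_M by simp
  qed
  have "((\<lambda>t. \<Sum>i\<in>J. f t i) \<longlongrightarrow> (\<Sum>i\<in>J. g i)) F"
    using J(2) by (intro tendsto_sum lim) auto
  then have "eventually (\<lambda>t. dist (\<Sum>i\<in>J. f t i) (\<Sum>i\<in>J. g i) < e / 4) F"
    using \<open>0 < e\<close> by (intro tendstoD) auto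
  with bound show "eventually (\<lambda>t. dist (\<Sum>\<^sub>\<infinity>i\<in>I. f t i) (\<Sum>\<^sub>\<infinity>i\<in>I. g i) < e) F"
  proof eventually_elim
    case (elim t)
    have "infsum (f t) I = sum (f t) J + infsum (f t) (I - J)" "\<bar>infsum (f t) (I - J)\<bar> \<le> e / 4"
      using split[OF summ[of "f t"]] tail[of "f t"] elim by blast+
    moreover have "infsum g I = sum g J + infsum g (I - J)" "\<bar>infsum g (I - J)\<bar> \<le> e / 4"
      using split[OF summ[of g]] tail[of g] g by blast+
    ultimately show ?case using elim(2) \<open>0 < e\<close> unfolding dist_real_def by linarith
  qed
qed

definition prim_points :: "int \<Rightarrow> complex set \<Rightarrow> complex set \<Rightarrow> (gold \<times> gold) set" where
  "prim_points k A V = {(a, b) \<in> points k A V. coprime a b}"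

lemma has_sum_finite_sum:
  fixes f :: "'a \<Rightarrow> 'b \<Rightarrow> real"
  assumes "finite P" "\<And>p. p \<in> P \<Longrightarrow> (f p has_sum c p) I"
  shows "((\<lambda>i. \<Sum>p\<in>P. f p i) has_sum (\<Sum>p\<in>P. c p)) I"
  using assms by (induction P) (auto intro!: has_sum_add has_sum_0)

text \<open>Only sets of common prime divisors contribute, so the sum is a finite alternating one.
  Since the class is nonzero, \<open>pi5\<close> is no common divisor, and all these sets lie in
  \<open>prime_sets'\<close>.\<close>

lemma has_sum_coprime_indicator:
  assumes "kap2 a b \<noteq> 0"
  shows "((\<lambda>S. (- 1) ^ card S * of_bool (\<Prod>S dvd a \<and> \<Prod>S dvd b)) has_sum (of_bool (coprime a b) :: real)) prime_sets'"
proof -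
  let ?Q = "{q. prime q \<and> q dvd gcd a b}"
  have "a \<noteq> 0 \<or> b \<noteq> 0" using assms by (auto simp: kap2_def kap_def)
  then have nz: "gcd a b \<noteq> 0" by simp
  have fin: "finite ?Q"
    using prime_factors_dvd[OF nz] finite_set_mset[of "prime_factorization (gcd a b)"] by simp
  have "\<not> pi5 dvd gcd a b"
    using assms by (auto simp: kap2_def pi5_dvd_iff[symmetric])  (simp add: pi5_dvd_iff)
  then have sub: "Pow ?Q \<subseteq> prime_sets'"
    using fin finite_subset by (auto simp: prime_sets'_def prime_sets_def)
  have iff: "\<Prod>S dvd a \<and> \<Prod>S dvd b \<longleftrightarrow> S \<in> Pow ?Q" if S: "S \<in> prime_sets'" for S
  proof -
    have S': "S \<in> prime_sets" using S by (simp add: prime_sets'_def)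
    have "\<Prod>S dvd a \<and> \<Prod>S dvd b \<longleftrightarrow> \<Prod>S dvd gcd a b" by simp
    also have "\<dots> \<longleftrightarrow> S \<in> Pow ?Q"
      unfolding prod_primes_dvd_iff[OF S'] using S' by (auto simp: prime_sets_def)
    finally show ?thesis .
  qed
  show ?thesis
  proof (rule has_sum_finite_neutralI)
    show "finite (Pow ?Q)" using fin by simp
    show "Pow ?Q \<subseteq> prime_sets'" by (rule sub)
    show "(- 1) ^ card S * of_bool (\<Prod>S dvd a \<and> \<Prod>S dvd b) = (0 :: real)" if "S \<in> prime_sets' - Pow ?Q" for S
      using that iff[of S] by simp
    have "(\<Sum>S\<in>Pow ?Q. (- 1) ^ card S * of_bool (\<Prod>S dvd a \<and> \<Prod>S dvd b)) = (\<Sum>S\<in>Pow ?Q. (- 1) ^ card S :: real)"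
    proof (rule sum.cong)
      fix S assume S: "S \<in> Pow ?Q"
      then have "S \<in> prime_sets'" using sub by blast
      with S have "\<Prod>S dvd a \<and> \<Prod>S dvd b" using iff by blast
      then show "(- 1) ^ card S * of_bool (\<Prod>S dvd a \<and> \<Prod>S dvd b) = ((- 1) ^ card S :: real)" by simp
    qed simp
    also have "\<dots> = (if ?Q = {} then 1 else 0)" by (rule sum_alternating_Pow[OF fin])
    also have "?Q = {} \<longleftrightarrow> coprime a b"
    proof
      assume Q: "?Q = {}"
      have "gcd a b dvd 1"
      proof (rule ccontr)
        assume "\<not> gcd a b dvd 1"
        then obtain p where "p dvd gcd a b" "prime p" using prime_divisor_exists[OF nz] by blast
        then show False using Q by blast
      qed
      then show "coprime a b" unfolding coprime_iff_gcd_eq_1 is_unit_gcd_iff .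
    next
      assume "coprime a b"
      then have "gcd a b = 1" by simp
      then show "?Q = {}" by (auto simp: not_prime_unit)
    qed
    finally show "of_bool (coprime a b) = (\<Sum>S\<in>Pow ?Q. (- 1) ^ card S * of_bool (\<Prod>S dvd a \<and> \<Prod>S dvd b) :: real)"
      by simp
  qed
qed

text \<open>The pointwise identity summed over the finitely many points of the region.\<close>

lemma card_prim_points:
  assumes k: "k \<in> {1..<5}" and bd: "bounded A" "bounded V"
  shows "((\<lambda>S. (- 1) ^ card S * real (card (mult_points (\<Prod>S) k A V))) has_sum real (card (prim_points k A V))) prime_sets'"
proof -
  let ?P = "points k A V"
  have fin: "finite ?P" using bd by (rule finite_points)
  have card: "real (card {(a, b) \<in> ?P. Q a b}) = (\<Sum>(a, b)\<in>?P. of_bool (Q a b))" for Q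
  proof -
    have "{(a, b) \<in> ?P. Q a b} = {p \<in> ?P. Q (fst p) (snd p)}" by auto
    then show ?thesis using fin by (simp add: case_prod_unfold sum_of_bool_eq Int_def)
  qed
  have "((\<lambda>S. \<Sum>p\<in>?P. (- 1) ^ card S * of_bool (\<Prod>S dvd fst p \<and> \<Prod>S dvd snd p)) has_sum
      (\<Sum>p\<in>?P. of_bool (coprime (fst p) (snd p)) :: real)) prime_sets'"
    by (rule has_sum_finite_sum[OF fin], rule has_sum_coprime_indicator) (use k in \<open>auto simp: points_def\<close>)
  moreover have "(\<Sum>p\<in>?P. of_bool (coprime (fst p) (snd p)) :: real) = card (prim_points k A V)"
    unfolding prim_points_def card by (simp add: case_prod_unfold)
  moreover have "(\<Sum>p\<in>?P. (- 1) ^ card S * of_bool (\<Prod>S dvd fst p \<and> \<Prod>S dvd snd p))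
      = (- 1) ^ card S * real (card (mult_points (\<Prod>S) k A V))" for S
    unfolding mult_points_def card by (simp add: case_prod_unfold sum_distrib_left)
  ultimately show ?thesis by simp
qed

lemma prime_sets'_nonzero:
  assumes "S \<in> prime_sets'" shows "\<Prod>S \<noteq> 0" "kap (\<Prod>S) \<noteq> 0"
proof -
  have S: "S \<in> prime_sets" "pi5 \<notin> S" using assms by (auto simp: prime_sets'_def)
  show "\<Prod>S \<noteq> 0" using S(1) by (rule prod_primes_nonzero)
  show "kap (\<Prod>S) \<noteq> 0"
    unfolding pi5_dvd_iff[symmetric] prime_dvd_prod_primes_iff[OF S(1) prime_pi5] by (rule S(2))
qed

lemma prim_points_limit:
  assumes k: "k \<in> {1..<5}"
    and D: "bounded D" "negligible (frontier D)" and V: "bounded V" "negligible (frontier V)"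
  shows "((\<lambda>T. card (prim_points k ((*\<^sub>R) T ` D) V) / T\<^sup>2)
      \<longlongrightarrow> vol D * vol V / (6 * root5 * zeta_gold)) at_top"
proof -
  define f where "f T S = (- 1) ^ card S * (card (mult_points (\<Prod>S) k ((*\<^sub>R) T ` D) V) / T\<^sup>2)" for T S
  define L where "L = vol D * vol V / covol"
  obtain C where C: "\<And>g T. g \<noteq> 0 \<Longrightarrow> kap g \<noteq> 0 \<Longrightarrow> 0 < T \<Longrightarrow>
    card (mult_points g k ((*\<^sub>R) T ` D) V) / T\<^sup>2 \<le> C * wt g"
    using mult_points_uniform_bound[OF k D(1) V(1)] by blast
  have "((\<lambda>T. \<Sum>\<^sub>\<infinity>S\<in>prime_sets'. f T S) \<longlongrightarrow> (\<Sum>\<^sub>\<infinity>S\<in>prime_sets'. sign_wt S * L)) at_top"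
  proof (rule tannery_infsum)
    have "(\<lambda>S. wt (\<Prod>S)) summable_on prime_sets'"
      using summable_wt_prime_sets by (rule summable_on_subset_banach) (auto simp: prime_sets'_def)
    then show "(\<lambda>S. C * wt (\<Prod>S)) summable_on prime_sets'" by (rule summable_on_cmult_right)
    show "eventually (\<lambda>T. \<forall>S\<in>prime_sets'. \<bar>f T S\<bar> \<le> C * wt (\<Prod>S)) at_top"
      using eventually_gt_at_top[of 0]
    proof eventually_elim
      case (elim T)
      show ?case
      proof
        fix S assume "S \<in> prime_sets'"
        from C[OF prime_sets'_nonzero[OF this] elim] show "\<bar>f T S\<bar> \<le> C * wt (\<Prod>S)"
          by (simp add: f_def abs_mult)
      qed
    qed
    show "((\<lambda>T. f T S) \<longlongrightarrow> sign_wt S * L) at_top" if S: "S \<in> prime_sets'" for S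
    proof -
      have "((\<lambda>T. f T S) \<longlongrightarrow> (- 1) ^ card S * (wt (\<Prod>S) * (vol D * vol V) / covol)) at_top"
        unfolding f_def using k
        by (intro tendsto_mult_left mult_points_limit prime_sets'_nonzero[OF S] D V) auto
      then show ?thesis by (simp add: sign_wt_def L_def mult.assoc)
    qed
  qed simp
  also have "(\<Sum>\<^sub>\<infinity>S\<in>prime_sets'. sign_wt S * L) = 25 / (24 * zeta_gold) * L"
    unfolding sign_wt_sum_coprime_5[symmetric] by (rule infsum_cmult_left')
  \<comment> \<open>The 25 of the removed Euler factor cancels against the 25 in the covolume, and
    24 / 4 = 6.\<close>
  also have "\<dots> = vol D * vol V / (6 * root5 * zeta_gold)"
  proof -
    have "25 / (24 * z) * (x / (25 * r / 4)) = x / (6 * r * z)" for x r z :: real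
      by (cases "r = 0"; cases "z = 0") (auto simp: field_simps)
    then show ?thesis unfolding L_def covol_def .
  qed
  finally have lim: "((\<lambda>T. \<Sum>\<^sub>\<infinity>S\<in>prime_sets'. f T S) \<longlongrightarrow> vol D * vol V / (6 * root5 * zeta_gold)) at_top" .
  have "(\<Sum>\<^sub>\<infinity>S\<in>prime_sets'. f T S) = card (prim_points k ((*\<^sub>R) T ` D) V) / T\<^sup>2" for T
  proof -
    have "((\<lambda>S. (- 1) ^ card S * real (card (mult_points (\<Prod>S) k ((*\<^sub>R) T ` D) V)) * (1 / T\<^sup>2))
        has_sum real (card (prim_points k ((*\<^sub>R) T ` D) V)) * (1 / T\<^sup>2)) prime_sets'"
      using D(1) V(1) by (intro has_sum_cmult_left card_prim_points[OF k]) (auto intro: bounded_scaling)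
    then show ?thesis by (intro infsumI) (simp add: f_def)
  qed
  with lim show ?thesis by simp
qed

section \<open>The pentagon\<close>

definition pentagon_hull :: "complex set" where
  "pentagon_hull = convex hull {1, zeta5, zeta5 ^ 2, zeta5 ^ 3, zeta5 ^ 4}"

lemma pentagon_eq: "pentagon = interior pentagon_hull"
  by (simp add: pentagon_def pentagon_hull_def)

lemma convex_pentagon: "convex pentagon"
  by (simp add: pentagon_eq pentagon_hull_def convex_interior)

lemma norm_pentagon_le:
  assumes "w \<in> pentagon" shows "norm w \<le> 1"
proof -
  have "norm zeta5 = 1" by (simp add: zeta5_cis)
  then have "{1, zeta5, zeta5 ^ 2, zeta5 ^ 3, zeta5 ^ 4} \<subseteq> cball 0 1"
    by (auto simp: norm_power)
  then have "pentagon_hull \<subseteq> cball 0 1"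
    unfolding pentagon_hull_def by (rule hull_minimal) (rule convex_cball)
  moreover have "w \<in> pentagon_hull" using assms interior_subset unfolding pentagon_eq by blast
  ultimately have "w \<in> cball 0 1" by blast
  then show ?thesis by simp
qed

lemma cis_vertex: "cis (2 * pi / 5 * of_int k) \<in> {1, zeta5, zeta5 ^ 2, zeta5 ^ 3, zeta5 ^ 4}"
proof -
  define r where "r = nat (k mod 5)"
  have k: "of_int k = 5 * of_int (k div 5) + (of_nat r :: real)"
  proof -
    have "k = 5 * (k div 5) + int r" by (simp add: r_def)
    then show ?thesis by (metis of_int_add of_int_mult of_int_numeral of_int_of_nat_eq)
  qed
  have "cis (2 * pi / 5 * of_int k) = cis (2 * pi * of_int (k div 5) + of_nat r * (2 * pi / 5))"
    unfolding k by (simp add: algebra_simps)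
  also have "\<dots> = zeta5 ^ r"
    unfolding cis_mult[symmetric] zeta5_cis Complex.DeMoivre by (simp add: cis_multiple_2pi)
  finally have eq: "cis (2 * pi / 5 * of_int k) = zeta5 ^ r" .
  have "r < 5" by (simp add: r_def)
  then have "r = 0 \<or> r = 1 \<or> r = 2 \<or> r = 3 \<or> r = 4" by linarith
  then show ?thesis unfolding eq by auto
qed

lemma cos_36: "cos (pi / 5) = golden / 2"
proof -
  have "zeta5\<^sup>2 = cis (pi - pi / 5)"
    unfolding zeta5_cis Complex.DeMoivre by (simp add: field_simps)
  then have "Re (zeta5\<^sup>2) = - cos (pi / 5)" by (simp only: cis.sel cos_pi_minus)
  then show ?thesis using Re_zeta5_square by simp
qed

text \<open>The vertices are 72 degrees apart, so rounding the argument of \<open>w\<close> finds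
  one within 36 degrees, and cos 36 = \<open>golden / 2\<close>.\<close>

lemma ex_vertex_inner_ge:
  fixes w :: complex
  obtains v where "v \<in> {1, zeta5, zeta5 ^ 2, zeta5 ^ 3, zeta5 ^ 4}" "golden / 2 * norm w \<le> w \<bullet> v"
proof -
  define \<theta> where "\<theta> = Arg w"
  define k where "k = round (\<theta> / (2 * pi / 5))"
  define \<phi> where "\<phi> = \<theta> - 2 * pi / 5 * of_int k"
  have "\<bar>of_int k - \<theta> / (2 * pi / 5)\<bar> \<le> 1 / 2"
    unfolding k_def by (rule of_int_round_abs_le)
  then have "(2 * pi / 5) * \<bar>of_int k - \<theta> / (2 * pi / 5)\<bar> \<le> (2 * pi / 5) * (1 / 2)"
    by (intro mult_left_mono) auto
  moreover have "(2 * pi / 5) * \<bar>of_int k - \<theta> / (2 * pi / 5)\<bar> = \<bar>\<phi>\<bar>"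
  proof -
    have "(2 * pi / 5) * \<bar>of_int k - \<theta> / (2 * pi / 5)\<bar> = \<bar>(2 * pi / 5) * (of_int k - \<theta> / (2 * pi / 5))\<bar>"
      by (simp add: abs_mult)
    also have "(2 * pi / 5) * (of_int k - \<theta> / (2 * pi / 5)) = - \<phi>"
      by (simp add: \<phi>_def right_diff_distrib)
    finally show ?thesis by simp
  qed
  ultimately have "\<bar>\<phi>\<bar> \<le> (2 * pi / 5) * (1 / 2)" by (simp only:)
  then have "\<bar>\<phi>\<bar> \<le> pi / 5" by simp
  then have "cos (pi / 5) \<le> cos \<bar>\<phi>\<bar>"
    by (intro cos_monotone_0_pi_le) auto
  then have cos: "golden / 2 \<le> cos \<phi>" by (simp add: cos_36)
  have w: "w = of_real (norm w) * cis \<theta>"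
    unfolding \<theta>_def using rcis_cmod_Arg[of w] by (simp add: rcis_def)
  have "w \<bullet> cis (2 * pi / 5 * of_int k) = norm w * cos \<phi>"
    by (subst w) (simp add: inner_complex_def \<phi>_def cos_diff algebra_simps)
  then have "golden / 2 * norm w \<le> w \<bullet> cis (2 * pi / 5 * of_int k)"
    using mult_right_mono[OF cos, of "norm w"] by (simp add: mult.commute)
  then show ?thesis using that cis_vertex by blast
qed

text \<open>\<open>golden / 2\<close> is the inradius. A point outside the hull is separated from it
  by a line, yet some vertex reaches at least distance \<open>golden / 2\<close> in the separating
  direction.\<close>

lemma ball_subset_pentagon: "ball 0 (golden / 2) \<subseteq> pentagon"
proof -
  have "ball 0 (golden / 2) \<subseteq> pentagon_hull"
  proof (rule ccontr)
    assume "\<not> ball 0 (golden / 2) \<subseteq> pentagon_hull"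
    then obtain z where "z \<in> ball 0 (golden / 2)" "z \<notin> pentagon_hull" by blast
    then have z: "norm z < golden / 2" "z \<notin> pentagon_hull" by simp_all
    have "convex pentagon_hull" "closed pentagon_hull"
      by (auto simp: pentagon_hull_def intro!: compact_imp_closed finite_imp_compact_convex_hull)
    then obtain a b where ab: "a \<bullet> z < b" "\<forall>x\<in>pentagon_hull. a \<bullet> x > b"
      using separating_hyperplane_closed_point[of pentagon_hull z] z by auto
    obtain v where v: "v \<in> {1, zeta5, zeta5 ^ 2, zeta5 ^ 3, zeta5 ^ 4}" "golden / 2 * norm (- a) \<le> (- a) \<bullet> v"
      by (rule ex_vertex_inner_ge)
    have "v \<in> pentagon_hull" unfolding pentagon_hull_def using v(1) by (rule hull_inc)
    then have "a \<bullet> z < a \<bullet> v" using ab by force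
    then have "golden / 2 * norm a < - (a \<bullet> z)" using v(2) by simp
    also have "\<dots> \<le> norm a * norm z"
      using Cauchy_Schwarz_ineq2[of a z] by linarith
    finally have "norm a * (golden / 2) < norm a * norm z" by (simp add: mult.commute)
    moreover have "norm a * norm z \<le> norm a * (golden / 2)" using z(1) by (intro mult_left_mono) auto
    ultimately show False by linarith
  qed
  then show ?thesis unfolding pentagon_eq by (intro interior_maximal) auto
qed

subsection \<open>Affine images\<close>

definition aff :: "real \<Rightarrow> complex \<Rightarrow> complex set" where
  "aff c e = (\<lambda>w. c *\<^sub>R w + e) ` pentagon"

lemma mem_aff_iff: "c \<noteq> 0 \<Longrightarrow> x \<in> aff c e \<longleftrightarrow> (1 / c) *\<^sub>R (x - e) \<in> pentagon"
proof
  assume c: "c \<noteq> 0" and "(1 / c) *\<^sub>R (x - e) \<in> pentagon"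
  moreover have "x = c *\<^sub>R ((1 / c) *\<^sub>R (x - e)) + e" using c by simp
  ultimately show "x \<in> aff c e" unfolding aff_def by blast
qed (auto simp: aff_def)

lemma aff_scale: "c \<noteq> 0 \<Longrightarrow> d \<noteq> 0 \<Longrightarrow> d *\<^sub>R x \<in> aff c e \<longleftrightarrow> x \<in> aff (c / d) ((1 / d) *\<^sub>R e)"
  by (simp add: mem_aff_iff scaleR_diff_right)

lemma norm_aff_le: "x \<in> aff c e \<Longrightarrow> norm x \<le> \<bar>c\<bar> + norm e"
proof -
  assume "x \<in> aff c e"
  then obtain w where w: "x = c *\<^sub>R w + e" "norm w \<le> 1" using norm_pentagon_le by (auto simp: aff_def)
  have "norm x \<le> \<bar>c\<bar> * norm w + norm e" unfolding w(1) by (rule norm_triangle_le) simp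
  also have "\<bar>c\<bar> * norm w \<le> \<bar>c\<bar> * 1" using w(2) by (intro mult_left_mono) auto
  finally show ?thesis by simp
qed

lemma aff_contains:
  assumes "c \<noteq> 0" "norm x + norm e < \<bar>c\<bar> * (golden / 2)" shows "x \<in> aff c e"
proof -
  have "norm (x - e) < \<bar>c\<bar> * (golden / 2)" using assms(2) norm_triangle_ineq4[of x e] by linarith
  moreover have "norm ((1 / c) *\<^sub>R (x - e)) = norm (x - e) / \<bar>c\<bar>"
    unfolding norm_scaleR by simp
  ultimately have "norm ((1 / c) *\<^sub>R (x - e)) < golden / 2"
    using assms(1) by (simp only: pos_divide_less_eq[OF zero_less_abs_iff[THEN iffD2, OF assms(1)]] mult.commute)
  then show ?thesis
    unfolding mem_aff_iff[OF assms(1)] using ball_subset_pentagon by (auto simp: dist_norm)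
qed

lemma bounded_aff: "bounded (aff c e)"
  using norm_aff_le by (auto simp: bounded_iff)

lemma convex_aff: "convex (aff c e)"
proof -
  have "aff c e = (\<lambda>x. e + x) ` (*\<^sub>R) c ` pentagon"
    by (auto simp: aff_def image_image add.commute)
  then show ?thesis using convex_pentagon by (simp add: convex_scaling convex_translation)
qed

lemma negligible_frontier_aff: "negligible (frontier (aff c e))"
  using convex_aff by (rule negligible_convex_frontier)

lemma measure_affine: "vol ((\<lambda>w. c *\<^sub>R w + e) ` (A :: complex set)) = c\<^sup>2 * vol A"
  using measure_lebesgue_affine[of c e A] by simp

definition overlap :: "complex \<Rightarrow> real" where
  "overlap e = vol (pentagon \<inter> (\<lambda>w. w + e) ` pentagon)"

lemma measure_aff: "vol (aff c e) = c\<^sup>2 * vol pentagon"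
  unfolding aff_def by (rule measure_affine)

lemma measure_aff_Int:
  assumes c: "c \<noteq> 0" and d: "e1 - e2 = c *\<^sub>R d"
  shows "vol (aff c e1 \<inter> aff c e2) = c\<^sup>2 * overlap d"
proof -
  have "aff c e1 \<inter> aff c e2 = (\<lambda>w. c *\<^sub>R w + e2) ` (pentagon \<inter> (\<lambda>w. w + d) ` pentagon)"
  proof (intro equalityI subsetI)
    fix x assume "x \<in> aff c e1 \<inter> aff c e2"
    then obtain u v where uv: "u \<in> pentagon" "v \<in> pentagon" "x = c *\<^sub>R u + e1" "x = c *\<^sub>R v + e2"
      by (auto simp: aff_def)
    have "c *\<^sub>R v = c *\<^sub>R (u + d)" using uv(3,4) d by (simp add: scaleR_add_right algebra_simps)
    then have "v = u + d" using c by simp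
    then show "x \<in> (\<lambda>w. c *\<^sub>R w + e2) ` (pentagon \<inter> (\<lambda>w. w + d) ` pentagon)" using uv by blast
  next
    fix x assume "x \<in> (\<lambda>w. c *\<^sub>R w + e2) ` (pentagon \<inter> (\<lambda>w. w + d) ` pentagon)"
    then obtain u where u: "u \<in> pentagon" "u + d \<in> pentagon" "x = c *\<^sub>R (u + d) + e2" by auto
    have "x = c *\<^sub>R u + e1" using u(3) d by (simp add: scaleR_add_right algebra_simps)
    then show "x \<in> aff c e1 \<inter> aff c e2" unfolding aff_def using u by blast
  qed
  then show ?thesis by (simp add: measure_affine overlap_def)
qed

lemma lmeasurable_aff: "aff c e \<in> lmeasurable"
  by (rule measurable_Jordan[OF bounded_aff negligible_frontier_aff])

lemma measure_lmeasurable_Diff: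
  assumes "A \<in> lmeasurable" "B \<in> lmeasurable"
  shows "vol (A - B) = vol A - vol (A \<inter> B)"
proof -
  have "A - B = A - (A \<inter> B)" by blast
  moreover have "vol (A - (A \<inter> B)) = vol A - vol (A \<inter> B)"
    using assms by (intro measurable_measure_Diff fmeasurable_Int_fmeasurable) (auto simp: fmeasurable_def)
  ultimately show ?thesis by simp
qed

section \<open>Windows, their hidden parts and the areas that remain\<close>

lemma window_eq:
  "window 1 \<epsilon> = aff 1 \<epsilon>" "window 2 \<epsilon> = aff (- golden) \<epsilon>"
  "window 3 \<epsilon> = aff golden \<epsilon>" "window 4 \<epsilon> = aff (- 1) \<epsilon>"
  by (simp_all add: window_def aff_def)

text \<open>The conjugate positions at which a point of class k is hidden. The factor
  \<open>1 / golden\<close> leads through \<open>- golden\<close> to the window of class 2k, its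
  square through \<open>golden\<^sup>2\<close> to that of class 4k; pulling these windows back gives
  the listed copies. For classes 1 and 4 the second copy is swallowed by the first and is
  omitted.\<close>

definition removed :: "nat \<Rightarrow> complex \<Rightarrow> complex set" where
  "removed k \<epsilon> =
    (if k = 1 then aff 1 (- (1 / golden) *\<^sub>R \<epsilon>)
     else if k = 2 then aff (1 / golden) (- (1 / golden) *\<^sub>R \<epsilon>) \<union> aff (1 / golden) ((1 / golden\<^sup>2) *\<^sub>R \<epsilon>)
     else if k = 3 then aff (- (1 / golden)) (- (1 / golden) *\<^sub>R \<epsilon>) \<union> aff (- (1 / golden)) ((1 / golden\<^sup>2) *\<^sub>R \<epsilon>)
     else aff (- 1) (- (1 / golden) *\<^sub>R \<epsilon>))"

definition visible_window :: "nat \<Rightarrow> complex \<Rightarrow> complex set" where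
  "visible_window k \<epsilon> = window k \<epsilon> - removed k \<epsilon>"

lemma inverse_golden_square: "1 / golden\<^sup>2 = 2 - golden"
proof -
  have "(2 - golden) * golden\<^sup>2 = 1"
    using golden_square by (simp add: power2_eq_square algebra_simps)
  then have "2 - golden = 1 / golden\<^sup>2"
    using golden_gt by (intro eq_divide_imp) simp_all
  then show ?thesis ..
qed

text \<open>The offsets between the centres. The first explains why \<open>golden\<close> times
  \<epsilon> is the argument of the overlap; the second yields the same argument after rescaling by
  \<open>golden\<close>.\<close>

lemma shift_sum: "\<epsilon> + (1 / golden) *\<^sub>R \<epsilon> = golden *\<^sub>R \<epsilon>" "(1 / golden\<^sup>2) *\<^sub>R \<epsilon> + (1 / golden) *\<^sub>R \<epsilon> = \<epsilon>" for \<epsilon> :: complex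
proof -
  have "\<epsilon> + (1 / golden) *\<^sub>R \<epsilon> = (1 + 1 / golden) *\<^sub>R \<epsilon>" by (simp add: scaleR_add_left)
  then show "\<epsilon> + (1 / golden) *\<^sub>R \<epsilon> = golden *\<^sub>R \<epsilon>" by (simp add: inverse_golden)
  have "(1 / golden\<^sup>2) *\<^sub>R \<epsilon> + (1 / golden) *\<^sub>R \<epsilon> = (1 / golden\<^sup>2 + 1 / golden) *\<^sub>R \<epsilon>" by (simp only: scaleR_add_left)
  then show "(1 / golden\<^sup>2) *\<^sub>R \<epsilon> + (1 / golden) *\<^sub>R \<epsilon> = \<epsilon>" by (simp add: inverse_golden inverse_golden_square)
qed

lemma bounded_visible_window: "bounded (visible_window k \<epsilon>)"
proof -
  have "bounded (window k \<epsilon>)"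
  proof -
    have "window k \<epsilon> = aff (if k = 1 then 1 else if k = 2 then - golden else if k = 3 then golden else - 1) \<epsilon>"
      by (simp add: window_def aff_def)
    then show ?thesis by (simp add: bounded_aff)
  qed
  then show ?thesis unfolding visible_window_def by (rule bounded_diff)
qed

lemma negligible_frontier_visible_window: "negligible (frontier (visible_window k \<epsilon>))"
proof -
  have win: "negligible (frontier (window k \<epsilon>))"
  proof -
    have "window k \<epsilon> = aff (if k = 1 then 1 else if k = 2 then - golden else if k = 3 then golden else - 1) \<epsilon>"
      by (simp add: window_def aff_def)
    then show ?thesis by (simp add: negligible_frontier_aff)
  qed
  have un: "negligible (frontier (A \<union> B))" if "negligible (frontier A)" "negligible (frontier B)" for A B :: "complex set"
    using negligible_subset[OF negligible_Un[OF that] frontier_Un_subset] .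
  have rem: "negligible (frontier (removed k \<epsilon>))"
    unfolding removed_def by (simp add: negligible_frontier_aff un)
  have eq: "visible_window k \<epsilon> = - (- window k \<epsilon> \<union> removed k \<epsilon>)"
    by (auto simp: visible_window_def)
  show ?thesis
    unfolding eq frontier_complement[of "- window k \<epsilon> \<union> removed k \<epsilon>"]
    by (rule un) (simp_all add: frontier_complement win rem)
qed

context
  fixes \<epsilon> :: complex
  assumes eps: "norm \<epsilon> < 0.1"
begin

text \<open>\<open>1 / golden\<close> and its square are below 0.6181, and 0.0619 rounds up 0.1
  times that.\<close>

lemma norm_eps_scaled: "norm ((1 / golden) *\<^sub>R \<epsilon>) < 0.0619" "norm ((1 / golden\<^sup>2) *\<^sub>R \<epsilon>) < 0.0619"
proof -
  have "(1 / golden) * norm \<epsilon> \<le> 0.6181 * norm \<epsilon>" "(1 / golden\<^sup>2) * norm \<epsilon> \<le> 0.6181 * norm \<epsilon>"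
    unfolding inverse_golden inverse_golden_square using golden_bounds by (intro mult_right_mono; simp)+
  then show "norm ((1 / golden) *\<^sub>R \<epsilon>) < 0.0619" "norm ((1 / golden\<^sup>2) *\<^sub>R \<epsilon>) < 0.0619"
    using eps golden_gt by simp_all
qed

text \<open>In classes 2 and 3 the hidden copies stay within radius 0.68, while the window contains
  the disc of radius \<open>golden\<^sup>2 / 2 - 0.1\<close>, so their area is simply
  subtracted.\<close>

lemma removed_subset:
  assumes "norm c = 1"
  shows "aff (c / golden) (- (1 / golden) *\<^sub>R \<epsilon>) \<union> aff (c / golden) ((1 / golden\<^sup>2) *\<^sub>R \<epsilon>) \<subseteq> aff (- c * golden) \<epsilon>"
proof
  fix x assume x: "x \<in> aff (c / golden) (- (1 / golden) *\<^sub>R \<epsilon>) \<union> aff (c / golden) ((1 / golden\<^sup>2) *\<^sub>R \<epsilon>)"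
  have "\<bar>c / golden\<bar> = golden - 1"
    using assms golden_gt inverse_golden by (simp add: abs_divide)
  moreover have "norm (- (1 / golden) *\<^sub>R \<epsilon>) < 0.0619" using norm_eps_scaled(1) by simp
  ultimately have "norm x < (golden - 1) + 0.0619"
    using x norm_aff_le[of x "c / golden" "- (1 / golden) *\<^sub>R \<epsilon>"]
      norm_aff_le[of x "c / golden" "(1 / golden\<^sup>2) *\<^sub>R \<epsilon>"] norm_eps_scaled(2) by (elim UnE) linarith+
  moreover have "1.618 * (1.618 / 2) \<le> golden * (golden / 2)"
    using golden_bounds by (intro mult_mono) auto
  ultimately have "norm x + norm \<epsilon> < \<bar>- c * golden\<bar> * (golden / 2)"
    using assms eps golden_bounds by (simp add: abs_mult)
  then show "x \<in> aff (- c * golden) \<epsilon>"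
    using assms golden_gt by (intro aff_contains) auto
qed

text \<open>Classes 1 and 4 lose a translate of the window itself. Classes 2 and 3, of area
  \<open>golden\<^sup>2\<close> times the pentagon, lose a union of two copies of scale
  \<open>1 / golden\<close>, whose overlap is added back.\<close>

lemma measure_visible_window:
  "vol (visible_window 1 \<epsilon>) = vol pentagon - overlap (golden *\<^sub>R \<epsilon>)"
  "vol (visible_window 4 \<epsilon>) = vol pentagon - overlap (golden *\<^sub>R \<epsilon>)"
  "vol (visible_window 2 \<epsilon>) = (3 * golden - 3) * vol pentagon + (2 - golden) * overlap (golden *\<^sub>R \<epsilon>)"
  "vol (visible_window 3 \<epsilon>) = (3 * golden - 3) * vol pentagon + (2 - golden) * overlap (golden *\<^sub>R \<epsilon>)"
proof -
  show "vol (visible_window 1 \<epsilon>) = vol pentagon - overlap (golden *\<^sub>R \<epsilon>)"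
  proof -
    have "vol (aff 1 \<epsilon> \<inter> aff 1 (- (1 / golden) *\<^sub>R \<epsilon>)) = 1\<^sup>2 * overlap (golden *\<^sub>R \<epsilon>)"
      by (rule measure_aff_Int) (simp_all add: shift_sum)
    then show ?thesis
      by (simp add: visible_window_def removed_def window_eq[simplified] measure_lmeasurable_Diff lmeasurable_aff measure_aff)
  qed
  show "vol (visible_window 4 \<epsilon>) = vol pentagon - overlap (golden *\<^sub>R \<epsilon>)"
  proof -
    have "vol (aff (- 1) (- (1 / golden) *\<^sub>R \<epsilon>) \<inter> aff (- 1) \<epsilon>) = (- 1)\<^sup>2 * overlap (golden *\<^sub>R \<epsilon>)"
      by (rule measure_aff_Int) (simp_all add: shift_sum(1)[symmetric])
    then show ?thesis
      by (simp add: visible_window_def removed_def window_eq measure_lmeasurable_Diff lmeasurable_aff measure_aff Int_commute)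
  qed
  have union: "vol (aff (- c * golden) \<epsilon> - (aff (c / golden) (- (1 / golden) *\<^sub>R \<epsilon>) \<union> aff (c / golden) ((1 / golden\<^sup>2) *\<^sub>R \<epsilon>)))
     = (3 * golden - 3) * vol pentagon + (2 - golden) * overlap (golden *\<^sub>R \<epsilon>)"
    if c: "c = 1 \<or> c = - 1" for c
  proof -
    let ?X = "aff (c / golden) (- (1 / golden) *\<^sub>R \<epsilon>)" and ?Y = "aff (c / golden) ((1 / golden\<^sup>2) *\<^sub>R \<epsilon>)"
    have sq: "(c / golden)\<^sup>2 = 2 - golden" "(- c * golden)\<^sup>2 = golden + 1" "(c * golden)\<^sup>2 = golden + 1"
      using c golden_square inverse_golden_square by (auto simp: power2_eq_square)
    have "vol (?X \<inter> ?Y) = (c / golden)\<^sup>2 * overlap (golden *\<^sub>R \<epsilon>)"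
    proof (cases "c = 1")
      case True
      have "vol (?Y \<inter> ?X) = (c / golden)\<^sup>2 * overlap (golden *\<^sub>R \<epsilon>)"
        using True golden_gt by (intro measure_aff_Int) (simp_all add: shift_sum)
      then show ?thesis by (simp add: Int_commute)
    next
      \<comment> \<open>For c = -1 the two sets are taken in the opposite order, so that the offset
        is again \<open>c / golden\<close> times \<open>golden *\<^sub>R \<epsilon>\<close>.\<close>
      case False
      have "- (1 / golden) *\<^sub>R \<epsilon> - (1 / golden\<^sup>2) *\<^sub>R \<epsilon> = - ((1 / golden\<^sup>2) *\<^sub>R \<epsilon> + (1 / golden) *\<^sub>R \<epsilon>)"
        by simp
      also have "\<dots> = - \<epsilon>" by (simp only: shift_sum)
      also have "- \<epsilon> = (c / golden) *\<^sub>R golden *\<^sub>R \<epsilon>"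
        using False c golden_gt by auto
      finally show ?thesis
        using c golden_gt by (intro measure_aff_Int) auto
    qed
    then have "vol (?X \<union> ?Y) = (2 - golden) * (2 * vol pentagon - overlap (golden *\<^sub>R \<epsilon>))"
      by (simp add: measure_Un3 lmeasurable_aff measure_aff sq algebra_simps)
    moreover have "?X \<union> ?Y \<subseteq> aff (- c * golden) \<epsilon>"
      using c by (intro removed_subset) auto
    ultimately have "vol (aff (- c * golden) \<epsilon> - (?X \<union> ?Y))
      = (golden + 1) * vol pentagon - (2 - golden) * (2 * vol pentagon - overlap (golden *\<^sub>R \<epsilon>))"
      by (simp add: measure_lmeasurable_Diff lmeasurable_aff fmeasurable.Un measure_aff sq Int_absorb1 del: minus_mult_left)
    then show ?thesis by (simp add: algebra_simps)
  qed
  show "vol (visible_window 2 \<epsilon>) = (3 * golden - 3) * vol pentagon + (2 - golden) * overlap (golden *\<^sub>R \<epsilon>)"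
    using union[of 1] by (simp add: visible_window_def removed_def window_eq)
  show "vol (visible_window 3 \<epsilon>) = (3 * golden - 3) * vol pentagon + (2 - golden) * overlap (golden *\<^sub>R \<epsilon>)"
    using union[of "- 1"] by (simp add: visible_window_def removed_def window_eq)
qed

end

section \<open>Visible points\<close>

lemma kap2_scale: "kap2 (g * c) (g * d) = (kap g * kap2 c d) mod 5"
  by (simp add: kap2_alt distrib_left[symmetric] kap_mult)

lemma kap2_scale_nonzero: "kap g \<noteq> 0 \<Longrightarrow> kap2 c d \<noteq> 0 \<Longrightarrow> kap2 (g * c) (g * d) \<noteq> 0"
  by (simp add: kap2_alt distrib_left[symmetric] kap_mult_nonzero)

lemma kap2_unscale_nonzero: "kap2 (g * c) (g * d) \<noteq> 0 \<Longrightarrow> kap2 c d \<noteq> 0"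
  by (auto simp: kap2_scale)

lemma nat_kap2: "kap2 a b \<noteq> 0 \<Longrightarrow> nat (kap2 a b) \<in> {1..4}"
  using kap_range(2)[of a b] by auto

lemma emb_in_point_set_iff:
  "emb a b \<in> point_set \<epsilon> \<longleftrightarrow> kap2 a b \<noteq> 0 \<and> emb' a b \<in> window (nat (kap2 a b)) \<epsilon>"
proof
  assume "emb a b \<in> point_set \<epsilon>"
  then obtain k :: nat where "k \<in> {1..4}" "kap2 a b = int k" "emb' a b \<in> window k \<epsilon>"
    by (auto simp: point_set_def kappa_emb sigma_emb)
  then show "kap2 a b \<noteq> 0 \<and> emb' a b \<in> window (nat (kap2 a b)) \<epsilon>" by simp
next
  assume *: "kap2 a b \<noteq> 0 \<and> emb' a b \<in> window (nat (kap2 a b)) \<epsilon>"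
  then have "nat (kap2 a b) \<in> {1..4}" "kappa (emb a b) = int (nat (kap2 a b))"
    using nat_kap2 kap_range(2)[of a b] by (auto simp: kappa_emb)
  then show "emb a b \<in> point_set \<epsilon>"
    unfolding point_set_def using * emb_in_Z_zeta5 sigma_emb by auto
qed

lemma point_set_cases:
  assumes "x \<in> point_set \<epsilon>" obtains a b where "x = emb a b"
  using assms by (auto simp: point_set_def Z_zeta5_eq)

lemma four_cases: "k \<in> {1..4} \<Longrightarrow> k = 1 \<or> k = 2 \<or> k = 3 \<or> k = (4 :: nat)"
  by auto

lemma kap_gphi: "kap gphi = 2" "kap (gphi\<^sup>2) = 4"
  by (simp_all add: kap_def power2_eq_square)

lemma rv_gphi': "rv gphi = 1 / golden"
  by (simp add: rv_gphi inverse_golden)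

text \<open>Translates the explicit copies back into the hiding conditions; a check of the four
  classes with the windows pulled back by \<open>- golden\<close> and
  \<open>golden\<^sup>2\<close>.\<close>

lemma removed_iff:
  assumes "k \<in> {1..4}"
  shows "s \<in> removed k \<epsilon> \<longleftrightarrow> (- golden) *\<^sub>R s \<in> window (2 * k mod 5) \<epsilon> \<or>
    (k = 2 \<or> k = 3) \<and> golden\<^sup>2 *\<^sub>R s \<in> window (4 * k mod 5) \<epsilon>"
proof -
  have g: "golden \<noteq> 0" "- golden \<noteq> 0" "golden\<^sup>2 \<noteq> 0" using golden_gt by simp_all
  have q: "golden / golden\<^sup>2 = 1 / golden" "- golden / golden\<^sup>2 = - (1 / golden)"
    "- golden / - golden = 1" "golden / - golden = - 1" "- 1 / - golden = 1 / golden" "- (- 1 / golden) = 1 / golden" "1 / - golden = - (1 / golden)"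
    using g by (simp_all add: power2_eq_square)
  have sc: "(- golden) *\<^sub>R s \<in> aff c \<epsilon> \<longleftrightarrow> s \<in> aff (c / - golden) (- (1 / golden) *\<^sub>R \<epsilon>)"
    "golden\<^sup>2 *\<^sub>R s \<in> aff c \<epsilon> \<longleftrightarrow> s \<in> aff (c / golden\<^sup>2) ((1 / golden\<^sup>2) *\<^sub>R \<epsilon>)" if "c \<noteq> 0" for c
    using aff_scale[OF that g(2), of s \<epsilon>] aff_scale[OF that g(3), of s \<epsilon>] by simp_all
  from four_cases[OF assms] show ?thesis
    using g by (elim disjE) (simp_all add: window_eq[unfolded One_nat_def] window_eq sc q removed_def del: scaleR_minus_left divide_minus_left)
qed

context
  fixes \<epsilon> :: complex
  assumes eps: "norm \<epsilon> < 0.1"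
begin

text \<open>All windows have scale at least 1, hence contain the disc of radius
  \<open>golden / 2 - 0.1\<close>, which is just above 0.7.\<close>

lemma window_contains:
  assumes "k \<in> {1..4}" "norm s \<le> 0.7" shows "s \<in> window k \<epsilon>"
proof -
  have "s \<in> aff c \<epsilon>" if "1 \<le> \<bar>c\<bar>" for c
  proof (rule aff_contains)
    have "1 * (golden / 2) \<le> \<bar>c\<bar> * (golden / 2)"
      using that golden_gt by (intro mult_right_mono) auto
    moreover have "norm s + norm \<epsilon> < 1 * (golden / 2)"
      using assms(2) eps golden_bounds by simp
    ultimately show "norm s + norm \<epsilon> < \<bar>c\<bar> * (golden / 2)" by linarith
  qed (use that in auto)
  then show ?thesis
    using four_cases[OF assms(1)] golden_gt by (elim disjE) (simp_all add: window_eq[unfolded One_nat_def] window_eq)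
qed

text \<open>The largest scale is \<open>golden\<close> and the pentagon lies in the unit disc;
  1.7182 exceeds \<open>golden + 0.1\<close>.\<close>

lemma norm_window:
  assumes "k \<in> {1..4}" "s \<in> window k \<epsilon>" shows "norm s < 1.7182"
proof -
  have "norm s < 1.7182" if "s \<in> aff c \<epsilon>" "\<bar>c\<bar> \<le> golden" for c
    using norm_aff_le[OF that(1)] that(2) eps golden_bounds by simp
  then show ?thesis
    using four_cases[OF assms(1)] assms(2) golden_gt
    by (elim disjE) (auto simp: window_eq[unfolded One_nat_def] window_eq)
qed

lemma small_in_point_set:
  "kap2 a b \<noteq> 0 \<Longrightarrow> norm (emb' a b) \<le> 0.7 \<Longrightarrow> emb a b \<in> point_set \<epsilon>"
  unfolding emb_in_point_set_iff using window_contains nat_kap2 by blast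

lemma norm_point_set: "emb a b \<in> point_set \<epsilon> \<Longrightarrow> norm (emb' a b) < 1.7182"
  unfolding emb_in_point_set_iff using norm_window nat_kap2 by blast

text \<open>Nonunits have norm at least 4, so replacing \<open>g\<close> by a unit slightly smaller than \<open>\<bar>g\<bar>\<close>
  multiplies the conjugate coordinate by at most \<open>\<tau> / 4\<close>, which brings it into the disc common
  to all windows.\<close>

lemma nonunit_shrink:
  assumes "emb (g * a) (g * b) \<in> point_set \<epsilon>" "g \<noteq> 0" "\<not> g dvd 1"
  obtains w where "w dvd 1" "0 < rv w" "rv w < \<bar>rv g\<bar>"
    "emb (w * a) (w * b) \<in> point_set \<epsilon>" "emb (- w * a) (- w * b) \<in> point_set \<epsilon>"
proof -
  have pos: "0 < \<bar>rv g\<bar>" using assms by simp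
  obtain w where w: "w dvd 1" "0 < rv w" "rv w \<le> \<bar>rv g\<bar>" "\<bar>rv g\<bar> < golden * rv w"
    using unit_near[OF pos] .
  have "rv w \<noteq> \<bar>rv g\<bar>"
  proof
    assume "rv w = \<bar>rv g\<bar>"
    then have "rv g = rv w \<or> rv g = rv (- w)" by auto
    then have "g = w \<or> g = - w" unfolding rv_eq_iff .
    then show False using w(1) assms(3) by auto
  qed
  then have lt: "rv w < \<bar>rv g\<bar>" using w by simp
  have "4 \<le> \<bar>rv g\<bar> * \<bar>rv' g\<bar>"
    using gnorm_nonunit_ge_4[OF assms(2,3)] unfolding abs_gnorm[symmetric] by linarith
  then have "4 / \<bar>rv g\<bar> \<le> \<bar>rv' g\<bar>" using pos by (simp add: field_simps)
  have "\<bar>rv' w\<bar> = 1 / rv w" using abs_rv'_unit[OF w(1)] w(2) by simp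
  also have "\<dots> \<le> golden / \<bar>rv g\<bar>" using w pos by (simp add: field_simps)
  also have "\<dots> = golden / 4 * (4 / \<bar>rv g\<bar>)" by simp
  also have "\<dots> \<le> golden / 4 * \<bar>rv' g\<bar>"
    using \<open>4 / \<bar>rv g\<bar> \<le> \<bar>rv' g\<bar>\<close> golden_gt by (intro mult_left_mono) auto
  finally have "\<bar>rv' w\<bar> * norm (emb' a b) \<le> golden / 4 * \<bar>rv' g\<bar> * norm (emb' a b)"
    by (intro mult_right_mono) auto
  also have "\<dots> = golden / 4 * norm (emb' (g * a) (g * b))"
    unfolding scaleR_emb(2)[symmetric] by simp
  also have "\<dots> \<le> 1.6181 / 4 * 1.7182"
    using golden_bounds norm_point_set[OF assms(1)] by (intro mult_mono) auto
  finally have small: "\<bar>rv' w\<bar> * norm (emb' a b) \<le> 0.7" by simp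
  have "kap2 (g * a) (g * b) \<noteq> 0" using assms(1) emb_in_point_set_iff by blast
  then have k0: "kap2 a b \<noteq> 0" by (rule kap2_unscale_nonzero)
  have "emb (v * a) (v * b) \<in> point_set \<epsilon>" if "v = w \<or> v = - w" for v
  proof (rule small_in_point_set)
    have "v dvd 1" using that w(1) by auto
    then show "kap2 (v * a) (v * b) \<noteq> 0"
      using k0 unit_kap_nonzero by (intro kap2_scale_nonzero) auto
    have "\<bar>rv' v\<bar> = \<bar>rv' w\<bar>" using that by auto
    then show "norm (emb' (v * a) (v * b)) \<le> 0.7"
      unfolding scaleR_emb(2)[symmetric] using small by simp
  qed
  then show ?thesis using that[OF w(1,2) lt] by blast
qed

lemma visible_imp_coprime:
  assumes "emb a b \<in> visible_points (point_set \<epsilon>)" shows "coprime a b"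
proof (rule ccontr)
  assume nc: "\<not> coprime a b"
  define g where "g = gcd a b"
  have P: "emb a b \<in> point_set \<epsilon>" and vis: "\<And>t. t \<in> {0<..<1} \<Longrightarrow> t *\<^sub>R emb a b \<notin> point_set \<epsilon>"
    using assms by (auto simp: visible_points_def)
  have "kap2 a b \<noteq> 0" using P emb_in_point_set_iff by blast
  then have "a \<noteq> 0 \<or> b \<noteq> 0" by (auto simp: kap2_def kap_def)
  then have g0: "g \<noteq> 0" by (simp add: g_def)
  have "\<not> g dvd 1" using nc unfolding g_def coprime_iff_gcd_eq_1 is_unit_gcd_iff .
  have "g dvd a" "g dvd b" by (simp_all add: g_def)
  then obtain c d where cd: "a = g * c" "b = g * d" by (auto elim!: dvdE)
  obtain w where w: "w dvd 1" "0 < rv w" "rv w < \<bar>rv g\<bar>"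
    "emb (w * c) (w * d) \<in> point_set \<epsilon>" "emb (- w * c) (- w * d) \<in> point_set \<epsilon>"
    using nonunit_shrink[OF P[unfolded cd] g0 \<open>\<not> g dvd 1\<close>] .
  have nz: "rv g \<noteq> 0" using g0 by simp
  have eq: "(rv v / rv g) *\<^sub>R emb a b = emb (v * c) (v * d)" for v
    unfolding cd scaleR_emb(1)[symmetric] using nz by simp
  show False
  proof (cases "0 < rv g")
    case True
    then have "rv w / rv g \<in> {0<..<1}" using w by simp
    from vis[OF this] show False unfolding eq using w(4) by blast
  next
    \<comment> \<open>The gcd may be negative in the first embedding; \<open>- w\<close> then keeps
      the shrinking factor positive.\<close>
    case False
    then have "rv (- w) / rv g \<in> {0<..<1}" using w nz by (simp add: field_simps)
    from vis[OF this] show False unfolding eq using w(5) by blast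
  qed
qed

lemma visible_imp_window:
  assumes "emb a b \<in> visible_points (point_set \<epsilon>)" shows "emb' a b \<in> visible_window (nat (kap2 a b)) \<epsilon>"
proof -
  have P: "emb a b \<in> point_set \<epsilon>" and vis: "\<And>t. t \<in> {0<..<1} \<Longrightarrow> t *\<^sub>R emb a b \<notin> point_set \<epsilon>"
    using assms by (auto simp: visible_points_def)
  have k0: "kap2 a b \<noteq> 0" and win: "emb' a b \<in> window (nat (kap2 a b)) \<epsilon>"
    using P emb_in_point_set_iff by blast+
  have not: "emb' (u * a) (u * b) \<notin> window (nat (kap u * kap2 a b mod 5)) \<epsilon>"
    if "0 < rv u" "rv u < 1" "kap u \<noteq> 0" for u
  proof
    assume "emb' (u * a) (u * b) \<in> window (nat (kap u * kap2 a b mod 5)) \<epsilon>"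
    then have "emb (u * a) (u * b) \<in> point_set \<epsilon>"
      unfolding emb_in_point_set_iff kap2_scale[symmetric] using kap2_scale_nonzero[OF that(3) k0] by blast
    then show False using vis[of "rv u"] that unfolding scaleR_emb(1) by simp
  qed
  have "1 / golden < 1" "0 < 1 / golden" using golden_gt by simp_all
  then have "rv gphi \<in> {0<..<1}" "rv (gphi\<^sup>2) \<in> {0<..<1}"
    unfolding rv_power rv_gphi' by (simp_all only: greaterThanLessThan_iff power_less_one_iff) (simp_all add: power_less_one_iff)
  then have n1: "emb' (gphi * a) (gphi * b) \<notin> window (nat (2 * kap2 a b mod 5)) \<epsilon>"
    and n2: "emb' (gphi\<^sup>2 * a) (gphi\<^sup>2 * b) \<notin> window (nat (4 * kap2 a b mod 5)) \<epsilon>"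
    using not[of gphi] not[of "gphi\<^sup>2"] by (simp_all add: kap_gphi)
  define k where "k = nat (kap2 a b)"
  have k: "k \<in> {1..4}" using nat_kap2[OF k0] by (simp add: k_def)
  have kk: "kap2 a b = int k" using k0 kap_range(2)[of a b] by (simp add: k_def)
  have nat_mod: "nat (2 * int k mod 5) = 2 * k mod 5" "nat (4 * int k mod 5) = 4 * k mod 5"
    by (simp_all add: nat_mod_distrib nat_mult_distrib)
  have "emb' a b \<notin> removed k \<epsilon>"
    unfolding removed_iff[OF k]
    using n1 n2 unfolding kk nat_mod scaleR_emb(2)[symmetric] rv_power rv_gphi by simp
  then show ?thesis using win by (simp add: visible_window_def k_def)
qed

text \<open>Such a \<open>u\<close> is tau to the power -n, so \<open>golden ^ n\<close> times the
  norm of the conjugate coordinate is below 1.7182. For n = 1, and for n = 2 in classes 2 and 3,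
  \<open>removed_iff\<close> applies directly. Otherwise the coordinate is below 0.67 or 0.42, hence
  inside the inscribed disc, of radius \<open>golden / 2\<close> or 1 / 2, of the copy removed for n
  = 1.\<close>

lemma unit_multiple_imp_removed:
  assumes k0: "kap2 a b \<noteq> 0" and u: "u dvd 1" "0 < rv u" "rv u < 1"
    and P: "emb (u * a) (u * b) \<in> point_set \<epsilon>"
  shows "emb' a b \<in> removed (nat (kap2 a b)) \<epsilon>"
proof -
  define k where "k = nat (kap2 a b)"
  have k: "k \<in> {1..4}" using nat_kap2[OF k0] by (simp add: k_def)
  have kk: "kap2 a b = int k" using k0 kap_range(2)[of a b] by (simp add: k_def)
  have nat_mod: "nat (2 * int k mod 5) = 2 * k mod 5" "nat (4 * int k mod 5) = 4 * k mod 5"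
    by (simp_all add: nat_mod_distrib nat_mult_distrib)
  obtain n where n: "1 \<le> n" "u * Gold 0 1 ^ n = 1"
    using small_unit_is_tau_power[OF u] .
  have "gphi * Gold 0 1 = 1" by (simp add: gold_eq_iff)
  then have "gphi ^ n * Gold 0 1 ^ n = 1" by (simp add: power_mult_distrib[symmetric])
  then have un: "u = gphi ^ n" using n(2) by (metis mult.assoc mult.commute mult_1_right)
  have win: "emb' (u * a) (u * b) \<in> window (nat (kap u * kap2 a b mod 5)) \<epsilon>"
    using P unfolding emb_in_point_set_iff kap2_scale by blast
  have norm: "golden ^ n * norm (emb' a b) < 1.7182"
    using norm_point_set[OF P] golden_gt unfolding scaleR_emb(2)[symmetric] un rv_power rv_gphi
    by (simp add: power_abs)
  note e = norm_eps_scaled[OF eps]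
  have e1: "norm (- (1 / golden) *\<^sub>R \<epsilon>) < 0.0619" using e(1) by simp
  consider "n = 1" | "n = 2" "k = 2 \<or> k = 3" | "2 \<le> n" "k = 1 \<or> k = 4" | "3 \<le> n" "k = 2 \<or> k = 3"
    using n(1) four_cases[OF k] by linarith
  then have "emb' a b \<in> removed k \<epsilon>"
  proof cases
    case 1
    then have "(- golden) *\<^sub>R emb' a b \<in> window (2 * k mod 5) \<epsilon>"
      using win unfolding un scaleR_emb(2)[symmetric] rv_power rv_gphi kk by (simp add: kap_gphi nat_mod)
    then show ?thesis unfolding removed_iff[OF k] by blast
  next
    case 2
    then have "golden\<^sup>2 *\<^sub>R emb' a b \<in> window (4 * k mod 5) \<epsilon>"
      using win unfolding un scaleR_emb(2)[symmetric] rv_power rv_gphi kk by (simp add: kap_gphi nat_mod)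
    then show ?thesis unfolding removed_iff[OF k] using 2 by blast
  next
    case 3
    have "golden\<^sup>2 \<le> golden ^ n" using 3 golden_gt by (intro power_increasing) auto
    then have "golden\<^sup>2 * norm (emb' a b) \<le> golden ^ n * norm (emb' a b)" by (rule mult_right_mono) simp
    then have "golden\<^sup>2 * norm (emb' a b) < 1.7182" using norm by linarith
    moreover have "2.6 * norm (emb' a b) \<le> golden\<^sup>2 * norm (emb' a b)"
      using golden_square golden_bounds by (intro mult_right_mono) (auto simp: power2_eq_square)
    ultimately have "norm (emb' a b) < 0.67" by simp
    moreover have "x + y < golden / 2" if "x < 0.67" "y < 0.0619" for x y :: real
      using that golden_bounds by simp
    ultimately have "norm (emb' a b) + norm (- (1 / golden) *\<^sub>R \<epsilon>) < golden / 2"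
      using e1 by blast
    then have "emb' a b \<in> aff c (- (1 / golden) *\<^sub>R \<epsilon>)" if "c = 1 \<or> c = - 1" for c
      using that by (intro aff_contains) auto
    then show ?thesis using 3(2) by (auto simp: removed_def)
  next
    case 4
    have "golden ^ 3 \<le> golden ^ n" using 4 golden_gt by (intro power_increasing) auto
    then have "golden ^ 3 * norm (emb' a b) \<le> golden ^ n * norm (emb' a b)" by (rule mult_right_mono) simp
    then have "golden ^ 3 * norm (emb' a b) < 1.7182" using norm by linarith
    moreover have "golden ^ 3 = 2 * golden + 1"
      using golden_square by (simp add: power3_eq_cube algebra_simps)
    then have "4.2 * norm (emb' a b) \<le> golden ^ 3 * norm (emb' a b)"
      using golden_bounds by (intro mult_right_mono) auto
    ultimately have small: "norm (emb' a b) < 0.42" by simp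
    have "emb' a b \<in> aff c (- (1 / golden) *\<^sub>R \<epsilon>)" if "c = 1 / golden \<or> c = - (1 / golden)" for c
    proof (rule aff_contains)
      show "c \<noteq> 0" using that golden_gt by auto
      have half: "\<bar>c\<bar> * (golden / 2) = 1 / 2" using that golden_gt by auto
      have "x + y < 1 / 2" if "x < 0.42" "y < 0.0619" for x y :: real
        using that by simp
      then show "norm (emb' a b) + norm (- (1 / golden) *\<^sub>R \<epsilon>) < \<bar>c\<bar> * (golden / 2)"
        unfolding half using small e1 by blast
    qed
    then show ?thesis using 4(2) by (auto simp: removed_def)
  qed
  then show ?thesis by (simp add: k_def)
qed

text \<open>A hiding factor t lies in the golden ring; if it is not a unit,
  \<open>nonunit_shrink\<close> replaces it by a still smaller unit that also hides the point, so
  only unit factors have to be excluded.\<close>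

lemma coprime_window_imp_visible:
  assumes cop: "coprime a b" and k0: "kap2 a b \<noteq> 0" and win: "emb' a b \<in> visible_window (nat (kap2 a b)) \<epsilon>"
  shows "emb a b \<in> visible_points (point_set \<epsilon>)"
proof -
  have "emb a b \<in> point_set \<epsilon>"
    unfolding emb_in_point_set_iff using k0 win by (simp add: visible_window_def)
  moreover have False if t: "0 < t" "t < 1" and P: "t *\<^sub>R emb a b \<in> point_set \<epsilon>" for t
  proof -
    obtain c d where cd: "t *\<^sub>R emb a b = emb c d" using P by (rule point_set_cases)
    have "Im (t *\<^sub>R emb a b) = Im (emb c d)" "Re (t *\<^sub>R emb a b) = Re (emb c d)" using cd by simp_all
    then have d: "rv d = t * rv b" and "t * (rv a + rv b * Re zeta5) = rv c + rv d * Re zeta5"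
      using Im_zeta5_pos by (simp_all add: emb_def)
    then have c: "rv c = t * rv a" by (simp add: algebra_simps)
    \<comment> \<open>Bezout recovers the factor itself: applying the combination to the multiple
      (c, d) gives an element \<open>h\<close> of the ring with \<open>rv h = t\<close>.\<close>
    obtain r s where "r * a + s * b = gcd a b" using bezout_coefficients_fst_snd by blast
    then have rs: "r * a + s * b = 1" using cop by simp
    define h where "h = r * c + s * d"
    have "rv h = t * rv (r * a + s * b)" by (simp add: h_def c d algebra_simps)
    then have h: "rv h = t" by (simp add: rs)
    have "rv c = rv (h * a)" "rv d = rv (h * b)" by (simp_all add: h c d)
    then have "c = h * a" "d = h * b" unfolding rv_eq_iff .
    then have P': "emb (h * a) (h * b) \<in> point_set \<epsilon>" using P cd by simp
    have "\<exists>u. u dvd 1 \<and> 0 < rv u \<and> rv u < 1 \<and> emb (u * a) (u * b) \<in> point_set \<epsilon>"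
    proof (cases "h dvd 1")
      case True
      then show ?thesis using h t P' by blast
    next
      case False
      have "h \<noteq> 0" using h t by auto
      then obtain w where "w dvd 1" "0 < rv w" "rv w < \<bar>rv h\<bar>" "emb (w * a) (w * b) \<in> point_set \<epsilon>"
        using nonunit_shrink[OF P' _ False] by blast
      then show ?thesis using h t by (intro exI[of _ w]) auto
    qed
    then have "emb' a b \<in> removed (nat (kap2 a b)) \<epsilon>"
      using unit_multiple_imp_removed[OF k0] by blast
    then show False using win by (simp add: visible_window_def)
  qed
  ultimately show ?thesis unfolding visible_points_def by auto
qed

lemma visible_points_Int:
  "visible_points (point_set \<epsilon>) \<inter> Y
    = (\<Union>k\<in>{1..4}. (\<lambda>(a, b). emb a b) ` prim_points (int k) Y (visible_window k \<epsilon>))"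
proof (intro equalityI subsetI)
  fix x assume x: "x \<in> visible_points (point_set \<epsilon>) \<inter> Y"
  then have "x \<in> point_set \<epsilon>" by (simp add: visible_points_def)
  then obtain a b where ab: "x = emb a b" by (rule point_set_cases)
  have k0: "kap2 a b \<noteq> 0" using \<open>x \<in> point_set \<epsilon>\<close> unfolding ab emb_in_point_set_iff by blast
  have "(a, b) \<in> prim_points (int (nat (kap2 a b))) Y (visible_window (nat (kap2 a b)) \<epsilon>)"
    using x visible_imp_coprime visible_imp_window kap_range(2)[of a b]
    unfolding ab by (auto simp: prim_points_def points_def)
  then show "x \<in> (\<Union>k\<in>{1..4}. (\<lambda>(a, b). emb a b) ` prim_points (int k) Y (visible_window k \<epsilon>))"
    using nat_kap2[OF k0] ab by (intro UN_I[of "nat (kap2 a b)"]) (auto intro!: image_eqI[of _ _ "(a, b)"])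
next
  fix x assume "x \<in> (\<Union>k\<in>{1..4}. (\<lambda>(a, b). emb a b) ` prim_points (int k) Y (visible_window k \<epsilon>))"
  then obtain k :: nat and a b where kab: "k \<in> {1..4}" "x = emb a b" "kap2 a b = int k"
    "emb a b \<in> Y" "emb' a b \<in> visible_window k \<epsilon>" "coprime a b"
    by (auto simp: prim_points_def points_def)
  then have "emb a b \<in> visible_points (point_set \<epsilon>)"
    by (intro coprime_window_imp_visible) auto
  then show "x \<in> visible_points (point_set \<epsilon>) \<inter> Y" using kab by simp
qed

lemma finite_prim_points: "bounded Y \<Longrightarrow> finite (prim_points k Y (visible_window j \<epsilon>))"
  using finite_points[OF _ bounded_visible_window, of Y k j \<epsilon>]
  by (rule rev_finite_subset) (auto simp: prim_points_def)

lemma locally_finite_visible_points: "locally_finite (visible_points (point_set \<epsilon>))"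
  unfolding locally_finite_def visible_points_Int by (intro allI impI finite_UN_I finite_imageI finite_prim_points) auto

lemma card_visible_points_Int:
  assumes "bounded Y"
  shows "card (visible_points (point_set \<epsilon>) \<inter> Y)
    = (\<Sum>k\<in>{1..4}. card (prim_points (int k) Y (visible_window k \<epsilon>)))"
proof -
  have inj: "inj_on (\<lambda>(a, b). emb a b) B" for B by (auto intro!: inj_onI)
  have "card (visible_points (point_set \<epsilon>) \<inter> Y)
      = (\<Sum>k\<in>{1..4}. card ((\<lambda>(a, b). emb a b) ` prim_points (int k) Y (visible_window k \<epsilon>)))"
    unfolding visible_points_Int
  proof (rule card_UN_disjoint)
    show "\<forall>k\<in>{1..4}. finite ((\<lambda>(a, b). emb a b) ` prim_points (int k) Y (visible_window k \<epsilon>))"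
      using finite_prim_points[OF assms] by simp
    show "\<forall>i\<in>{1..4}. \<forall>j\<in>{1..4}. i \<noteq> j \<longrightarrow> (\<lambda>(a, b). emb a b) ` prim_points (int i) Y (visible_window i \<epsilon>)
        \<inter> (\<lambda>(a, b). emb a b) ` prim_points (int j) Y (visible_window j \<epsilon>) = {}"
      by (auto simp: prim_points_def points_def)
  qed simp
  then show ?thesis by (simp add: card_image[OF inj])
qed

end

theorem theorem4p20:
  fixes \<epsilon> :: complex
  assumes "norm \<epsilon> < 0.1"
  shows "has_density (visible_points (point_set \<epsilon>))
           (((3 + golden) * measure lebesgue pentagon
              - measure lebesgue (pentagon \<inter> (\<lambda>w. w + golden *\<^sub>R \<epsilon>) ` pentagon))
            / (3 * (golden + 2) * dedekind_zeta real_subfield 2))"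
  unfolding has_density_def
proof (intro conjI allI impI)
  show "locally_finite (visible_points (point_set \<epsilon>))"
    using assms by (rule locally_finite_visible_points)
next
  fix D :: "complex set"
  assume "jordan_measurable D \<and> measure lebesgue D > 0"
  then have D: "bounded D" "negligible (frontier D)" and pos: "0 < measure lebesgue D"
    by (auto simp: jordan_measurable_def)
  define W where "W = measure lebesgue pentagon"
  define Ov where "Ov = overlap (golden *\<^sub>R \<epsilon>)"
  define z where "z = zeta_gold"
  define c where "c T k = card (prim_points (int k) ((*\<^sub>R) T ` D) (visible_window k \<epsilon>)) / T\<^sup>2" for T k
  have ratio: "(\<Sum>k\<in>{1..4}. c T k) / measure lebesgue D
      = real (card (visible_points (point_set \<epsilon>) \<inter> (*\<^sub>R) T ` D)) / measure lebesgue ((*\<^sub>R) T ` D)" for T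
    unfolding card_visible_points_Int[OF assms bounded_scaling[OF D(1)]] measure_scaleR c_def
    by (simp add: sum_divide_distrib)
  have lim: "((\<lambda>T. (\<Sum>k\<in>{1..4}. c T k) / measure lebesgue D) \<longlongrightarrow>
      (\<Sum>k\<in>{1..4}. measure lebesgue D * measure lebesgue (visible_window k \<epsilon>) / (6 * root5 * z)) / measure lebesgue D) at_top"
    unfolding c_def z_def using pos
    by (intro tendsto_divide tendsto_const tendsto_sum prim_points_limit D bounded_visible_window
        negligible_frontier_visible_window) auto
  have four: "{1..4 :: nat} = {1, 2, 3, 4}" by auto
  have "(\<Sum>k\<in>{1..4}. measure lebesgue (visible_window k \<epsilon>)) = 2 * (W - Ov) + 2 * ((3 * golden - 3) * W + (2 - golden) * Ov)"
    unfolding four W_def Ov_def using measure_visible_window[OF assms] by simp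
  also have "\<dots> = (6 * golden - 4) * W - (2 * golden - 2) * Ov"
    by (simp add: algebra_simps)
  finally have sum: "(\<Sum>k\<in>{1..4}. measure lebesgue (visible_window k \<epsilon>)) = (6 * golden - 4) * W - (2 * golden - 2) * Ov" .
  have "(\<Sum>k\<in>{1..4}. measure lebesgue D * measure lebesgue (visible_window k \<epsilon>) / (6 * root5 * z)) / measure lebesgue D
      = (\<Sum>k\<in>{1..4}. measure lebesgue (visible_window k \<epsilon>)) / (6 * root5 * z)"
    using pos by (simp add: sum_divide_distrib)
  also have "\<dots> = ((3 + golden) * W - Ov) / (3 * (golden + 2) * z)"
  proof -
    \<comment> \<open>The two fractions agree only modulo the equation of tau: the difference of the
      cross products is a multiple of tau squared - tau - 1.\<close>
    have "((6 * golden - 4) * W - (2 * golden - 2) * Ov) * (3 * (golden + 2)) - ((3 + golden) * W - Ov) * (6 * root5)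
        = (golden * golden - golden - 1) * (6 * W - 6 * Ov)"
      by (simp add: algebra_simps)
    then have eq: "((6 * golden - 4) * W - (2 * golden - 2) * Ov) * (3 * (golden + 2)) = ((3 + golden) * W - Ov) * (6 * root5)"
      unfolding golden_square by simp
    have nz: "6 * root5 \<noteq> 0" "3 * (golden + 2) \<noteq> 0" using golden_gt by simp_all
    have cross: "x / (p * z) = y / (q * z)" if "x * q = y * p" "p \<noteq> 0" "q \<noteq> 0" for x y p q :: real
    proof -
      have "x / p = y / q" using that by (simp add: frac_eq_eq)
      then show ?thesis by (metis divide_divide_eq_left)
    qed
    show ?thesis unfolding sum by (rule cross[OF eq nz])
  qed
  also have "\<dots> = ((3 + golden) * measure lebesgue pentagon
              - measure lebesgue (pentagon \<inter> (\<lambda>w. w + golden *\<^sub>R \<epsilon>) ` pentagon))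
            / (3 * (golden + 2) * dedekind_zeta real_subfield 2)"
    by (simp add: W_def Ov_def z_def overlap_def dedekind_zeta_real_subfield)
  finally show "((\<lambda>T. real (card (visible_points (point_set \<epsilon>) \<inter> (*\<^sub>R) T ` D)) / measure lebesgue ((*\<^sub>R) T ` D))
      \<longlongrightarrow> ((3 + golden) * measure lebesgue pentagon
              - measure lebesgue (pentagon \<inter> (\<lambda>w. w + golden *\<^sub>R \<epsilon>) ` pentagon))
            / (3 * (golden + 2) * dedekind_zeta real_subfield 2)) at_top"
    using lim unfolding ratio by simp
qed

end
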